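(* Let $\mathcal M$ be a von Neumann factor acting on a separable Hilbert space $H$ with a separating and cyclic unit vector $x_0$. For a linear map $\phi\in\mathbb{CB}^\sigma_\varepsilon(\mathcal M)$, the following are equivalent: (i) $\phi:\mathcal M\to\mathcal M$ is a completely positive linear map; (ii) $\tilde\phi:\mathcal B(H)\to\mathcal B(H)$ is a completely positive linear map; (iii) $\tilde\phi:\mathcal B(H)\to\mathcal B(H)$ is a positive linear map; (iv) $\mathrm C_\phi$ is a positive operator in $\mathcal B(H)$; (v) $\mathrm D_\phi$ is a positive operator in $\mathcal T(H)$; (vi) $\phi=\sum_{i=1}^\infty \mathrm{Ad}_{V_i}$ in the point-weak topology, for some $V_i\in\mathcal M$ with $\sum_{i=1}^\infty V_i^*V_i\le \|\phi\|_{\rm cb}I$.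
   Context: Inner products $(\cdot|\cdot)$ are linear in the first variable. $\mathcal B(H)$ denotes the bounded operators and $\mathcal T(H)=\mathcal B(H)_*$ the trace class operators on $H$, paired by $\langle A,B\rangle=\operatorname{Tr}(AB)$. For $x,y\in H$, $x\boxtimes y$ is the operator $z\mapsto (z|y)x$. A map is normal if it is continuous for the $\sigma$-weak topologies. For a normal linear map $\Phi:\mathcal B(H)\to\mathcal B(H)$, its predual map $\Phi_*:\mathcal T(H)\to\mathcal T(H)$ is defined by $\langle A,\Phi_*(B)\rangle=\langle\Phi(A),B\rangle$. Let $\mathcal M'$ be the commutant of $\mathcal M$ and $\mathrm{alg}(\mathcal M',\mathcal M)$ the algebra generated by $\mathcal M$ and $\mathcal M'$, i.e. the linear span of products $A'B$ with $A'\in\mathcal M'$, $B\in\mathcal M$; it is weakly dense in $\mathcal B(H)$ and is $*$-isomorphic to the algebraic tensor product $\mathcal M'\otimes\mathcal M$. For a linear map $\phi:\mathcal M\to\mathcal M$, define the (well-defined) linear map $\tilde\phi$ on $\mathrm{alg}(\mathcal M',\mathcal M)$ by $\tilde\phi(\sum_i A_i'B_i)=\sum_i A_i'\phi(B_i)$. $\mathbb{CB}^\sigma_\varepsilon(\mathcal M)$ is the space of linear maps $\phi:\mathcal M\to\mathcal M$ such that $\tilde\phi$ extends to a normal map on $\mathcal B(H)$, the extension still being denoted $\tilde\phi$ (such $\phi$ are automatically normal and completely bounded, and $\|\cdot\|_{\rm cb}$ is the completely bounded norm). With $E_0=x_0\boxtimes x_0$ the projection onto $\mathbb C x_0$, for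 $\phi\in\mathbb{CB}^\sigma_\varepsilon(\mathcal M)$ put $\mathrm C_\phi=\tilde\phi(E_0)\in\mathcal B(H)$ and $\mathrm D_\phi=\tilde\phi_*(E_0)\in\mathcal T(H)$. For $V\in\mathcal M$, $\mathrm{Ad}_V(A)=V^*AV$ for $A\in\mathcal M$. *)

theory Defs
  imports "HOL-Analysis.Analysis"
begin

section \<open>Complex Hilbert spaces\<close>

class complex_vector = ab_group_add +
  fixes scaleC :: "complex \<Rightarrow> 'a \<Rightarrow> 'a"  (infixr \<open>*\<^sub>C\<close> 75)
  assumes scaleC_add_right: "a *\<^sub>C (x + y) = a *\<^sub>C x + a *\<^sub>C y"
    and scaleC_add_left: "(a + b) *\<^sub>C x = a *\<^sub>C x + b *\<^sub>C x"
    and scaleC_scaleC: "a *\<^sub>C (b *\<^sub>C x) = (a * b) *\<^sub>C x"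
    and scaleC_one: "1 *\<^sub>C x = x"

lemma vector_space_scaleC: "vector_space (scaleC :: complex \<Rightarrow> 'a \<Rightarrow> 'a::complex_vector)"
  by unfold_locales (simp_all add: scaleC_add_right scaleC_add_left scaleC_scaleC scaleC_one)

lemma scaleC_zero_right: "a *\<^sub>C 0 = (0 :: 'a::complex_vector)"
  and scaleC_minus_right: "a *\<^sub>C (- x) = - (a *\<^sub>C (x :: 'a::complex_vector))"
  and scaleC_diff_right: "a *\<^sub>C (x - y) = a *\<^sub>C x - a *\<^sub>C (y :: 'a::complex_vector)"
proof -
  interpret vector_space "scaleC :: complex \<Rightarrow> 'a \<Rightarrow> 'a"
    by (rule vector_space_scaleC)
  show "a *\<^sub>C 0 = (0::'a)" "a *\<^sub>C (- x) = - (a *\<^sub>C x)" "a *\<^sub>C (x - y) = a *\<^sub>C x - a *\<^sub>C y"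
    by (rule scale_zero_right scale_minus_right scale_right_diff_distrib)+
qed

class chilbert_space = banach + complex_vector +
  fixes cinner :: "'a \<Rightarrow> 'a \<Rightarrow> complex"
  assumes scaleR_scaleC: "r *\<^sub>R x = complex_of_real r *\<^sub>C x"
    and cinner_add_left: "cinner (x + y) z = cinner x z + cinner y z"
    and cinner_scaleC_left: "cinner (a *\<^sub>C x) y = a * cinner x y"
    and cinner_commute: "cinner x y = cnj (cinner y x)"
    and cinner_self: "cinner x x = complex_of_real ((norm x)\<^sup>2)"

lemma cinner_add_right: "cinner x (y + z) = cinner x y + cinner x (z :: 'h::chilbert_space)"
  by (metis cinner_add_left cinner_commute complex_cnj_add)

lemma cinner_scaleC_right: "cinner x (a *\<^sub>C y) = cnj a * cinner x (y :: 'h::chilbert_space)"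
  by (metis cinner_commute cinner_scaleC_left complex_cnj_mult)

lemma norm_scaleC: "norm (a *\<^sub>C x) = cmod a * norm (x :: 'h::chilbert_space)"
proof -
  have "complex_of_real ((norm (a *\<^sub>C x))\<^sup>2) = (a * cnj a) * complex_of_real ((norm x)\<^sup>2)"
    by (simp add: cinner_self[symmetric] cinner_scaleC_left cinner_scaleC_right
        del: of_real_power)
  also have "\<dots> = complex_of_real ((cmod a * norm x)\<^sup>2)"
    by (simp only: power_mult_distrib of_real_mult complex_norm_square[symmetric])
  finally have "(norm (a *\<^sub>C x))\<^sup>2 = (cmod a * norm x)\<^sup>2"
    by (simp only: of_real_eq_iff)
  then show ?thesis
    by (simp add: power2_eq_iff_nonneg)
qed

lemma cinner_Cauchy_Schwarz: "cmod (cinner x y) \<le> norm x * norm (y :: 'h::chilbert_space)"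
proof (cases "y = 0")
  case True
  have "cinner x (0 + 0) = cinner x (0::'h) + cinner x 0"
    by (rule cinner_add_right)
  then show ?thesis using True by simp
next
  case False
  define c where "c = cinner x y"
  define n where "n = (norm y)\<^sup>2"
  have n: "n > 0" using False by (simp add: n_def)
  define a where "a = - (c / complex_of_real n)"
  let ?z = "x + a *\<^sub>C y"
  have "complex_of_real ((norm ?z)\<^sup>2) = cinner ?z ?z"
    by (rule cinner_self[symmetric])
  also have "\<dots> = complex_of_real ((norm x)\<^sup>2) + cnj a * c + a * cnj c
      + a * cnj a * complex_of_real n"
    by (simp add: cinner_add_left cinner_add_right cinner_scaleC_left cinner_scaleC_right
        cinner_self[of x] cinner_self[of y] cinner_commute[of y x] c_def n_def algebra_simps
        del: of_real_power)
  also have "\<dots> = complex_of_real ((norm x)\<^sup>2) - c * cnj c / complex_of_real n"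
    using n by (simp add: a_def)
  also have "\<dots> = complex_of_real ((norm x)\<^sup>2 - (cmod c)\<^sup>2 / n)"
    by (simp only: complex_norm_square[symmetric] of_real_diff of_real_divide)
  finally have "(norm ?z)\<^sup>2 = (norm x)\<^sup>2 - (cmod c)\<^sup>2 / n"
    by (simp only: of_real_eq_iff)
  then have "(cmod c)\<^sup>2 / n \<le> (norm x)\<^sup>2"
    by (metis diff_ge_0_iff_ge zero_le_power2)
  then have "(cmod c)\<^sup>2 \<le> (norm x * norm y)\<^sup>2"
    using n by (simp add: n_def field_simps power_mult_distrib)
  then show ?thesis
    unfolding c_def by (rule power2_le_imp_le) simp
qed

definition is_onb :: "'h::chilbert_space set \<Rightarrow> bool" where
  "is_onb E \<longleftrightarrow> (\<forall>e\<in>E. norm e = 1) \<and> (\<forall>e\<in>E. \<forall>f\<in>E. e \<noteq> f \<longrightarrow> cinner e f = 0)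
     \<and> closure (module.span scaleC E) = UNIV"

section \<open>Bounded operators\<close>

typedef (overloaded) 'h bop =
  "{T :: 'h::chilbert_space \<Rightarrow> 'h. bounded_linear T \<and> (\<forall>c x. T (c *\<^sub>C x) = c *\<^sub>C T x)}"
  morphisms bop_apply Abs_bop
  by (rule exI[of _ id]) (simp add: id_def)

setup_lifting type_definition_bop

notation bop_apply (infixr \<open>*\<^sub>V\<close> 70)

lemma bop_eqI: "(\<And>x. A *\<^sub>V x = B *\<^sub>V x) \<Longrightarrow> A = B"
  by (simp add: bop_apply_inject[symmetric] fun_eq_iff)

lemma bop_apply_add: "A *\<^sub>V (x + y) = A *\<^sub>V x + A *\<^sub>V y"
  by transfer (simp add: linear_add bounded_linear.linear)

instantiation bop :: (chilbert_space) "{ring, monoid_mult, complex_vector}"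
begin

lift_definition zero_bop :: "'a bop" is "\<lambda>_. 0"
  by (simp add: scaleC_zero_right)

lift_definition one_bop :: "'a bop" is "\<lambda>x. x"
  by simp

lift_definition plus_bop :: "'a bop \<Rightarrow> 'a bop \<Rightarrow> 'a bop" is "\<lambda>S T x. S x + T x"
  by (simp add: bounded_linear_add scaleC_add_right)

lift_definition scaleC_bop :: "complex \<Rightarrow> 'a bop \<Rightarrow> 'a bop" is "\<lambda>c T x. c *\<^sub>C T x"
proof
  fix c :: complex and T :: "'a \<Rightarrow> 'a"
  assume T: "bounded_linear T \<and> (\<forall>c x. T (c *\<^sub>C x) = c *\<^sub>C T x)"
  have "bounded_linear (\<lambda>x::'a. c *\<^sub>C x)"
    by (rule bounded_linear_intro[of _ "cmod c"])
      (simp_all add: scaleC_add_right scaleR_scaleC scaleC_scaleC norm_scaleC mult.commute)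
  then show "bounded_linear (\<lambda>x. c *\<^sub>C T x)"
    using T bounded_linear_compose by blast
  show "\<forall>d x. c *\<^sub>C T (d *\<^sub>C x) = d *\<^sub>C c *\<^sub>C T x"
    using T by (simp add: scaleC_scaleC mult.commute)
qed

lift_definition uminus_bop :: "'a bop \<Rightarrow> 'a bop" is "\<lambda>T x. - T x"
  by (simp add: bounded_linear_minus scaleC_minus_right)

lift_definition minus_bop :: "'a bop \<Rightarrow> 'a bop \<Rightarrow> 'a bop" is "\<lambda>S T x. S x - T x"
  by (simp add: bounded_linear_sub scaleC_diff_right)

lift_definition times_bop :: "'a bop \<Rightarrow> 'a bop \<Rightarrow> 'a bop" is "\<lambda>S T x. S (T x)"
  by (auto intro: bounded_linear_compose)

instance
  by standard
    (rule bop_eqI, simp add: zero_bop.rep_eq one_bop.rep_eq plus_bop.rep_eq scaleC_bop.rep_eq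
      uminus_bop.rep_eq minus_bop.rep_eq times_bop.rep_eq bop_apply_add add.assoc add.commute
      scaleC_add_right scaleC_add_left scaleC_scaleC scaleC_one)+

end

lift_definition rank_one :: "'h::chilbert_space \<Rightarrow> 'h \<Rightarrow> 'h bop"  (infix \<open>\<boxtimes>\<close> 75)
  is "\<lambda>x y z. cinner z y *\<^sub>C x"
proof
  fix x y :: 'h
  show "bounded_linear (\<lambda>z. cinner z y *\<^sub>C x)"
  proof (rule bounded_linear_intro[of _ "norm y * norm x"])
    fix z
    have "cmod (cinner z y) * norm x \<le> (norm z * norm y) * norm x"
      by (intro mult_right_mono cinner_Cauchy_Schwarz) simp
    then show "norm (cinner z y *\<^sub>C x) \<le> norm z * (norm y * norm x)"
      by (simp add: norm_scaleC mult.assoc)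
  qed (simp_all add: cinner_add_left scaleC_add_left scaleR_scaleC cinner_scaleC_left scaleC_scaleC)
  show "\<forall>c z. cinner (c *\<^sub>C z) y *\<^sub>C x = c *\<^sub>C cinner z y *\<^sub>C x"
    by (simp add: cinner_scaleC_left scaleC_scaleC)
qed

definition adj :: "'h::chilbert_space bop \<Rightarrow> 'h bop" where
  "adj A = (THE B. \<forall>x y. cinner (A *\<^sub>V x) y = cinner x (B *\<^sub>V y))"

definition positive_op :: "'h::chilbert_space bop \<Rightarrow> bool" where
  "positive_op A \<longleftrightarrow> (\<forall>x. cinner (A *\<^sub>V x) x \<in> \<real>\<^sub>\<ge>\<^sub>0)"

definition wot_sums :: "(nat \<Rightarrow> 'h::chilbert_space bop) \<Rightarrow> 'h bop \<Rightarrow> bool" where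
  "wot_sums T S \<longleftrightarrow> (\<forall>x y. (\<lambda>i. cinner (T i *\<^sub>V x) y) sums cinner (S *\<^sub>V x) y)"

definition Ad :: "'h::chilbert_space bop \<Rightarrow> 'h bop \<Rightarrow> 'h bop" where
  "Ad V A = adj V * A * V"

section \<open>Trace class operators and normal maps\<close>

definition abs_op :: "'h::chilbert_space bop \<Rightarrow> 'h bop" where
  "abs_op A = (THE P. positive_op P \<and> P * P = adj A * A)"

definition trace_class :: "'h::chilbert_space bop set" where
  "trace_class = {A. \<exists>E. is_onb E \<and> (\<lambda>e. cinner (abs_op A *\<^sub>V e) e) summable_on E}"

text \<open>For trace class operators the value does not depend on the chosen orthonormal basis.\<close>

definition op_trace :: "'h::chilbert_space bop \<Rightarrow> complex" where
  "op_trace A = (\<Sum>\<^sub>\<infinity>e\<in>(SOME E. is_onb E). cinner (A *\<^sub>V e) e)"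

text \<open>The weak* topology of \<open>B(H)\<close> as the dual of the trace class operators.\<close>

definition sigma_weak :: "'h::chilbert_space bop topology" where
  "sigma_weak = topology_generated_by
     {{A. op_trace (A * B) \<in> U} | B U. B \<in> trace_class \<and> open U}"

definition normal_map :: "('h::chilbert_space bop \<Rightarrow> 'h bop) \<Rightarrow> bool" where
  "normal_map \<Phi> \<longleftrightarrow> continuous_map sigma_weak sigma_weak \<Phi>"

definition predual_map :: "('h::chilbert_space bop \<Rightarrow> 'h bop) \<Rightarrow> 'h bop \<Rightarrow> 'h bop" where
  "predual_map \<Phi> B = (THE C. C \<in> trace_class \<and> (\<forall>A. op_trace (A * C) = op_trace (\<Phi> A * B)))"

section \<open>Linear, positive and completely positive maps\<close>

text \<open>Maps defined on a linear subspace \<open>S\<close> of \<open>B(H)\<close> are represented by total functions, of which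
  only the values on \<open>S\<close> matter.\<close>

definition linear_map_on :: "'h::chilbert_space bop set \<Rightarrow> ('h bop \<Rightarrow> 'h bop) \<Rightarrow> bool" where
  "linear_map_on S \<phi> \<longleftrightarrow> (\<forall>A\<in>S. \<forall>B\<in>S. \<phi> (A + B) = \<phi> A + \<phi> B)
     \<and> (\<forall>c. \<forall>A\<in>S. \<phi> (c *\<^sub>C A) = c *\<^sub>C \<phi> A)"

definition positive_map_on :: "'h::chilbert_space bop set \<Rightarrow> ('h bop \<Rightarrow> 'h bop) \<Rightarrow> bool" where
  "positive_map_on S \<phi> \<longleftrightarrow> linear_map_on S \<phi> \<and> (\<forall>A\<in>S. positive_op A \<longrightarrow> positive_op (\<phi> A))"

text \<open>A matrix of operators \<open>A i j\<close> with \<open>i, j < n\<close> acts on the direct sum \<open>H\<^sup>n\<close>, whose elements are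
  families \<open>x i\<close> with \<open>i < n\<close>; entries with other indices are ignored.\<close>

definition tuple_inner :: "nat \<Rightarrow> (nat \<Rightarrow> 'h::chilbert_space) \<Rightarrow> (nat \<Rightarrow> 'h) \<Rightarrow> complex" where
  "tuple_inner n x y = (\<Sum>i<n. cinner (x i) (y i))"

definition tuple_norm :: "nat \<Rightarrow> (nat \<Rightarrow> 'h::chilbert_space) \<Rightarrow> real" where
  "tuple_norm n x = sqrt (\<Sum>i<n. (norm (x i))\<^sup>2)"

definition mat_apply ::
    "nat \<Rightarrow> (nat \<Rightarrow> nat \<Rightarrow> 'h::chilbert_space bop) \<Rightarrow> (nat \<Rightarrow> 'h) \<Rightarrow> nat \<Rightarrow> 'h" where
  "mat_apply n A x = (\<lambda>i. \<Sum>j<n. A i j *\<^sub>V x j)"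

definition mat_positive :: "nat \<Rightarrow> (nat \<Rightarrow> nat \<Rightarrow> 'h::chilbert_space bop) \<Rightarrow> bool" where
  "mat_positive n A \<longleftrightarrow> (\<forall>x. tuple_inner n (mat_apply n A x) x \<in> \<real>\<^sub>\<ge>\<^sub>0)"

definition mat_norm :: "nat \<Rightarrow> (nat \<Rightarrow> nat \<Rightarrow> 'h::chilbert_space bop) \<Rightarrow> real" where
  "mat_norm n A = (SUP x\<in>{x. tuple_norm n x \<le> 1}. tuple_norm n (mat_apply n A x))"

definition matrices :: "nat \<Rightarrow> 'a set \<Rightarrow> (nat \<Rightarrow> nat \<Rightarrow> 'a) set" where
  "matrices n S = {A. \<forall>i<n. \<forall>j<n. A i j \<in> S}"

definition amplify :: "('a \<Rightarrow> 'b) \<Rightarrow> (nat \<Rightarrow> nat \<Rightarrow> 'a) \<Rightarrow> nat \<Rightarrow> nat \<Rightarrow> 'b" where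
  "amplify \<phi> A = (\<lambda>i j. \<phi> (A i j))"

definition completely_positive_on ::
    "'h::chilbert_space bop set \<Rightarrow> ('h bop \<Rightarrow> 'h bop) \<Rightarrow> bool" where
  "completely_positive_on S \<phi> \<longleftrightarrow> linear_map_on S \<phi>
     \<and> (\<forall>n. \<forall>A\<in>matrices n S. mat_positive n A \<longrightarrow> mat_positive n (amplify \<phi> A))"

text \<open>As a supremum of reals, this is the completely bounded norm only of completely bounded maps.\<close>

definition cb_norm_on :: "'h::chilbert_space bop set \<Rightarrow> ('h bop \<Rightarrow> 'h bop) \<Rightarrow> real" where
  "cb_norm_on S \<phi> =
     (SUP (n, A)\<in>{(n, A). A \<in> matrices n S \<and> mat_norm n A \<le> 1}. mat_norm n (amplify \<phi> A))"

section \<open>Von Neumann algebras\<close>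

definition commutant :: "'h::chilbert_space bop set \<Rightarrow> 'h bop set" where
  "commutant S = {A. \<forall>B\<in>S. A * B = B * A}"

definition von_neumann_algebra :: "'h::chilbert_space bop set \<Rightarrow> bool" where
  "von_neumann_algebra M \<longleftrightarrow> (\<forall>A\<in>M. adj A \<in> M) \<and> commutant (commutant M) = M"

definition factor :: "'h::chilbert_space bop set \<Rightarrow> bool" where
  "factor M \<longleftrightarrow> von_neumann_algebra M \<and> M \<inter> commutant M = range (\<lambda>c. c *\<^sub>C 1)"

definition cyclic_vector :: "'h::chilbert_space bop set \<Rightarrow> 'h \<Rightarrow> bool" where
  "cyclic_vector M x \<longleftrightarrow> closure {A *\<^sub>V x | A. A \<in> M} = UNIV"

definition separating_vector :: "'h::chilbert_space bop set \<Rightarrow> 'h \<Rightarrow> bool" where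
  "separating_vector M x \<longleftrightarrow> (\<forall>A\<in>M. A *\<^sub>V x = 0 \<longrightarrow> A = 0)"

definition normal_extension ::
    "'h::chilbert_space bop set \<Rightarrow> ('h bop \<Rightarrow> 'h bop) \<Rightarrow> ('h bop \<Rightarrow> 'h bop) \<Rightarrow> bool" where
  "normal_extension M \<phi> \<Phi> \<longleftrightarrow> linear_map_on UNIV \<Phi> \<and> normal_map \<Phi>
     \<and> (\<forall>(n::nat) A' B. (\<forall>i<n. A' i \<in> commutant M \<and> B i \<in> M) \<longrightarrow>
          \<Phi> (\<Sum>i<n. A' i * B i) = (\<Sum>i<n. A' i * \<phi> (B i)))"

definition CB_sigma :: "'h::chilbert_space bop set \<Rightarrow> ('h bop \<Rightarrow> 'h bop) set" where
  "CB_sigma M = {\<phi>. linear_map_on M \<phi> \<and> \<phi> ` M \<subseteq> M \<and> (\<exists>\<Phi>. normal_extension M \<phi> \<Phi>)}"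

text \<open>For a factor \<open>M\<close> the extension is unique, as the algebra generated by \<open>M\<close> and its commutant is
  \<open>\<sigma>\<close>-weakly dense.\<close>

definition tilde :: "'h::chilbert_space bop set \<Rightarrow> ('h bop \<Rightarrow> 'h bop) \<Rightarrow> 'h bop \<Rightarrow> 'h bop" where
  "tilde M \<phi> = (THE \<Phi>. normal_extension M \<phi> \<Phi>)"

definition C_op :: "'h::chilbert_space bop set \<Rightarrow> 'h \<Rightarrow> ('h bop \<Rightarrow> 'h bop) \<Rightarrow> 'h bop" where
  "C_op M x\<^sub>0 \<phi> = tilde M \<phi> (x\<^sub>0 \<boxtimes> x\<^sub>0)"

definition D_op :: "'h::chilbert_space bop set \<Rightarrow> 'h \<Rightarrow> ('h bop \<Rightarrow> 'h bop) \<Rightarrow> 'h bop" where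
  "D_op M x\<^sub>0 \<phi> = predual_map (tilde M \<phi>) (x\<^sub>0 \<boxtimes> x\<^sub>0)"

end

theory Submission
  imports Defs
begin

text \<open>
  A \<open>\<sigma>\<close>-weakly continuous functional on \<open>B(H)\<close> has the form \<open>A \<mapsto> \<Sum>k. \<langle>A a\<^sub>k, b\<^sub>k\<rangle>\<close> with
  square-summable \<open>a, b\<close>.  As \<open>M\<close> is a factor, the algebra generated by \<open>M\<close> and \<open>M'\<close> has trivial
  commutant, and von Neumann's density argument on \<open>\<ell>\<^sup>2(H)\<close> shows that such a functional is
  determined by its values on that algebra, and is positive if it is nonnegative on the elements
  \<open>X\<^sup>*X\<close> of it.  So \<open>\<Phi>\<close>, the extension of \<open>\<phi>\<close>, is an \<open>M'\<close>-bimodule map, and it is positive if \<open>\<phi>\<close> is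
  completely positive.

  Since \<open>M'x\<^sub>0\<close> is dense, \<open>\<Phi>\<close> is determined by \<open>C = \<Phi>(x\<^sub>0 \<boxtimes> x\<^sub>0)\<close> through
  \<open>\<Phi>(A'x\<^sub>0 \<boxtimes> B'x\<^sub>0) = A'CB'\<^sup>*\<close>.  If \<open>C = R\<^sup>2\<close> is positive, put \<open>v\<^sub>k = R e\<^sub>k\<close> for an orthonormal basis \<open>e\<close>.
  Positivity of \<open>\<Phi>\<close> on rank one operators bounds \<open>\<parallel>A'v\<^sub>k\<parallel>\<close> by a multiple of \<open>\<parallel>A'x\<^sub>0\<parallel>\<close>, so
  \<open>A'x\<^sub>0 \<mapsto> A'v\<^sub>k\<close> extends to an operator in \<open>M'' = M\<close>; the adjoints of these operators are the \<open>V\<^sub>k\<close>, and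
  \<open>\<Phi> = \<Sum>k. Ad(V\<^sub>k)\<close> on all of \<open>B(H)\<close>.
\<close>

section \<open>Inner products\<close>

text \<open>Normality is given by a topology, so it must first be made concrete: a linear functional
  bounded on a \<open>sigma_weak\<close> neighbourhood of \<open>0\<close> vanishes on the common
  kernel of finitely many trace functionals, hence is a combination of them. The step from (i) is
  delicate because \<open>X\<^sup>*X\<close> is quadratic in \<open>X\<close>, which weak
  approximation does not control. The density argument approximates strongly, but at one vector of
  \<open>\<ell>\<^sup>2(H)\<close>; interleaving the two vectors that represent a functional lets
  one sequence serve both. In the other direction, positivity of \<open>C\<close> yields positivity
  of \<open>\<Phi>\<close> only on the operators \<open>x \<boxtimes> x\<close> with
  \<open>x\<close> in \<open>M'x\<^sub>0\<close>. Continuity and the Parseval expansion of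
  \<open>ZZ\<^sup>*\<close> spread it to all operators \<open>ZZ\<^sup>*\<close>, and comparing
  \<open>y \<boxtimes> y\<close> with \<open>\<parallel>y\<parallel>\<^sup>2 1\<close> makes a bound
  of \<open>\<Phi>(1)\<close> the constant in the estimate of the \<open>V\<^sub>k\<close>.
  Condition (v) is tied to the others by \<open>\<langle>Dx, y\<rangle> = \<langle>\<Phi>(x
  \<boxtimes> y)x\<^sub>0, x\<^sub>0\<rangle>\<close>. The norm estimate in (vi) needs an a priori
  bound, since \<open>cb_norm_on\<close> is a supremum of reals and means nothing for an unbounded
  set.\<close>

interpretation scaleC: bounded_bilinear "scaleC :: complex \<Rightarrow> 'h \<Rightarrow> 'h::chilbert_space"
proof
  fix r :: real and a :: complex and x :: 'h
  show "(r *\<^sub>R a) *\<^sub>C x = r *\<^sub>R a *\<^sub>C x" "a *\<^sub>C r *\<^sub>R x = r *\<^sub>R a *\<^sub>C x"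
    by (simp_all add: scaleR_scaleC scaleC_scaleC scaleR_conv_of_real mult.commute)
  show "\<exists>K. \<forall>a (x::'h). norm (a *\<^sub>C x) \<le> norm a * norm x * K"
    by (rule exI[of _ 1]) (simp add: norm_scaleC)
qed (simp_all add: scaleC_add_left scaleC_add_right)

interpretation cinner: bounded_bilinear "cinner :: 'h \<Rightarrow> 'h::chilbert_space \<Rightarrow> complex"
proof
  fix r :: real and x y :: 'h
  show "cinner (r *\<^sub>R x) y = r *\<^sub>R cinner x y" "cinner x (r *\<^sub>R y) = r *\<^sub>R cinner x y"
    by (simp_all add: scaleR_scaleC cinner_scaleC_left cinner_scaleC_right scaleR_conv_of_real)
  show "\<exists>K. \<forall>x y::'h. norm (cinner x y) \<le> norm x * norm y * K"
    by (rule exI[of _ 1]) (simp add: cinner_Cauchy_Schwarz)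
qed (simp_all add: cinner_add_left cinner_add_right)

declare cinner.zero_left [simp] cinner.zero_right [simp] scaleC.zero_left [simp]
  scaleC.zero_right [simp] scaleC_one [simp]

text \<open>Lets the real part of a Parseval series on the diagonal be read as a series of
  squares.\<close>

lemma cmod_cinner_mult: "cmod (cinner x y) ^ 2 = Re (cinner x y * cinner y x)"
  by (subst cinner_commute[of y x]) (simp add: complex_norm_square[symmetric] del: of_real_power)

lemma norm_diff_square: "(norm (x - y :: 'h::chilbert_space))\<^sup>2 = (norm x)\<^sup>2 + (norm y)\<^sup>2 - 2 * Re (cinner x y)"
proof -
  have "(norm (x - y))\<^sup>2 = Re (cinner (x - y) (x - y))"
    by (simp add: cinner_self)
  also have "\<dots> = (norm x)\<^sup>2 + (norm y)\<^sup>2 - (Re (cinner x y) + Re (cinner y x))"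
    by (simp add: cinner.diff_left cinner.diff_right cinner_self[of x] cinner_self[of y])
  also have "Re (cinner y x) = Re (cinner x y)"
    by (subst cinner_commute) simp
  finally show ?thesis by simp
qed

lemma norm_add_square: "(norm (x + y :: 'h::chilbert_space))\<^sup>2 = (norm x)\<^sup>2 + (norm y)\<^sup>2 + 2 * Re (cinner x y)"
  using norm_diff_square[of x "- y"] by (simp add: cinner.minus_right)

lemma cinner_eq_zero_iff: "cinner x x = 0 \<longleftrightarrow> x = (0::'h::chilbert_space)"
  by (simp add: cinner_self)

lemma cinner_extI: "(\<And>y. cinner x y = cinner x' y) \<Longrightarrow> x = (x'::'h::chilbert_space)"
  by (metis cinner.diff_left cinner_eq_zero_iff right_minus_eq)

section \<open>Closed subspaces and orthogonal projections\<close>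

definition csubspace :: "'h::complex_vector set \<Rightarrow> bool" where
  "csubspace S \<longleftrightarrow> 0 \<in> S \<and> (\<forall>x\<in>S. \<forall>y\<in>S. x + y \<in> S) \<and> (\<forall>c. \<forall>x\<in>S. c *\<^sub>C x \<in> S)"

lemma csubspaceI:
  "0 \<in> S \<Longrightarrow> (\<And>x y. x \<in> S \<Longrightarrow> y \<in> S \<Longrightarrow> x + y \<in> S) \<Longrightarrow> (\<And>c x. x \<in> S \<Longrightarrow> c *\<^sub>C x \<in> S) \<Longrightarrow> csubspace S"
  by (auto simp: csubspace_def)

lemma csubspace_0: "csubspace S \<Longrightarrow> 0 \<in> S"
  and csubspace_add: "csubspace S \<Longrightarrow> x \<in> S \<Longrightarrow> y \<in> S \<Longrightarrow> x + y \<in> S"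
  and csubspace_scaleC: "csubspace S \<Longrightarrow> x \<in> S \<Longrightarrow> c *\<^sub>C x \<in> S"
  by (auto simp: csubspace_def)

lemma scaleC_minus_one: "(- 1) *\<^sub>C x = - (x :: 'a::complex_vector)"
proof -
  interpret vector_space "scaleC :: complex \<Rightarrow> 'a \<Rightarrow> 'a"
    by (rule vector_space_scaleC)
  show ?thesis using scale_minus_left[of 1 x] by (simp add: scaleC_one)
qed

lemma csubspace_diff: "csubspace S \<Longrightarrow> x \<in> S \<Longrightarrow> y \<in> S \<Longrightarrow> x - y \<in> S"
  using csubspace_add[of S x "(-1) *\<^sub>C y"] csubspace_scaleC[of S y "-1"]
  by (simp add: scaleC_minus_one)

lemma csubspace_closure: "csubspace S \<Longrightarrow> csubspace (closure (S :: 'h::chilbert_space set))"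
proof (rule csubspaceI)
  assume S: "csubspace S"
  show "0 \<in> closure S" using csubspace_0[OF S] closure_subset by blast
  fix x y c assume x: "x \<in> closure S"
  then obtain f where f: "\<And>n. f n \<in> S" "f \<longlonglongrightarrow> x" unfolding closure_sequential by blast
  show "c *\<^sub>C x \<in> closure S" unfolding closure_sequential
    by (rule exI[of _ "\<lambda>n. c *\<^sub>C f n"]) (auto intro!: csubspace_scaleC S f scaleC.tendsto)
  assume y: "y \<in> closure S"
  then obtain g where g: "\<And>n. g n \<in> S" "g \<longlonglongrightarrow> y" unfolding closure_sequential by blast
  show "x + y \<in> closure S" unfolding closure_sequential
    by (rule exI[of _ "\<lambda>n. f n + g n"]) (auto intro!: csubspace_add S f g tendsto_add)
qed

text \<open>Midpoints of a minimizing sequence stay in \<open>S\<close>, so their squared distance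
  to \<open>x\<close> is at least \<open>d\<close>, and the parallelogram law makes the sequence
  Cauchy.\<close>

lemma nearest_point_exists:
  fixes S :: "'h::chilbert_space set"
  assumes S: "csubspace S" "closed S"
  shows "\<exists>s\<in>S. \<forall>y\<in>S. norm (x - s) \<le> norm (x - y)"
proof -
  define d where "d = (INF y\<in>S. (norm (x - y))\<^sup>2)"
  have ne: "S \<noteq> {}" using csubspace_0[OF S(1)] by auto
  have bb: "bdd_below ((\<lambda>y. (norm (x - y))\<^sup>2) ` S)" by (rule bdd_belowI2[of _ 0]) simp
  have dle: "d \<le> (norm (x - y))\<^sup>2" if "y \<in> S" for y
    unfolding d_def by (rule cINF_lower[OF bb that])
  have "\<exists>y\<in>S. (norm (x - y))\<^sup>2 < d + 1 / Suc n" for n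
    using cINF_less_iff[OF ne bb, of "d + 1 / Suc n"] by (simp add: d_def)
  then obtain f where f: "\<And>n. f n \<in> S" "\<And>n. (norm (x - f n))\<^sup>2 < d + 1 / Suc n" by metis
  have par: "(norm (f m - f n))\<^sup>2 \<le> 2 / Suc m + 2 / Suc n" for m n
  proof -
    let ?a = "x - f m" and ?b = "x - f n"
    have mid: "(1/2) *\<^sub>C (f m + f n) \<in> S" by (intro csubspace_scaleC csubspace_add S f)
    have "?a + ?b = 2 *\<^sub>R (x - (1/2) *\<^sub>C (f m + f n))"
      by (simp add: scaleR_scaleC scaleC_diff_right scaleC_add_right scaleC_scaleC scaleC_one)
        (metis one_add_one scaleC_add_left scaleC_one add_diff_eq diff_add_eq diff_diff_eq2 add.commute add_diff_add)
    then have "(norm (?a + ?b))\<^sup>2 = 4 * (norm (x - (1/2) *\<^sub>C (f m + f n)))\<^sup>2"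
      by (simp add: power_mult_distrib)
    then have "(norm (?a + ?b))\<^sup>2 \<ge> 4 * d" using dle[OF mid] by simp
    moreover have "(norm (?a - ?b))\<^sup>2 + (norm (?a + ?b))\<^sup>2 = 2 * (norm ?a)\<^sup>2 + 2 * (norm ?b)\<^sup>2"
      unfolding norm_diff_square[of ?a ?b] norm_add_square[of ?a ?b] by simp
    moreover have "norm (?a - ?b) = norm (f m - f n)" by (simp add: norm_minus_commute)
    ultimately show ?thesis using f(2)[of m] f(2)[of n] by simp
  qed
  have "Cauchy f"
  proof (rule metric_CauchyI)
    fix e :: real assume e: "0 < e"
    obtain N :: nat where N: "4 / e\<^sup>2 < real N" using reals_Archimedean2 by blast
    show "\<exists>N. \<forall>m\<ge>N. \<forall>n\<ge>N. dist (f m) (f n) < e"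
    proof (intro exI allI impI)
      fix m n assume "N \<le> m" "N \<le> n"
      have N0: "real N > 0" using N e by (smt (verit) divide_pos_pos zero_less_power)
      have "2 / Suc k < e\<^sup>2 / 2" if "N \<le> k" for k
      proof -
        have "2 / Suc k < 2 / N" using that N0 by (simp add: frac_less2)
        also have "\<dots> < e\<^sup>2 / 2" using N N0 e by (simp add: field_simps)
        finally show ?thesis .
      qed
      then have "(norm (f m - f n))\<^sup>2 < e\<^sup>2" 
        using par[of m n] \<open>N \<le> m\<close> \<open>N \<le> n\<close> by (smt (verit) field_sum_of_halves)
      then show "dist (f m) (f n) < e" using e by (simp add: dist_norm power_less_imp_less_base)
    qed
  qed
  then obtain s where s: "f \<longlonglongrightarrow> s" using Cauchy_convergent convergent_def by blast
  have "s \<in> S" using S(2) f(1) s closed_sequentially by blast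
  moreover have "norm (x - s) \<le> norm (x - y)" if "y \<in> S" for y
  proof -
    have "(\<lambda>n. (norm (x - f n))\<^sup>2) \<longlonglongrightarrow> (norm (x - s))\<^sup>2" by (intro tendsto_intros s)
    moreover have "(\<lambda>n. d + 1 / Suc n) \<longlonglongrightarrow> d + 0"
      by (intro tendsto_intros) (use LIMSEQ_inverse_real_of_nat in \<open>simp add: inverse_eq_divide\<close>)
    ultimately have "(norm (x - s))\<^sup>2 \<le> d + 0"
      by (rule LIMSEQ_le) (use f(2) less_imp_le in blast)
    then have "(norm (x - s))\<^sup>2 \<le> (norm (x - y))\<^sup>2" using dle[OF that] by linarith
    then show ?thesis by (rule power2_le_imp_le) (rule norm_ge_zero)
  qed
  ultimately show ?thesis by blast
qed

text \<open>First variation at the nearest point: a nonzero inner product with some \<open>y\<close>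
  in \<open>S\<close> would allow a small move along \<open>y\<close> that comes closer to
  \<open>x\<close>.\<close>

lemma orthogonal_projection_exists:
  fixes S :: "'h::chilbert_space set"
  assumes S: "csubspace S" "closed S"
  shows "\<exists>s\<in>S. \<forall>y\<in>S. cinner (x - s) y = 0"
proof -
  obtain s where s: "s \<in> S" "\<And>y. y \<in> S \<Longrightarrow> norm (x - s) \<le> norm (x - y)"
    using nearest_point_exists[OF S] by blast
  have "cinner (x - s) y = 0" if y: "y \<in> S" for y
  proof (rule ccontr)
    define c where "c = cinner (x - s) y"
    assume "cinner (x - s) y \<noteq> 0"
    then have c: "(cmod c)\<^sup>2 > 0" by (simp add: c_def)
    \<comment> \<open>Moving along \<open>c *\<^sub>C y\<close> rather than \<open>y\<close> makes
      the cross term the real number \<open>t * (cmod c)\<^sup>2\<close>.\<close>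
    have ineq: "2 * t * (cmod c)\<^sup>2 \<le> t\<^sup>2 * ((cmod c)\<^sup>2 * (norm y)\<^sup>2)" for t :: real
    proof -
      let ?z = "(of_real t * c) *\<^sub>C y"
      have "norm (x - s) \<le> norm (x - (s + ?z))"
        by (intro s csubspace_add S csubspace_scaleC y)
      then have "(norm (x - s))\<^sup>2 \<le> (norm ((x - s) - ?z))\<^sup>2" by (simp add: diff_diff_eq)
      also have "\<dots> = (norm (x - s))\<^sup>2 + t\<^sup>2 * ((cmod c)\<^sup>2 * (norm y)\<^sup>2) - 2 * Re (cinner (x - s) ?z)"
        by (simp only: norm_diff_square norm_scaleC) (simp add: norm_mult power_mult_distrib)
      also have "Re (cinner (x - s) ?z) = t * (cmod c)\<^sup>2"
        by (simp add: cinner_scaleC_right c_def[symmetric] cmod_power2) (simp add: power2_eq_square algebra_simps)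
      finally show ?thesis by simp
    qed
    \<comment> \<open>The summand \<open>1\<close> keeps \<open>r\<close> positive even for
      \<open>y = 0\<close>; the step size \<open>t = 1 / r\<close> is small enough for the linear
      term to win.\<close>
    define r where "r = (norm y)\<^sup>2 + 1"
    have r: "r > 0" "(norm y)\<^sup>2 < r" by (simp_all add: r_def add_nonneg_pos)
    have "2 * (1 / r) * (cmod c)\<^sup>2 \<le> (1/r)\<^sup>2 * ((cmod c)\<^sup>2 * (norm y)\<^sup>2)" by (rule ineq)
    then have "(2 * r) * (cmod c)\<^sup>2 \<le> (norm y)\<^sup>2 * (cmod c)\<^sup>2"
      using r by (simp add: field_simps power2_eq_square)
    then have "2 * r \<le> (norm y)\<^sup>2" using c by (simp only: mult_le_cancel_right_pos)
    then show False using r by linarith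
  qed
  with s(1) show ?thesis by blast
qed

section \<open>Riesz representation and adjoints\<close>

lemma bop_bounded_linear: "bounded_linear (\<lambda>x. A *\<^sub>V x)"
  by transfer simp

lemmas bop_apply_zero [simp] = linear_0[OF bounded_linear.linear[OF bop_bounded_linear]]
  and bop_apply_diff = linear_diff[OF bounded_linear.linear[OF bop_bounded_linear]]
  and bop_apply_tendsto = bounded_linear.tendsto[OF bop_bounded_linear]

lemma bop_apply_scaleC: "A *\<^sub>V (c *\<^sub>C x) = c *\<^sub>C (A *\<^sub>V x)"
  by transfer simp

lemmas bop_simps = zero_bop.rep_eq one_bop.rep_eq plus_bop.rep_eq scaleC_bop.rep_eq
  uminus_bop.rep_eq minus_bop.rep_eq times_bop.rep_eq rank_one.rep_eq

text \<open>Every operator defined by a formula is built through this; complex homogeneity covers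
  the real homogeneity that \<open>bounded_linear\<close> asks for.\<close>

lemma Abs_bop_apply:
  assumes "\<And>x y. T (x + y) = T x + T y" "\<And>c x. T (c *\<^sub>C x) = c *\<^sub>C T x" "\<And>x. norm (T x) \<le> K * norm x"
  shows "Abs_bop T *\<^sub>V x = T x"
proof -
  have "bounded_linear T"
    by (rule bounded_linear_intro[of _ K]) (use assms in \<open>simp_all add: scaleR_scaleC mult.commute\<close>)
  then show ?thesis using assms by (subst Abs_bop_inverse) auto
qed

lemma bop_bound: obtains K where "K > 0" "\<And>x. norm (A *\<^sub>V x) \<le> K * norm x"
  using bounded_linear.pos_bounded[OF bop_bounded_linear[of A]] by (metis mult.commute)

text \<open>The kernel of \<open>f\<close> has codimension one, so the representing vector is a
  multiple of \<open>w\<close>, the component orthogonal to the kernel of any \<open>a\<close> with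
  \<open>f a \<noteq> 0\<close>.\<close>

lemma riesz_representation:
  fixes f :: "'h::chilbert_space \<Rightarrow> complex"
  assumes add: "\<And>x y. f (x + y) = f x + f y" and sc: "\<And>c x. f (c *\<^sub>C x) = c * f x"
    and bd: "\<And>x. cmod (f x) \<le> K * norm x"
  shows "\<exists>y. \<forall>x. f x = cinner x y"
proof (cases "\<forall>x. f x = 0")
  case True
  then show ?thesis by (intro exI[of _ 0]) (simp add: cinner.zero_right)
next
  case False
  then obtain a where a: "f a \<noteq> 0" by blast
  define S where "S = {x. f x = 0}"
  have bl: "bounded_linear f"
    by (rule bounded_linear_intro[of _ K])
      (use assms in \<open>simp_all add: scaleR_scaleC mult.commute scaleR_conv_of_real\<close>)
  have f0: "f 0 = 0" using sc[of 0 0] by (simp add: scaleC.zero_left)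
  have "csubspace S" using add sc f0 by (auto simp: csubspace_def S_def)
  moreover have "closed S" unfolding S_def
    by (rule closed_Collect_eq) (auto intro: linear_continuous_on bl)
  ultimately obtain s where s: "s \<in> S" "\<And>y. y \<in> S \<Longrightarrow> cinner (a - s) y = 0"
    using orthogonal_projection_exists by metis
  define w where "w = a - s"
  have fd: "f (x - y) = f x - f y" for x y using bl by (simp add: bounded_linear.linear linear_diff)
  have fw: "f w = f a" using s(1) by (simp add: w_def fd S_def)
  then have w: "w \<noteq> 0" using a f0 by auto
  have key: "cinner x w = (f x / f w) * cinner w w" for x
  proof -
    have "x - (f x / f w) *\<^sub>C w \<in> S" using a fw by (simp add: S_def fd sc)
    then have "cinner w (x - (f x / f w) *\<^sub>C w) = 0" using s(2) by (simp add: w_def)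
    then have "cinner (x - (f x / f w) *\<^sub>C w) w = 0" by (metis cinner_commute complex_cnj_zero)
    then show ?thesis by (simp add: cinner.diff_left cinner_scaleC_left)
  qed
  have "f x = cinner x (cnj (f w / cinner w w) *\<^sub>C w)" for x
    using key[of x] w a fw by (simp add: cinner_scaleC_right cinner_eq_zero_iff)
  then show ?thesis by blast
qed

text \<open>Riesz gives the value \<open>g y\<close> for each \<open>y\<close> separately. Linearity
  of \<open>g\<close> follows by testing against all vectors, the bound from \<open>\<parallel>g
  y\<parallel>\<^sup>2 = \<langle>A(g y), y\<rangle>\<close>.\<close>

lemma adjoint_exists: "\<exists>B. \<forall>x y. cinner (A *\<^sub>V x) y = cinner x (B *\<^sub>V y)"
proof -
  obtain K where K: "K > 0" "\<And>x. norm (A *\<^sub>V x) \<le> K * norm x" using bop_bound[of A] by blast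
  have CS: "cmod (cinner (A *\<^sub>V x) y) \<le> K * norm x * norm y" for x y
    using cinner_Cauchy_Schwarz[of "A *\<^sub>V x" y] mult_right_mono[OF K(2)[of x], of "norm y"] by simp
  have "\<exists>z. \<forall>x. cinner (A *\<^sub>V x) y = cinner x z" for y
    by (rule riesz_representation[where K = "K * norm y"])
      (use CS in \<open>simp_all add: bop_apply_add cinner_add_left bop_apply_scaleC cinner_scaleC_left algebra_simps\<close>)
  then obtain g where g: "\<And>x y. cinner (A *\<^sub>V x) y = cinner x (g y)" by metis
  have g': "cinner (g y) x = cinner y (A *\<^sub>V x)" for x y by (metis g cinner_commute)
  have "Abs_bop g *\<^sub>V y = g y" for y
  proof (rule Abs_bop_apply)
    show "g (x + y) = g x + g y" for x y
      by (rule cinner_extI) (simp add: g' cinner_add_left)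
    show "g (c *\<^sub>C x) = c *\<^sub>C g x" for c x
      by (rule cinner_extI) (simp add: g' cinner_scaleC_left)
    show "norm (g y) \<le> K * norm y" for y
    proof (cases "g y = 0")
      case False
      have "(norm (g y))\<^sup>2 = cmod (cinner (A *\<^sub>V g y) y)"
        unfolding g cinner_self by (simp del: of_real_power add: norm_of_real)
      also have "\<dots> \<le> K * norm (g y) * norm y" by (rule CS)
      finally show ?thesis using False by (simp add: power2_eq_square algebra_simps)
    qed (use K in simp)
  qed
  then show ?thesis using g by (intro exI[of _ "Abs_bop g"]) simp
qed

text \<open>The uniqueness behind the description in \<open>adj\<close>; adjoints are computed by
  exhibiting the operator.\<close>

lemma adj_eqI: "(\<And>x y. cinner (A *\<^sub>V x) y = cinner x (B *\<^sub>V y)) \<Longrightarrow> adj A = B"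
  unfolding adj_def
proof (rule the_equality)
  fix B' assume *: "\<And>x y. cinner (A *\<^sub>V x) y = cinner x (B *\<^sub>V y)"
    "\<forall>x y. cinner (A *\<^sub>V x) y = cinner x (B' *\<^sub>V y)"
  have "cinner (B' *\<^sub>V y) x = cinner (B *\<^sub>V y) x" for x y
    using * cinner_commute[of "B' *\<^sub>V y" x] cinner_commute[of "B *\<^sub>V y" x] by metis
  then show "B' = B"
    by (intro bop_eqI cinner_extI)
qed blast

lemma cinner_adj: "cinner (A *\<^sub>V x) y = cinner x (adj A *\<^sub>V y)"
proof -
  obtain B where B: "\<And>x y. cinner (A *\<^sub>V x) y = cinner x (B *\<^sub>V y)"
    using adjoint_exists by blast
  show ?thesis unfolding adj_eqI[OF B] by (rule B)
qed

lemma cinner_adj_left: "cinner (adj A *\<^sub>V x) y = cinner x (A *\<^sub>V y)"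
proof -
  have "cinner (adj A *\<^sub>V x) y = cnj (cinner y (adj A *\<^sub>V x))" by (rule cinner_commute)
  also have "\<dots> = cinner x (A *\<^sub>V y)"
    unfolding cinner_adj[symmetric] by (rule cinner_commute[symmetric])
  finally show ?thesis .
qed

lemma adj_adj [simp]: "adj (adj A) = A"
  by (rule adj_eqI) (simp add: cinner_adj_left)

lemma adj_mult: "adj (A * B) = adj B * adj A"
  by (rule adj_eqI) (simp add: bop_simps cinner_adj)

lemma adj_add: "adj (A + B) = adj A + adj B"
  by (rule adj_eqI) (simp add: bop_simps cinner_adj cinner_add_left cinner_add_right)

lemma adj_diff: "adj (A - B) = adj A - adj B"
  by (rule adj_eqI) (simp add: bop_simps cinner_adj cinner.diff_left cinner.diff_right)

lemma adj_one [simp]: "adj 1 = 1"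
  by (rule adj_eqI) (simp add: bop_simps)

lemma adj_scaleC: "adj (c *\<^sub>C A) = cnj c *\<^sub>C adj A"
  by (rule adj_eqI) (simp add: bop_simps cinner_scaleC_left cinner_scaleC_right cinner_adj)

lemma bop_extI: "(\<And>x y. cinner (A *\<^sub>V x) y = cinner (B *\<^sub>V x) y) \<Longrightarrow> A = B"
  by (rule bop_eqI, rule cinner_extI)

lemma mult_rank_one: "A * (x \<boxtimes> y) = (A *\<^sub>V x) \<boxtimes> y"
  by (rule bop_eqI) (simp add: bop_simps bop_apply_scaleC)

lemma rank_one_mult: "(x \<boxtimes> y) * A = x \<boxtimes> (adj A *\<^sub>V y)"
  by (rule bop_eqI) (simp add: bop_simps cinner_adj)

section \<open>Orthogonal projections as operators\<close>

definition projects_onto :: "'h::chilbert_space set \<Rightarrow> 'h bop \<Rightarrow> bool" where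
  "projects_onto S P \<longleftrightarrow> (\<forall>x. P *\<^sub>V x \<in> S \<and> (\<forall>y\<in>S. cinner (x - P *\<^sub>V x) y = 0))"

definition proj :: "'h::chilbert_space set \<Rightarrow> 'h bop" where
  "proj S = (SOME P. projects_onto S P)"

context
  fixes S :: "'h::chilbert_space set"
  assumes S: "csubspace S" "closed S"
begin

lemma projection_unique:
  assumes "s \<in> S" "s' \<in> S"
    and "\<And>y. y \<in> S \<Longrightarrow> cinner (x - s) y = 0" "\<And>y. y \<in> S \<Longrightarrow> cinner (x - s') y = 0"
  shows "s = s'"
proof -
  have "s - s' \<in> S" by (intro csubspace_diff S assms)
  then have "cinner ((x - s') - (x - s)) (s - s') = 0"
    unfolding cinner.diff_left[of "x - s'"] by (simp add: assms)
  then show ?thesis by (simp add: cinner_eq_zero_iff)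
qed

lemma proj_mem: "proj S *\<^sub>V x \<in> S"
  and proj_ortho: "y \<in> S \<Longrightarrow> cinner (x - proj S *\<^sub>V x) y = 0"
proof -
  have "\<forall>x. \<exists>s. s \<in> S \<and> (\<forall>y\<in>S. cinner (x - s) y = 0)"
    using orthogonal_projection_exists[OF S] by blast
  from choice[OF this] obtain p where "\<forall>x. p x \<in> S \<and> (\<forall>y\<in>S. cinner (x - p x) y = 0)" ..
  then have p: "\<And>x. p x \<in> S" "\<And>x y. y \<in> S \<Longrightarrow> cinner (x - p x) y = 0" by auto
  have app: "Abs_bop p *\<^sub>V x = p x" for x
  proof (rule Abs_bop_apply[where K = 1])
    show "p (x + y) = p x + p y" for x y
    proof (rule projection_unique[OF p(1) csubspace_add[OF S(1) p(1) p(1)] p(2)])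
      fix z assume z: "z \<in> S"
      have "cinner (x + y - (p x + p y)) z = cinner (x - p x) z + cinner (y - p y) z"
        
        by (simp only: cinner_add_left[symmetric] add_diff_add)
      then show "cinner (x + y - (p x + p y)) z = 0" by (simp add: p(2)[OF z])
    qed
    show "p (c *\<^sub>C x) = c *\<^sub>C p x" for c x
    proof (rule projection_unique[OF p(1) csubspace_scaleC[OF S(1) p(1)] p(2)])
      fix z assume z: "z \<in> S"
      show "cinner (c *\<^sub>C x - c *\<^sub>C p x) z = 0"
        unfolding scaleC_diff_right[symmetric] cinner_scaleC_left p(2)[OF z] by simp
    qed
    show "norm (p x) \<le> 1 * norm x" for x
    proof -
      have "(norm x)\<^sup>2 = (norm ((x - p x) + p x))\<^sup>2" by simp
      also have "\<dots> = (norm (x - p x))\<^sup>2 + (norm (p x))\<^sup>2"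
        unfolding norm_add_square p(2)[OF p(1)] by simp
      finally have "(norm (p x))\<^sup>2 \<le> (norm x)\<^sup>2" by simp
      then show ?thesis using power2_le_imp_le[of "norm (p x)" "norm x"] by simp
    qed
  qed
  have "projects_onto S (Abs_bop p)"
    unfolding projects_onto_def app using p by auto
  then have "projects_onto S (proj S)"
    unfolding proj_def by (rule someI[of "projects_onto S"])
  then show "proj S *\<^sub>V x \<in> S" "y \<in> S \<Longrightarrow> cinner (x - proj S *\<^sub>V x) y = 0"
    unfolding projects_onto_def by auto
qed

lemma proj_fixes: "x \<in> S \<Longrightarrow> proj S *\<^sub>V x = x"
  by (rule projection_unique[of _ _ x]) (simp_all add: proj_mem proj_ortho)

text \<open>Invariance under the adjoint means that \<open>T\<close> also preserves the orthogonal
  complement, so \<open>T(Px)\<close> satisfies the two conditions that characterize the projection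
  of \<open>Tx\<close>.\<close>

lemma proj_commutes:
  assumes T: "\<And>x. x \<in> S \<Longrightarrow> T *\<^sub>V x \<in> S" "\<And>x. x \<in> S \<Longrightarrow> adj T *\<^sub>V x \<in> S"
  shows "proj S * T = T * proj S"
proof (rule bop_eqI)
  fix x
  have "proj S *\<^sub>V (T *\<^sub>V x) = T *\<^sub>V (proj S *\<^sub>V x)"
    by (rule projection_unique[of _ _ "T *\<^sub>V x"])
      (simp_all add: T proj_mem proj_ortho bop_apply_diff[symmetric] cinner_adj)
  then show "(proj S * T) *\<^sub>V x = (T * proj S) *\<^sub>V x" by (simp add: bop_simps)
qed

end

text \<open>The graph \<open>G\<close> need not be densely defined: the operator is \<open>0\<close> on the orthogonal complement
  of its domain.\<close>

lemma bounded_graph_extension: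
  fixes G :: "('h::chilbert_space \<times> 'h) set"
  assumes add: "\<And>a b a' b'. (a, b) \<in> G \<Longrightarrow> (a', b') \<in> G \<Longrightarrow> (a + a', b + b') \<in> G"
    and sc: "\<And>c a b. (a, b) \<in> G \<Longrightarrow> (c *\<^sub>C a, c *\<^sub>C b) \<in> G"
    and ne: "(0, 0) \<in> G"
    and bd: "\<And>a b. (a, b) \<in> G \<Longrightarrow> norm b \<le> K * norm a" and K: "K \<ge> 0"
  shows "\<exists>U. \<forall>(a, b)\<in>G. U *\<^sub>V a = b"
proof -
  define S where "S = {a. \<exists>b. (a, b) \<in> G}"
  have S: "csubspace S"
  proof (rule csubspaceI)
    show "0 \<in> S" unfolding S_def using ne by blast
    fix x y c assume xy: "x \<in> S" "y \<in> S"
    obtain b where b: "(x, b) \<in> G" using xy(1) unfolding S_def by blast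
    obtain b' where b': "(y, b') \<in> G" using xy(2) unfolding S_def by blast
    show "x + y \<in> S" unfolding S_def using add[OF b b'] by blast
    show "c *\<^sub>C x \<in> S" unfolding S_def using sc[OF b] by blast
  qed
  define P where "P = proj (closure S)"
  have P: "P *\<^sub>V x \<in> closure S" "x \<in> closure S \<Longrightarrow> P *\<^sub>V x = x" for x
    unfolding P_def by (intro proj_mem proj_fixes csubspace_closure S closed_closure, assumption?)+
  \<comment> \<open>Closing the graph keeps linearity and the bound, and completeness of the space
    enlarges the domain to \<open>closure S\<close>, where \<open>P\<close> can be used to make the
    operator total.\<close>
  define H where "H = closure G"
  have Hseq: "(x, y) \<in> H \<longleftrightarrow> (\<exists>a b. (\<forall>n. (a n, b n) \<in> G) \<and> a \<longlonglongrightarrow> x \<and> b \<longlonglongrightarrow> y)" for x y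
  proof
    assume "(x, y) \<in> H"
    then obtain f where f: "\<And>n. f n \<in> G" "f \<longlonglongrightarrow> (x, y)" unfolding H_def closure_sequential by blast
    show "\<exists>a b. (\<forall>n. (a n, b n) \<in> G) \<and> a \<longlonglongrightarrow> x \<and> b \<longlonglongrightarrow> y"
      using tendsto_fst[OF f(2)] tendsto_snd[OF f(2)] f(1)
      by (intro exI[of _ "\<lambda>n. fst (f n)"] exI[of _ "\<lambda>n. snd (f n)"]) auto
  next
    assume "\<exists>a b. (\<forall>n. (a n, b n) \<in> G) \<and> a \<longlonglongrightarrow> x \<and> b \<longlonglongrightarrow> y"
    then obtain a b where "\<And>n. (a n, b n) \<in> G" "a \<longlonglongrightarrow> x" "b \<longlonglongrightarrow> y" by blast
    then show "(x, y) \<in> H" unfolding H_def closure_sequential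
      by (intro exI[of _ "\<lambda>n. (a n, b n)"]) (auto intro: tendsto_Pair)
  qed
  have Hadd: "(a + a', b + b') \<in> H" if "(a, b) \<in> H" "(a', b') \<in> H" for a b a' b'
  proof -
    obtain f g where "\<And>n. (f n, g n) \<in> G" "f \<longlonglongrightarrow> a" "g \<longlonglongrightarrow> b"
      using \<open>(a, b) \<in> H\<close> unfolding Hseq by blast
    moreover obtain f' g' where "\<And>n. (f' n, g' n) \<in> G" "f' \<longlonglongrightarrow> a'" "g' \<longlonglongrightarrow> b'"
      using \<open>(a', b') \<in> H\<close> unfolding Hseq by blast
    ultimately have "\<forall>n. (f n + f' n, g n + g' n) \<in> G" "(\<lambda>n. f n + f' n) \<longlonglongrightarrow> a + a'" "(\<lambda>n. g n + g' n) \<longlonglongrightarrow> b + b'"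
      by (simp_all add: tendsto_add add)
    then show ?thesis unfolding Hseq
      by (intro exI[of _ "\<lambda>n. f n + f' n"] exI[of _ "\<lambda>n. g n + g' n"]) simp
  qed
  have Hsc: "(c *\<^sub>C a, c *\<^sub>C b) \<in> H" if "(a, b) \<in> H" for a b c
  proof -
    obtain f g where "\<And>n. (f n, g n) \<in> G" "f \<longlonglongrightarrow> a" "g \<longlonglongrightarrow> b" using \<open>(a, b) \<in> H\<close> unfolding Hseq by blast
    then have "\<forall>n. (c *\<^sub>C f n, c *\<^sub>C g n) \<in> G" "(\<lambda>n. c *\<^sub>C f n) \<longlonglongrightarrow> c *\<^sub>C a" "(\<lambda>n. c *\<^sub>C g n) \<longlonglongrightarrow> c *\<^sub>C b"
      by (simp_all add: scaleC.tendsto sc)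
    then show ?thesis unfolding Hseq 
      by (intro exI[of _ "\<lambda>n. c *\<^sub>C f n"] exI[of _ "\<lambda>n. c *\<^sub>C g n"]) simp
  qed
  have Hbd: "norm b \<le> K * norm a" if "(a, b) \<in> H" for a b
  proof -
    obtain f g where fg: "\<And>n. (f n, g n) \<in> G" "f \<longlonglongrightarrow> a" "g \<longlonglongrightarrow> b" using \<open>(a, b) \<in> H\<close> unfolding Hseq by blast
    show ?thesis
      by (rule LIMSEQ_le[of "\<lambda>n. norm (g n)" _ "\<lambda>n. K * norm (f n)"]) (auto intro!: tendsto_intros fg bd)
  qed
  \<comment> \<open>The bound alone makes the closed graph single-valued: a difference of two values
    sits over \<open>0\<close>.\<close>
  have Huniq: "b = b'" if "(a, b) \<in> H" "(a, b') \<in> H" for a b b'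
  proof -
    have "(a + (-1) *\<^sub>C a, b + (-1) *\<^sub>C b') \<in> H" by (intro Hadd Hsc that)
    then show ?thesis using Hbd by (force simp: scaleC_minus_one)
  qed
  have Hex: "\<exists>b. (a, b) \<in> H" if "a \<in> closure S" for a
  proof -
    obtain f where f: "\<And>n. f n \<in> S" "f \<longlonglongrightarrow> a" using \<open>a \<in> closure S\<close> unfolding closure_sequential by blast
    have "\<exists>b. (f n, b) \<in> G" for n using f(1)[of n] unfolding S_def by blast
    then obtain g where g: "\<And>n. (f n, g n) \<in> G" by metis
    have gd: "norm (g m - g n) \<le> K * norm (f m - f n)" for m n
      using bd[OF add[OF g[of m] sc[OF g[of n], of "-1"]]] by (simp add: scaleC_minus_one)
    have "Cauchy g"
    proof (rule metric_CauchyI)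
      fix e :: real assume "0 < e"
      \<comment> \<open>\<open>K + 1\<close> avoids a division by zero when
        \<open>K = 0\<close>.\<close>
      then have "e / (K + 1) > 0" using K by simp
      then obtain N where N: "\<And>m n. m \<ge> N \<Longrightarrow> n \<ge> N \<Longrightarrow> dist (f m) (f n) < e / (K + 1)"
        using LIMSEQ_imp_Cauchy[OF f(2)] unfolding Cauchy_def by metis
      show "\<exists>N. \<forall>m\<ge>N. \<forall>n\<ge>N. dist (g m) (g n) < e"
      proof (intro exI allI impI)
        fix m n assume mn: "N \<le> m" "N \<le> n"
        have "norm (g m - g n) \<le> (K + 1) * norm (f m - f n)"
          using gd[of m n] by (smt (verit) mult_right_mono norm_ge_zero)
        also have "\<dots> < (K + 1) * (e / (K + 1))"
          using N[OF mn] K by (intro mult_strict_left_mono) (auto simp: dist_norm)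
        finally show "dist (g m) (g n) < e" using K by (simp add: dist_norm)
      qed
    qed
    then obtain b where "g \<longlonglongrightarrow> b" using Cauchy_convergent convergent_def by blast
    then show ?thesis using f g Hseq by blast
  qed
  have "\<exists>b. (P *\<^sub>V x, b) \<in> H" for x by (rule Hex, rule P)
  then obtain u where u: "\<And>x. (P *\<^sub>V x, u x) \<in> H" by metis
  obtain K1 where K1: "\<And>x. norm (P *\<^sub>V x) \<le> K1 * norm x" using bop_bound[of P] by blast
  have app: "Abs_bop u *\<^sub>V x = u x" for x
  proof (rule Abs_bop_apply[where K = "K * K1"])
    show "u (x + y) = u x + u y" for x y
      using Huniq[OF u[of "x + y"]] Hadd[OF u[of x] u[of y]] by (simp add: bop_apply_add)
    show "u (c *\<^sub>C x) = c *\<^sub>C u x" for x c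
      using Huniq[OF u[of "c *\<^sub>C x"]] Hsc[OF u[of x]] by (simp add: bop_apply_scaleC)
    show "norm (u x) \<le> K * K1 * norm x" for x
      using Hbd[OF u[of x]] mult_left_mono[OF K1 K, of x] by simp
  qed
  have "Abs_bop u *\<^sub>V a = b" if "(a, b) \<in> G" for a b
  proof -
    have "a \<in> S" unfolding S_def using that by blast
    then have "a \<in> closure S" using closure_subset by blast
    moreover have "(a, b) \<in> H" using that closure_subset by (auto simp: H_def)
    ultimately show ?thesis using u[of a] P(2) Huniq app by metis
  qed
  then show ?thesis by blast
qed

text \<open>The assignment \<open>Sx \<mapsto> Tx\<close> is a bounded graph. Applied to an operator
  and its absolute value, in either order, it takes the place of the polar decomposition.\<close>

lemma douglas_factorization:
  fixes S T :: "'h::chilbert_space bop"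
  assumes "\<And>x. norm (T *\<^sub>V x) \<le> K * norm (S *\<^sub>V x)" "K \<ge> 0"
  obtains U where "T = U * S"
proof -
  have "\<exists>U. \<forall>(a, b)\<in>range (\<lambda>x. (S *\<^sub>V x, T *\<^sub>V x)). U *\<^sub>V a = b"
    by (rule bounded_graph_extension[where K = K])
      (use assms in \<open>auto simp: bop_apply_add[symmetric] bop_apply_scaleC[symmetric] bop_apply_zero intro: range_eqI[of _ _ 0]\<close>)
  then obtain U where U: "\<And>x. U *\<^sub>V (S *\<^sub>V x) = T *\<^sub>V x" by auto
  show thesis
    by (rule that[of U], rule bop_eqI) (simp add: bop_simps U)
qed

section \<open>Positive operators and square roots\<close>

lemma bop_mult_scaleC_left: "(c *\<^sub>C A) * B = c *\<^sub>C (A * B :: 'h::chilbert_space bop)"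
  and bop_mult_scaleC_right: "A * (c *\<^sub>C B) = c *\<^sub>C (A * B :: 'h::chilbert_space bop)"
  by (rule bop_eqI, simp add: bop_simps bop_apply_scaleC)+

text \<open>Polarization over the complex numbers: the diagonal values at \<open>x + y\<close> and
  at \<open>x + \<i>y\<close> give two independent equations for
  \<open>\<langle>Ax, y\<rangle>\<close> and \<open>\<langle>Ay, x\<rangle>\<close>.\<close>

lemma bop_eq_0_if_quadratic_form_0:
  assumes "\<And>x. cinner (A *\<^sub>V x) x = 0"
  shows "A = (0 :: 'h::chilbert_space bop)"
proof (rule bop_extI)
  fix x y
  have "cinner (A *\<^sub>V (x + y)) (x + y) = 0" "cinner (A *\<^sub>V (x + \<i> *\<^sub>C y)) (x + \<i> *\<^sub>C y) = 0"
    by (rule assms)+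
  then have "cinner (A *\<^sub>V x) y + cinner (A *\<^sub>V y) x = 0"
    "- \<i> * cinner (A *\<^sub>V x) y + \<i> * cinner (A *\<^sub>V y) x = 0"
    by (simp_all add: bop_apply_add bop_apply_scaleC cinner_add_left cinner_add_right
        cinner_scaleC_left cinner_scaleC_right assms)
  then have "\<i> * (cinner (A *\<^sub>V x) y + cinner (A *\<^sub>V y) x) - (- \<i> * cinner (A *\<^sub>V x) y + \<i> * cinner (A *\<^sub>V y) x) = 0"
    by simp
  then have "2 * \<i> * cinner (A *\<^sub>V x) y = 0" by (simp add: algebra_simps)
  then show "cinner (A *\<^sub>V x) y = cinner (0 *\<^sub>V x) y" by (simp add: bop_simps)
qed

text \<open>Real diagonal values already force self-adjointness, which is why
  \<open>positive_op\<close> does not list it.\<close>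

lemma positive_op_adj: "positive_op A \<Longrightarrow> adj A = A"
proof -
  assume A: "positive_op A"
  have "cinner ((A - adj A) *\<^sub>V x) x = 0" for x
  proof -
    have "cinner (A *\<^sub>V x) x \<in> \<real>\<^sub>\<ge>\<^sub>0" using A by (simp add: positive_op_def)
    then have "cnj (cinner (A *\<^sub>V x) x) = cinner (A *\<^sub>V x) x"
      by (simp add: complex_nonneg_Reals_iff complex_eq_iff)
    moreover have "cinner (adj A *\<^sub>V x) x = cnj (cinner (A *\<^sub>V x) x)"
      unfolding cinner_adj_left by (rule cinner_commute)
    ultimately show ?thesis by (simp add: bop_simps cinner.diff_left)
  qed
  from bop_eq_0_if_quadratic_form_0[OF this] show "adj A = A" by simp
qed

lemma positive_op_Re: "positive_op A \<Longrightarrow> Re (cinner (A *\<^sub>V x) x) \<ge> 0"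
  by (auto simp: positive_op_def complex_nonneg_Reals_iff)

lemma self_adjoint_quadratic_form_real: "adj A = A \<Longrightarrow> cinner (A *\<^sub>V x) x = of_real (Re (cinner (A *\<^sub>V x) x))"
proof -
  assume "adj A = A"
  then have "cinner (A *\<^sub>V x) x = cnj (cinner (A *\<^sub>V x) x)"
    by (metis cinner_adj cinner_commute)
  then show ?thesis by (metis Reals_cnj_iff of_real_Re)
qed

lemma positive_opI:
  assumes "adj A = A" "\<And>x. Re (cinner (A *\<^sub>V x) x) \<ge> 0"
  shows "positive_op A"
  unfolding positive_op_def
  using self_adjoint_quadratic_form_real[OF assms(1)] assms(2)
  by (metis nonneg_Reals_of_real_iff)

lemma positive_op_adj_mult: "positive_op (adj A * A)"
  by (rule positive_opI) (simp_all add: adj_mult bop_simps cinner_adj_left cinner_self del: of_real_power)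

text \<open>This is \<open>A\<^sup>2 \<le> cA\<close>. It comes from positivity at the single vector
  \<open>x - Ax/c\<close> and not from a square root of \<open>A\<close>, whose construction rests
  on it.\<close>

lemma positive_op_norm_bound:
  assumes A: "positive_op A" and c: "c > 0" "\<And>x. norm (A *\<^sub>V x) \<le> c * norm x"
  shows "(norm (A *\<^sub>V x))\<^sup>2 \<le> c * Re (cinner (A *\<^sub>V x) x)"
proof -
  let ?z = "x - (1/c) *\<^sub>R (A *\<^sub>V x)"
  have sa: "cinner (A *\<^sub>V (A *\<^sub>V x)) x = cinner (A *\<^sub>V x) (A *\<^sub>V x)"
    using cinner_adj[of A "A *\<^sub>V x" x] positive_op_adj[OF A] by simp
  have Ar: "A *\<^sub>V (r *\<^sub>R y) = r *\<^sub>R (A *\<^sub>V y)" for r y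
    by (simp add: scaleR_scaleC bop_apply_scaleC)
  have "0 \<le> Re (cinner (A *\<^sub>V ?z) ?z)" by (rule positive_op_Re[OF A])
  also have "\<dots> = Re (cinner (A *\<^sub>V x) x) - 2 / c * (norm (A *\<^sub>V x))\<^sup>2
      + (1 / c)\<^sup>2 * Re (cinner (A *\<^sub>V (A *\<^sub>V x)) (A *\<^sub>V x))"
    by (simp add: bop_apply_diff Ar cinner.diff_left cinner.diff_right cinner.scaleR_left
        cinner.scaleR_right sa cinner_self power2_eq_square field_simps)
  also have "\<dots> \<le> Re (cinner (A *\<^sub>V x) x) - 2 / c * (norm (A *\<^sub>V x))\<^sup>2
      + (1 / c)\<^sup>2 * (c * (norm (A *\<^sub>V x))\<^sup>2)"
  proof -
    have "Re (cinner (A *\<^sub>V (A *\<^sub>V x)) (A *\<^sub>V x)) \<le> norm (A *\<^sub>V (A *\<^sub>V x)) * norm (A *\<^sub>V x)"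
      by (rule order_trans[OF complex_Re_le_cmod cinner_Cauchy_Schwarz])
    also have "\<dots> \<le> (c * norm (A *\<^sub>V x)) * norm (A *\<^sub>V x)"
      by (rule mult_right_mono[OF c(2)]) simp
    finally have "Re (cinner (A *\<^sub>V (A *\<^sub>V x)) (A *\<^sub>V x)) \<le> c * (norm (A *\<^sub>V x))\<^sup>2"
      by (simp add: power2_eq_square mult.assoc)
    then show ?thesis by (intro add_left_mono mult_left_mono) simp_all
  qed
  finally have "0 \<le> Re (cinner (A *\<^sub>V x) x) - 1 / c * (norm (A *\<^sub>V x))\<^sup>2"
    using c(1) by (simp add: power2_eq_square field_simps)
  then show ?thesis using c(1) by (simp add: field_simps)
qed

lemma positive_op_kernel: "positive_op A \<Longrightarrow> Re (cinner (A *\<^sub>V x) x) = 0 \<Longrightarrow> A *\<^sub>V x = 0"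
proof -
  assume A: "positive_op A" and z: "Re (cinner (A *\<^sub>V x) x) = 0"
  obtain c where c: "c > 0" "\<And>x. norm (A *\<^sub>V x) \<le> c * norm x" using bop_bound[of A] by blast
  show ?thesis using positive_op_norm_bound[OF A c, of x] z by simp
qed

text \<open>The iteration \<open>Y \<mapsto> (B + Y\<^sup>2) / 2\<close>, whose limit \<open>Y\<close> satisfies \<open>(1 - Y)\<^sup>2 = 1 - B\<close>, is dominated
  in norm by the scalar iteration with \<open>B = 1\<close>.\<close>

primrec sqrt_iter :: "'h::chilbert_space bop \<Rightarrow> nat \<Rightarrow> 'h bop" where
  "sqrt_iter B 0 = 0"
| "sqrt_iter B (Suc n) = (1/2) *\<^sub>C (B + sqrt_iter B n * sqrt_iter B n)"

primrec scalar_iter :: "nat \<Rightarrow> real" where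
  "scalar_iter 0 = 0"
| "scalar_iter (Suc n) = (1 + (scalar_iter n)\<^sup>2) / 2"

lemma scalar_iter_bounds: "0 \<le> scalar_iter n" "scalar_iter n \<le> 1"
proof -
  have "0 \<le> scalar_iter n \<and> scalar_iter n \<le> 1"
    by (induction n) (auto simp: power_le_one)
  then show "0 \<le> scalar_iter n" "scalar_iter n \<le> 1" by auto
qed

lemma scalar_iter_Suc_le: "scalar_iter n \<le> scalar_iter (Suc n)"
proof -
  have "0 \<le> (1 - scalar_iter n)\<^sup>2" by simp
  then show ?thesis by (simp add: power2_eq_square algebra_simps)
qed

text \<open>Serves twice: the iterates commute with each other, and the limit commutes with
  everything that commutes with \<open>B\<close>.\<close>

lemma sqrt_iter_commute: "T * B = B * T \<Longrightarrow> T * sqrt_iter B n = sqrt_iter B n * T"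
proof (induction n)
  case (Suc n)
  have "T * (sqrt_iter B n * sqrt_iter B n) = (sqrt_iter B n * sqrt_iter B n) * T"
    using Suc by (metis mult.assoc)
  then show ?case using Suc.prems
    by (simp add: bop_mult_scaleC_left bop_mult_scaleC_right distrib_left distrib_right)
qed simp

lemma sqrt_iter_adj: "adj B = B \<Longrightarrow> adj (sqrt_iter B n) = sqrt_iter B n"
proof (induction n)
  case 0
  show ?case by (rule adj_eqI) (simp add: bop_simps)
next
  case (Suc n)
  then show ?case by (simp add: adj_scaleC adj_add adj_mult)
qed

context
  fixes B :: "'h::chilbert_space bop"
  assumes contr: "\<And>x. norm (B *\<^sub>V x) \<le> norm x"
begin

lemma norm_sqrt_iter: "norm (sqrt_iter B n *\<^sub>V x) \<le> scalar_iter n * norm x"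
proof (induction n arbitrary: x)
  case (Suc n)
  let ?Y = "sqrt_iter B n"
  have "norm (?Y *\<^sub>V (?Y *\<^sub>V x)) \<le> scalar_iter n * (scalar_iter n * norm x)"
    using Suc[of "?Y *\<^sub>V x"] mult_left_mono[OF Suc[of x] scalar_iter_bounds(1)[of n]] by linarith
  then have "norm (B *\<^sub>V x + ?Y *\<^sub>V (?Y *\<^sub>V x)) \<le> norm x + (scalar_iter n)\<^sup>2 * norm x"
    using norm_triangle_ineq[of "B *\<^sub>V x" "?Y *\<^sub>V (?Y *\<^sub>V x)"] contr[of x]
    by (simp add: power2_eq_square mult.assoc)
  then show ?case by (simp add: bop_simps norm_scaleC field_simps)
qed (simp add: bop_simps)

text \<open>Since the iterates commute, successive differences satisfy
  \<open>Y'' - Y' = (Y' + Y)(Y' - Y) / 2\<close>; the scalar iteration factors in the same way and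
  majorizes it term by term.\<close>

lemma norm_sqrt_iter_step:
  "norm ((sqrt_iter B (Suc n) - sqrt_iter B n) *\<^sub>V x) \<le> (scalar_iter (Suc n) - scalar_iter n) * norm x"
proof (induction n arbitrary: x)
  case 0
  show ?case using contr[of x] by (simp add: bop_simps norm_scaleC)
next
  case (Suc n)
  let ?Y = "sqrt_iter B n" and ?Y' = "sqrt_iter B (Suc n)"
  let ?y = "scalar_iter n" and ?y' = "scalar_iter (Suc n)"
  have comm: "?Y' * ?Y = ?Y * ?Y'"
    by (rule sqrt_iter_commute) (metis sqrt_iter_commute)
  have "sqrt_iter B (Suc (Suc n)) - ?Y' = (1/2) *\<^sub>C (?Y' * ?Y' - ?Y * ?Y)"
    by (simp only: sqrt_iter.simps scaleC_diff_right[symmetric]) simp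
  also have "?Y' * ?Y' - ?Y * ?Y = (?Y' + ?Y) * (?Y' - ?Y)"
    using comm by (simp add: distrib_right right_diff_distrib)
  finally have eq: "(sqrt_iter B (Suc (Suc n)) - ?Y') *\<^sub>V x =
      (1/2) *\<^sub>C (?Y' *\<^sub>V ((?Y' - ?Y) *\<^sub>V x) + ?Y *\<^sub>V ((?Y' - ?Y) *\<^sub>V x))"
    by (simp only: bop_simps)
  let ?d = "(?Y' - ?Y) *\<^sub>V x"
  have "norm (?Y' *\<^sub>V ?d + ?Y *\<^sub>V ?d) \<le> (?y' + ?y) * norm ?d"
    using norm_triangle_ineq[of "?Y' *\<^sub>V ?d" "?Y *\<^sub>V ?d"] norm_sqrt_iter[of "Suc n" ?d]
      norm_sqrt_iter[of n ?d] by (simp only: distrib_right)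
  also have "\<dots> \<le> (?y' + ?y) * ((?y' - ?y) * norm x)"
    by (rule mult_left_mono[OF Suc]) (simp add: scalar_iter_bounds add_nonneg_nonneg del: scalar_iter.simps)
  also have "\<dots> = 2 * ((scalar_iter (Suc (Suc n)) - ?y') * norm x)"
    by (simp add: scalar_iter.simps(2)[of "Suc n"] del: scalar_iter.simps)
      (simp add: power2_eq_square field_simps)
  finally show ?case unfolding eq norm_scaleC by simp
qed

lemma norm_sqrt_iter_diff:
  "norm (sqrt_iter B (n + k) *\<^sub>V x - sqrt_iter B n *\<^sub>V x) \<le> (scalar_iter (n + k) - scalar_iter n) * norm x"
proof (induction k)
  case (Suc k)
  have "norm (sqrt_iter B (n + Suc k) *\<^sub>V x - sqrt_iter B n *\<^sub>V x)
      \<le> norm ((sqrt_iter B (Suc (n + k)) - sqrt_iter B (n + k)) *\<^sub>V x)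
        + norm (sqrt_iter B (n + k) *\<^sub>V x - sqrt_iter B n *\<^sub>V x)"
    by (rule order_trans[OF _ norm_triangle_ineq]) (simp add: bop_simps(6) del: sqrt_iter.simps)
  also have "\<dots> \<le> (scalar_iter (Suc (n + k)) - scalar_iter (n + k)) * norm x
      + (scalar_iter (n + k) - scalar_iter n) * norm x"
    by (rule add_mono[OF norm_sqrt_iter_step Suc])
  finally show ?case by (simp add: algebra_simps del: sqrt_iter.simps scalar_iter.simps)
qed simp

text \<open>The scalar sequence is increasing and bounded by \<open>1\<close>, hence Cauchy, and its
  telescoped increments dominate those of the operators at every vector. So the iterates converge
  strongly, which is enough to pass to the limit in the recursion.\<close>

lemma contraction_sqrt_exists:
  assumes sa: "adj B = B"
  obtains Y where "adj Y = Y" "\<And>x. norm (Y *\<^sub>V x) \<le> norm x" "Y + Y = B + Y * Y"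
    "\<And>T. T * B = B * T \<Longrightarrow> T * Y = Y * T"
proof -
  have "incseq scalar_iter" by (rule incseq_SucI) (rule scalar_iter_Suc_le)
  then have "convergent scalar_iter"
    using incseq_convergent[of scalar_iter 1] scalar_iter_bounds by (metis convergent_def)
  then have cs: "Cauchy scalar_iter" by (rule convergent_Cauchy)
  have "Cauchy (\<lambda>n. sqrt_iter B n *\<^sub>V x)" for x
  proof (rule CauchyI')
    fix e :: real assume "e > 0"
    then have "e / (norm x + 1) > 0" by (simp add: add_nonneg_pos)
    then obtain N where N: "\<And>m n. m \<ge> N \<Longrightarrow> n \<ge> N \<Longrightarrow> \<bar>scalar_iter m - scalar_iter n\<bar> < e / (norm x + 1)"
      using cs unfolding Cauchy_def dist_real_def by metis
    show "\<exists>M. \<forall>m\<ge>M. \<forall>n>m. dist (sqrt_iter B m *\<^sub>V x) (sqrt_iter B n *\<^sub>V x) < e"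
      unfolding dist_norm
    proof (intro exI allI impI)
      fix m n assume mn: "N \<le> m" "m < n"
      have "norm (sqrt_iter B m *\<^sub>V x - sqrt_iter B n *\<^sub>V x) \<le> (scalar_iter n - scalar_iter m) * norm x"
        using norm_sqrt_iter_diff[of m "n - m" x] mn by (simp add: norm_minus_commute)
      also have "\<dots> \<le> (e / (norm x + 1)) * norm x"
        using N[of n m] mn by (intro mult_right_mono) auto
      also have "\<dots> < e"
        using \<open>e > 0\<close> add_nonneg_pos[OF norm_ge_zero[of x] zero_less_one] by (simp add: field_simps)
      finally show "norm (sqrt_iter B m *\<^sub>V x - sqrt_iter B n *\<^sub>V x) < e" .
    qed
  qed
  then have "\<forall>x. \<exists>l. (\<lambda>n. sqrt_iter B n *\<^sub>V x) \<longlonglongrightarrow> l"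
    by (simp add: Cauchy_convergent_iff convergent_def)
  from choice[OF this] obtain y where y: "\<And>x. (\<lambda>n. sqrt_iter B n *\<^sub>V x) \<longlonglongrightarrow> y x" by auto
  have yb: "norm (y x) \<le> norm x" for x
  proof (rule LIMSEQ_le_const2[OF tendsto_norm[OF y]], intro exI allI impI)
    fix n
    have "scalar_iter n * norm x \<le> norm x"
      using mult_right_mono[OF scalar_iter_bounds(2)[of n], of "norm x"] by simp
    then show "norm (sqrt_iter B n *\<^sub>V x) \<le> norm x" using norm_sqrt_iter[of n x] by linarith
  qed
  define Y where "Y = Abs_bop y"
  have Y: "Y *\<^sub>V x = y x" for x unfolding Y_def
  proof (rule Abs_bop_apply[where K = 1])
    show "y (a + b) = y a + y b" for a b
      by (rule LIMSEQ_unique[OF y]) (simp add: bop_apply_add tendsto_add y)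
    show "y (c *\<^sub>C a) = c *\<^sub>C y a" for c a
      by (rule LIMSEQ_unique[OF y]) (simp add: bop_apply_scaleC scaleC.tendsto y)
    show "norm (y a) \<le> 1 * norm a" for a using yb by simp
  qed
  have lim: "(\<lambda>n. sqrt_iter B n *\<^sub>V x) \<longlonglongrightarrow> Y *\<^sub>V x" for x using y Y by simp
  show thesis
  proof (rule that)
    show "adj Y = Y"
    proof (rule adj_eqI)
      fix a b
      have "(\<lambda>n. cinner (sqrt_iter B n *\<^sub>V a) b) \<longlonglongrightarrow> cinner (Y *\<^sub>V a) b"
        by (intro cinner.tendsto lim tendsto_const)
      moreover have "(\<lambda>n. cinner (sqrt_iter B n *\<^sub>V a) b) \<longlonglongrightarrow> cinner a (Y *\<^sub>V b)"
        unfolding cinner_adj sqrt_iter_adj[OF sa] by (intro cinner.tendsto lim tendsto_const)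
      ultimately show "cinner (Y *\<^sub>V a) b = cinner a (Y *\<^sub>V b)" by (rule LIMSEQ_unique)
    qed
    show "norm (Y *\<^sub>V x) \<le> norm x" for x using yb Y by simp
    show "T * Y = Y * T" if "T * B = B * T" for T
    proof (rule bop_eqI)
      fix x
      have "(\<lambda>n. T *\<^sub>V (sqrt_iter B n *\<^sub>V x)) \<longlonglongrightarrow> T *\<^sub>V (Y *\<^sub>V x)"
        by (intro bop_apply_tendsto lim)
      moreover have "T *\<^sub>V (sqrt_iter B n *\<^sub>V x) = sqrt_iter B n *\<^sub>V (T *\<^sub>V x)" for n
        using sqrt_iter_commute[OF that, of n] by (metis times_bop.rep_eq)
      ultimately have "(\<lambda>n. sqrt_iter B n *\<^sub>V (T *\<^sub>V x)) \<longlonglongrightarrow> T *\<^sub>V (Y *\<^sub>V x)" by simp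
      from LIMSEQ_unique[OF this lim] show "(T * Y) *\<^sub>V x = (Y * T) *\<^sub>V x" by (simp add: bop_simps)
    qed
    show "Y + Y = B + Y * Y"
    proof (rule bop_eqI)
      fix x
      \<comment> \<open>All iterates are contractions, so applying the varying iterate to the
        vanishing error \<open>Yx - Y\<^sub>nx\<close> still tends to \<open>0\<close>; this gives
        convergence of the squares.\<close>
      have a: "(\<lambda>n. sqrt_iter B n *\<^sub>V (Y *\<^sub>V x - sqrt_iter B n *\<^sub>V x)) \<longlonglongrightarrow> 0"
      proof (rule tendsto_norm_zero_cancel, rule tendsto_sandwich[OF _ _ tendsto_const])
        have "norm (sqrt_iter B n *\<^sub>V z) \<le> norm z" for n z
          using norm_sqrt_iter[of n z] mult_right_mono[OF scalar_iter_bounds(2)[of n], of "norm z"]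
          by simp
        then show "\<forall>\<^sub>F n in sequentially. norm (sqrt_iter B n *\<^sub>V (Y *\<^sub>V x - sqrt_iter B n *\<^sub>V x))
            \<le> norm (Y *\<^sub>V x - sqrt_iter B n *\<^sub>V x)" by simp
        show "(\<lambda>n. norm (Y *\<^sub>V x - sqrt_iter B n *\<^sub>V x)) \<longlonglongrightarrow> 0"
          using tendsto_norm[OF tendsto_diff[OF tendsto_const lim[of x]], of "Y *\<^sub>V x"] by simp
      qed simp
      have "(\<lambda>n. sqrt_iter B n *\<^sub>V (sqrt_iter B n *\<^sub>V x)) \<longlonglongrightarrow> Y *\<^sub>V (Y *\<^sub>V x) - 0"
        using tendsto_diff[OF lim[of "Y *\<^sub>V x"] a] by (simp add: bop_apply_diff)
      then have "(\<lambda>n. (1/2) *\<^sub>C (B *\<^sub>V x + sqrt_iter B n *\<^sub>V (sqrt_iter B n *\<^sub>V x)))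
          \<longlonglongrightarrow> (1/2) *\<^sub>C (B *\<^sub>V x + Y *\<^sub>V (Y *\<^sub>V x))"
        by (intro scaleC.tendsto tendsto_add tendsto_const) simp
      then have "(\<lambda>n. sqrt_iter B (Suc n) *\<^sub>V x) \<longlonglongrightarrow> (1/2) *\<^sub>C (B *\<^sub>V x + Y *\<^sub>V (Y *\<^sub>V x))"
        by (simp add: bop_simps)
      from LIMSEQ_unique[OF LIMSEQ_Suc[OF lim] this]
      have "Y *\<^sub>V x = (1/2) *\<^sub>C (B *\<^sub>V x + Y *\<^sub>V (Y *\<^sub>V x))" .
      then have "Y *\<^sub>V x + Y *\<^sub>V x = ((1/2) + (1/2)) *\<^sub>C (B *\<^sub>V x + Y *\<^sub>V (Y *\<^sub>V x))"
        by (simp only: scaleC_add_left)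
      then show "(Y + Y) *\<^sub>V x = (B + Y * Y) *\<^sub>V x" by (simp add: bop_simps)
    qed
  qed
qed

end

text \<open>Dividing by a bound \<open>c\<close> makes \<open>B = 1 - A/c\<close> a contraction, and
  then \<open>(1 - Y)\<^sup>2 = A/c\<close>. The commutation clause is recorded for the proof of
  uniqueness.\<close>

lemma positive_sqrt_exists:
  assumes A: "positive_op (A :: 'h::chilbert_space bop)"
  shows "\<exists>R. positive_op R \<and> R * R = A \<and> (\<forall>T. T * A = A * T \<longrightarrow> T * R = R * T)"
proof -
  obtain c where c: "c > 0" "\<And>x. norm (A *\<^sub>V x) \<le> c * norm x" using bop_bound[of A] by blast
  define d where "d = complex_of_real (1 / c)"
  define B where "B = 1 - d *\<^sub>C A"
  have saB: "adj B = B"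
    by (simp add: B_def adj_diff adj_scaleC positive_op_adj[OF A] d_def)
  have contr: "norm (B *\<^sub>V x) \<le> norm x" for x
  proof -
    have dA: "(d *\<^sub>C A) *\<^sub>V x = (1/c) *\<^sub>R (A *\<^sub>V x)" by (simp add: bop_simps d_def scaleR_scaleC)
    have "(norm (B *\<^sub>V x))\<^sup>2 = (norm x)\<^sup>2 + (1/c)\<^sup>2 * (norm (A *\<^sub>V x))\<^sup>2 - 2 / c * Re (cinner x (A *\<^sub>V x))"
      unfolding B_def minus_bop.rep_eq one_bop.rep_eq dA norm_diff_square
      using c(1) by (simp add: cinner.scaleR_right power_mult_distrib power_divide)
    also have "Re (cinner x (A *\<^sub>V x)) = Re (cinner (A *\<^sub>V x) x)"
      by (metis cinner_commute complex_cnj cnj.sel(1))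
    also have "(norm x)\<^sup>2 + (1/c)\<^sup>2 * (norm (A *\<^sub>V x))\<^sup>2 - 2 / c * Re (cinner (A *\<^sub>V x) x)
        \<le> (norm x)\<^sup>2 + (1/c)\<^sup>2 * (c * Re (cinner (A *\<^sub>V x) x)) - 2 / c * Re (cinner (A *\<^sub>V x) x)"
      by (intro diff_right_mono add_left_mono mult_left_mono positive_op_norm_bound A c) simp
    also have "\<dots> = (norm x)\<^sup>2 - Re (cinner (A *\<^sub>V x) x) / c"
      using c(1) by (simp add: power2_eq_square field_simps)
    also have "\<dots> \<le> (norm x)\<^sup>2" using positive_op_Re[OF A, of x] c(1) by simp
    finally show ?thesis by (rule power2_le_imp_le) simp
  qed
  obtain Y where Y: "adj Y = Y" "\<And>x. norm (Y *\<^sub>V x) \<le> norm x" "Y + Y = B + Y * Y"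
    "\<And>T. T * B = B * T \<Longrightarrow> T * Y = Y * T"
    using contraction_sqrt_exists[OF contr saB] by blast
  define s where "s = complex_of_real (sqrt c)"
  define R where "R = s *\<^sub>C (1 - Y)"
  have "positive_op R"
  proof (rule positive_opI)
    show "adj R = R" by (simp add: R_def s_def adj_scaleC adj_diff Y)
    fix x
    have "Re (cinner (Y *\<^sub>V x) x) \<le> norm (Y *\<^sub>V x) * norm x"
      by (rule order_trans[OF complex_Re_le_cmod cinner_Cauchy_Schwarz])
    also have "\<dots> \<le> (norm x)\<^sup>2" using mult_right_mono[OF Y(2)[of x], of "norm x"] by (simp add: power2_eq_square)
    finally have "0 \<le> Re (cinner x x) - Re (cinner (Y *\<^sub>V x) x)" by (simp add: cinner_self)
    then show "0 \<le> Re (cinner (R *\<^sub>V x) x)"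
      using c(1) by (simp add: R_def s_def bop_simps cinner_scaleC_left cinner.diff_left)
  qed
  moreover have "R * R = A"
  proof -
    have "R * R = (s * s) *\<^sub>C ((1 - Y) * (1 - Y))"
      by (simp add: R_def bop_mult_scaleC_left bop_mult_scaleC_right scaleC_scaleC)
    also have "(1 - Y) * (1 - Y) = 1 - (Y + Y) + Y * Y" by (simp add: left_diff_distrib right_diff_distrib)
    also have "\<dots> = d *\<^sub>C A" unfolding Y(3) B_def by simp
    also have "s * s = complex_of_real c" unfolding s_def of_real_mult[symmetric] using c(1) by simp
    also have "complex_of_real c *\<^sub>C d *\<^sub>C A = A"
      using c(1) by (simp add: scaleC_scaleC d_def scaleC_one)
    finally show ?thesis .
  qed
  moreover have "T * R = R * T" if "T * A = A * T" for T
  proof -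
    have "T * B = B * T" unfolding B_def
      by (simp add: left_diff_distrib right_diff_distrib bop_mult_scaleC_left bop_mult_scaleC_right that)
    from Y(4)[OF this] show ?thesis
      by (simp add: R_def left_diff_distrib right_diff_distrib bop_mult_scaleC_left bop_mult_scaleC_right)
  qed
  ultimately show ?thesis by blast
qed

text \<open>A root \<open>Q\<close> commutes with its square, hence with the constructed root
  \<open>R\<close>, so \<open>(Q + R)(Q - R) = 0\<close>. On the range of \<open>Q - R\<close> both
  quadratic forms therefore vanish, which gives \<open>(Q - R)\<^sup>2 = 0\<close>, and
  \<open>Q - R\<close> is self-adjoint.\<close>

lemma positive_sqrt_unique:
  assumes P: "positive_op P" and Q: "positive_op Q" and eq: "P * P = Q * Q"
  shows "P = (Q :: 'h::chilbert_space bop)"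
proof -
  \<comment> \<open>Compares an arbitrary root with the constructed one; it is applied to
    \<open>P\<close> and to \<open>Q\<close>.\<close>
  have *: "Q = R" if R: "positive_op R" "R * R = Q * Q" "\<And>T. T * (Q * Q) = (Q * Q) * T \<Longrightarrow> T * R = R * T"
    and Q: "positive_op Q" for Q R :: "'h bop"
  proof -
    have QR: "Q * R = R * Q" by (rule R(3)) (simp add: mult.assoc)
    have prod: "(Q + R) * (Q - R) = 0"
      using R(2) QR by (simp add: distrib_right right_diff_distrib)
    have z: "(Q - R) *\<^sub>V ((Q - R) *\<^sub>V x) = 0" for x
    proof -
      let ?y = "(Q - R) *\<^sub>V x"
      have "(Q + R) *\<^sub>V ?y = 0" using prod by (metis times_bop.rep_eq zero_bop.rep_eq)
      then have "Re (cinner (Q *\<^sub>V ?y) ?y) + Re (cinner (R *\<^sub>V ?y) ?y) = 0"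
        by (simp add: plus_bop.rep_eq cinner_add_left[symmetric] plus_complex.sel(1)[symmetric] del: plus_complex.sel)
      then have "Re (cinner (Q *\<^sub>V ?y) ?y) = 0" "Re (cinner (R *\<^sub>V ?y) ?y) = 0"
        using positive_op_Re[OF Q, of ?y] positive_op_Re[OF R(1), of ?y] by linarith+
      then have "Q *\<^sub>V ?y = 0" "R *\<^sub>V ?y = 0" using positive_op_kernel Q R(1) by blast+
      then show ?thesis by (subst minus_bop.rep_eq) simp
    qed
    have sa: "adj (Q - R) = Q - R" by (simp add: adj_diff positive_op_adj Q R(1))
    have "(Q - R) *\<^sub>V x = 0" for x
    proof -
      have "cinner ((Q - R) *\<^sub>V x) ((Q - R) *\<^sub>V x) = 0"
        using cinner_adj[of "Q - R" x "(Q - R) *\<^sub>V x"] by (simp only: sa z cinner.zero_right)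
      then show ?thesis by (simp only: cinner_eq_zero_iff)
    qed
    then have "Q - R = 0" by (intro bop_eqI) (simp add: zero_bop.rep_eq)
    then show ?thesis by simp
  qed
  have "positive_op (adj P * P)" by (rule positive_op_adj_mult)
  then have "positive_op (P * P)" by (simp add: positive_op_adj[OF P])
  from positive_sqrt_exists[OF this] obtain R where R: "positive_op R" "R * R = P * P"
    "\<forall>T. T * (P * P) = (P * P) * T \<longrightarrow> T * R = R * T" by blast
  have "P = R" by (rule *[OF R(1,2) _ P]) (rule R(3)[rule_format])
  moreover have "Q = R" by (rule *[OF R(1,2)[unfolded eq] _ Q]) (rule R(3)[unfolded eq, rule_format])
  ultimately show ?thesis by simp
qed

lemma abs_op_eqI: "positive_op P \<Longrightarrow> P * P = adj A * A \<Longrightarrow> abs_op A = P"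
  unfolding abs_op_def by (rule the_equality) (auto intro: positive_sqrt_unique)

lemma abs_op: "positive_op (abs_op A)" "abs_op A * abs_op A = adj A * A"
proof -
  obtain R where "positive_op R" "R * R = adj A * A"
    using positive_sqrt_exists[OF positive_op_adj_mult[of A]] by blast
  with abs_op_eqI[OF this] show "positive_op (abs_op A)" "abs_op A * abs_op A = adj A * A" by simp_all
qed

lemma norm_abs_op: "norm (abs_op A *\<^sub>V x) = norm (A *\<^sub>V x)"
proof -
  have "cinner (abs_op A *\<^sub>V x) (abs_op A *\<^sub>V x) = cinner ((abs_op A * abs_op A) *\<^sub>V x) x"
    by (simp add: bop_simps cinner_adj positive_op_adj[OF abs_op(1)])
  also have "\<dots> = cinner (A *\<^sub>V x) (A *\<^sub>V x)"
    unfolding abs_op(2) by (simp add: bop_simps cinner_adj_left)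
  finally have "(norm (abs_op A *\<^sub>V x))\<^sup>2 = (norm (A *\<^sub>V x))\<^sup>2"
    by (simp only: cinner_self of_real_eq_iff)
  then show ?thesis by (simp add: power2_eq_iff_nonneg)
qed

section \<open>Orthonormal bases and Parseval sequences\<close>

interpretation cvs: vector_space "scaleC :: complex \<Rightarrow> 'a \<Rightarrow> 'a::complex_vector"
  by (rule vector_space_scaleC)

lemma csubspace_span: "csubspace (cvs.span E)"
  by (rule csubspaceI) (auto intro: cvs.span_zero cvs.span_add cvs.span_scale)

lemma cinner_zero_commute: "cinner x y = 0 \<longleftrightarrow> cinner y x = 0"
  by (metis cinner_commute complex_cnj_zero_iff)

text \<open>Zorn: if the closed span of a maximal orthonormal set were proper, a normalized vector
  orthogonal to it could be added.\<close>

lemma onb_exists: "\<exists>E :: 'h::chilbert_space set. is_onb E"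
proof -
  define \<S> where "\<S> = {E :: 'h set. (\<forall>e\<in>E. norm e = 1) \<and> (\<forall>e\<in>E. \<forall>f\<in>E. e \<noteq> f \<longrightarrow> cinner e f = 0)}"
  have "\<Union>C \<in> \<S>" if C: "subset.chain \<S> C" for C
  proof -
    have sub: "C \<subseteq> \<S>" and chain: "\<And>X Y. X \<in> C \<Longrightarrow> Y \<in> C \<Longrightarrow> X \<subseteq> Y \<or> Y \<subseteq> X"
      using C by (auto simp: subset_chain_def)
    have "cinner e f = 0" if "e \<in> X" "X \<in> C" "f \<in> Y" "Y \<in> C" "e \<noteq> f" for e f X Y
    proof -
      obtain Z where "Z \<in> C" "e \<in> Z" "f \<in> Z" using chain[of X Y] \<open>e \<in> X\<close> \<open>X \<in> C\<close> \<open>f \<in> Y\<close> \<open>Y \<in> C\<close> by blast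
      then show ?thesis using sub \<open>e \<noteq> f\<close> by (auto simp: \<S>_def)
    qed
    moreover have "norm e = 1" if "e \<in> X" "X \<in> C" for e X using sub that by (auto simp: \<S>_def)
    ultimately show ?thesis unfolding \<S>_def by blast
  qed
  then obtain M where M: "M \<in> \<S>" "\<And>X. X \<in> \<S> \<Longrightarrow> M \<subseteq> X \<Longrightarrow> X = M"
    using subset_Zorn'[of \<S>] by blast
  define S where "S = closure (cvs.span M)"
  have S: "csubspace S" "closed S"
    unfolding S_def by (simp_all add: csubspace_closure csubspace_span)
  have MS: "M \<subseteq> S" unfolding S_def using cvs.span_superset closure_subset by blast
  have "S = UNIV"
  proof (rule ccontr)
    assume "S \<noteq> UNIV"
    then obtain x where x: "x \<notin> S" by blast
    define z where "z = x - proj S *\<^sub>V x"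
    have z0: "z \<noteq> 0" using x proj_mem[OF S, of x] by (auto simp: z_def)
    have zS: "cinner z y = 0" if "y \<in> S" for y unfolding z_def by (rule proj_ortho[OF S that])
    define e where "e = complex_of_real (1 / norm z) *\<^sub>C z"
    have e1: "norm e = 1" using z0 by (simp add: e_def norm_scaleC norm_divide)
    have eS: "cinner e y = 0" if "y \<in> S" for y by (simp add: e_def cinner_scaleC_left zS[OF that])
    have eS': "cinner y e = 0" if "y \<in> S" for y using eS[OF that] cinner_zero_commute by blast
    have "insert e M \<in> \<S>"
      using M(1) e1 eS eS' MS unfolding \<S>_def by auto
    then have "e \<in> M" using M(2)[of "insert e M"] by blast
    then have "cinner e e = 0" using eS MS by blast
    then show False using e1 by (simp add: cinner_eq_zero_iff)
  qed
  then have "is_onb M" using M(1) by (simp add: is_onb_def \<S>_def S_def)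
  then show ?thesis by blast
qed

lemma mult_le_sum_squares: "0 \<le> a \<Longrightarrow> 0 \<le> b \<Longrightarrow> a * b \<le> a\<^sup>2 + (b\<^sup>2 :: real)"
proof -
  assume "0 \<le> a" "0 \<le> b"
  then have "0 \<le> a * b" by simp
  then show ?thesis using sum_squares_bound[of a b] by linarith
qed

text \<open>The only property of a basis that is used. Zero vectors are allowed and orthonormality
  is not recorded, so a finite basis can be padded to a sequence.\<close>

definition parseval :: "(nat \<Rightarrow> 'h::chilbert_space) \<Rightarrow> bool" where
  "parseval e \<longleftrightarrow> (\<forall>x y. ((\<lambda>n. cinner x (e n) * cinner (e n) y) has_sum cinner x y) UNIV)"

lemma parseval_norm:
  assumes "parseval e"
  shows "((\<lambda>n. (cmod (cinner x (e n)))\<^sup>2) has_sum (norm x)\<^sup>2) UNIV"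
proof -
  have "((\<lambda>n. cinner x (e n) * cinner (e n) x) has_sum cinner x x) UNIV"
    using assms by (simp add: parseval_def)
  from has_sum_Re[OF this] show ?thesis
    by (simp add: cmod_cinner_mult cinner_self del: times_complex.sel)
qed

text \<open>\<open>P N\<close> is the projection onto the span of the first \<open>N\<close>
  vectors. On the span of all of them it is eventually exact, and the contractions
  \<open>x \<mapsto> x - P N x\<close> carry convergence over to the closure.\<close>

lemma parseval_if_orthogonal_total:
  fixes e :: "nat \<Rightarrow> 'h::chilbert_space"
  assumes norm: "\<And>n. norm (e n) = 1 \<or> e n = 0"
    and ortho: "\<And>m n. m \<noteq> n \<Longrightarrow> cinner (e m) (e n) = 0"
    and total: "closure (cvs.span (range e)) = UNIV"
  shows "parseval e"
proof -
  define P where "P N x = (\<Sum>n<N. cinner x (e n) *\<^sub>C e n)" for N x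
  have P_inner: "cinner (P N x) y = (\<Sum>n<N. cinner x (e n) * cinner (e n) y)" for N x y
    by (simp add: P_def cinner.sum_left cinner_scaleC_left)
  have P_e: "cinner (P N x) (e m) = cinner x (e m)" if "m < N" for N x m
  proof -
    have "cinner (P N x) (e m) = (\<Sum>n<N. if n = m then cinner x (e m) * cinner (e m) (e m) else 0)"
      unfolding P_inner by (intro sum.cong) (auto simp: ortho)
    also have "\<dots> = cinner x (e m) * cinner (e m) (e m)" using that by simp
    also have "\<dots> = cinner x (e m)" using norm[of m] by (auto simp: cinner_self)
    finally show ?thesis .
  qed
  have P_orth: "cinner (x - P N x) (P N x) = 0" for N x
    unfolding P_def[of N x] cinner.sum_right cinner_scaleC_right
    by (rule sum.neutral) (simp add: cinner.diff_left P_e P_def[symmetric])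
  have pyth: "(norm x)\<^sup>2 = (norm (x - P N x))\<^sup>2 + (norm (P N x))\<^sup>2" for N x
    using norm_add_square[of "x - P N x" "P N x"] P_orth[where N = N and x = x] by simp
  have contr: "norm (x - P N x) \<le> norm x" for N x
  proof -
    have "(norm (x - P N x))\<^sup>2 \<le> (norm x)\<^sup>2" using pyth[of x N] by simp
    then show ?thesis by (rule power2_le_imp_le) simp
  qed
  have P_norm: "(norm (P N x))\<^sup>2 = (\<Sum>n<N. (cmod (cinner x (e n)))\<^sup>2)" for N x
  proof -
    have "cinner (P N x) (P N x) = cinner x (P N x)"
      using P_orth[of x N] by (simp add: cinner.diff_left)
    also have "\<dots> = (\<Sum>n<N. cnj (cinner x (e n)) * cinner x (e n))"
      by (simp add: P_def[of N x] cinner.sum_right cinner_scaleC_right)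
    also have "\<dots> = of_real (\<Sum>n<N. (cmod (cinner x (e n)))\<^sup>2)"
      by (simp add: complex_norm_square mult.commute del: of_real_power)
    finally show ?thesis by (simp only: cinner_self of_real_eq_iff)
  qed
  have P_add: "P N (x + y) = P N x + P N y" for N x y
    by (simp add: P_def cinner_add_left scaleC_add_left sum.distrib)
  have P_scaleC: "P N (c *\<^sub>C x) = c *\<^sub>C P N x" for N c x
    by (simp add: P_def cinner_scaleC_left scaleC.sum_right scaleC_scaleC)
  have P_diff: "P N (x - y) = P N x - P N y" for N x y
    using P_add[of N x "(-1) *\<^sub>C y"] P_scaleC[of N "-1" y] by (simp add: scaleC_minus_one)
  have "\<exists>N0. \<forall>N\<ge>N0. P N x = x" if "x \<in> cvs.span (range e)" for x
    using that
  proof (induction rule: cvs.span_induct_alt)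
    case base
    show ?case using P_scaleC[of _ 0 0] by simp
  next
    case (step c x y)
    then obtain N0 where N0: "\<And>N. N \<ge> N0 \<Longrightarrow> P N y = y" by blast
    obtain m where m: "x = e m" using step by blast
    have "P N x = x" if "N > m" for N
    proof -
      have "P N x = (\<Sum>n<N. if n = m then e m else 0)" unfolding P_def m
        by (intro sum.cong refl) (use norm[of m] in \<open>auto simp: ortho cinner_self\<close>)
      then show ?thesis using that m by simp
    qed
    then show ?case
      by (intro exI[of _ "max N0 (Suc m)"]) (simp add: P_add P_scaleC N0)
  qed
  then have P_lim_span: "\<exists>N0. \<forall>N\<ge>N0. P N x = x" if "x \<in> cvs.span (range e)" for x using that by blast
  have P_lim: "(\<lambda>N. P N x) \<longlonglongrightarrow> x" for x
  proof (rule LIMSEQ_I)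
    fix r :: real assume r: "0 < r"
    have "x \<in> closure (cvs.span (range e))" using total by simp
    then obtain y where y: "y \<in> cvs.span (range e)" "dist y x < r"
      using r by (auto simp: closure_approachable)
    obtain N0 where N0: "\<And>N. N \<ge> N0 \<Longrightarrow> P N y = y" using P_lim_span[OF y(1)] by blast
    show "\<exists>no. \<forall>n\<ge>no. norm (P n x - x) < r"
    proof (intro exI allI impI)
      fix n assume "N0 \<le> n"
      then have "P n x - x = - ((x - y) - P n (x - y))" by (simp add: P_diff N0)
      then have "norm (P n x - x) = norm ((x - y) - P n (x - y))" by (simp only: norm_minus_cancel)
      also have "\<dots> \<le> norm (x - y)" by (rule contr)
      also have "\<dots> < r" using y(2) by (simp add: dist_norm norm_minus_commute)
      finally show "norm (P n x - x) < r" .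
    qed
  qed
  have sq: "summable (\<lambda>n. (cmod (cinner x (e n)))\<^sup>2)" for x
  proof (rule bounded_imp_summable)
    show "(\<Sum>k\<le>n. (cmod (cinner x (e k)))\<^sup>2) \<le> (norm x)\<^sup>2" for n
      using P_norm[of "Suc n" x] pyth[of x "Suc n"] by (simp add: lessThan_Suc_atMost)
  qed simp
  \<comment> \<open>\<open>has_sum\<close> is unordered, so the limit of the partial sums must be
    complemented by absolute convergence, which Bessel's inequality supplies.\<close>
  show ?thesis unfolding parseval_def
  proof (intro allI norm_summable_imp_has_sum)
    fix x y
    show "(\<lambda>n. cinner x (e n) * cinner (e n) y) sums cinner x y"
      unfolding sums_def P_inner[symmetric] by (intro cinner.tendsto P_lim tendsto_const)
    show "summable (\<lambda>n. norm (cinner x (e n) * cinner (e n) y))"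
    proof (rule summable_comparison_test')
      show "summable (\<lambda>n. (cmod (cinner x (e n)))\<^sup>2 + (cmod (cinner y (e n)))\<^sup>2)"
        by (intro summable_add sq)
      have "cmod (cinner (e n) y) = cmod (cinner y (e n))" for n
        by (subst cinner_commute) simp
      then show "norm (norm (cinner x (e n) * cinner (e n) y)) \<le> (cmod (cinner x (e n)))\<^sup>2 + (cmod (cinner y (e n)))\<^sup>2" for n
        using mult_le_sum_squares[of "cmod (cinner x (e n))" "cmod (cinner y (e n))"]
        by (simp add: norm_mult)
    qed
  qed
qed

text \<open>Distinct orthonormal vectors have squared distance \<open>2\<close>, so points of a
  dense set chosen within \<open>1/2\<close> of them are distinct.\<close>

lemma orthonormal_countable:
  fixes E :: "'h::chilbert_space set"
  assumes sep: "separable_space (euclidean :: 'h topology)"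
    and E: "\<And>e. e \<in> E \<Longrightarrow> norm e = 1" "\<And>e f. e \<in> E \<Longrightarrow> f \<in> E \<Longrightarrow> e \<noteq> f \<Longrightarrow> cinner e f = 0"
  shows "countable E"
proof -
  obtain C :: "'h set" where C: "countable C" "closure C = UNIV"
    using sep by (auto simp: separable_space_def)
  have "\<exists>c\<in>C. dist c e < 1/2" for e
  proof -
    have "e \<in> closure C" using C(2) by simp
    moreover have "(0::real) < 1/2" by simp
    ultimately show ?thesis unfolding closure_approachable by blast
  qed
  then have "\<forall>e. \<exists>d. d \<in> C \<and> dist d e < 1/2" by blast
  from choice[OF this] obtain c where c: "\<And>e. c e \<in> C" "\<And>e. dist (c e) e < 1/2" by blast
  have inj: "inj_on c E"
  proof (rule inj_onI, rule ccontr)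
    fix e f assume ef: "e \<in> E" "f \<in> E" "c e = c f" "e \<noteq> f"
    have "dist e f < 1" using c(2)[of e] c(2)[of f] ef(3) dist_triangle_half_r[of "c e" e 1 f] by simp
    then have "(norm (e - f))\<^sup>2 < 1" unfolding dist_norm by (simp add: abs_square_less_1)
    moreover have "(norm (e - f))\<^sup>2 = 2" unfolding norm_diff_square using E ef by simp
    ultimately show False by simp
  qed
  have "c ` E \<subseteq> C" using c(1) by blast
  then have "countable (c ` E)" by (rule countable_subset[OF _ C(1)])
  from countable_image_inj_on[OF this inj] show ?thesis .
qed

text \<open>The total sum over the basis is transported to a sequence that may contain zeros, so that
  finite and infinite bases are treated alike.\<close>

lemma onb_enumeration:
  fixes E :: "'h::chilbert_space set"
  assumes sep: "separable_space (euclidean :: 'h topology)" and E: "is_onb E"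
  shows "\<exists>e. parseval e \<and> (\<forall>(F :: 'h \<Rightarrow> complex) s. F 0 = 0 \<longrightarrow>
    (F has_sum s) E = ((\<lambda>n. F (e n)) has_sum s) UNIV)"
proof -
  have E': "\<And>e. e \<in> E \<Longrightarrow> norm e = 1" "\<And>e f. e \<in> E \<Longrightarrow> f \<in> E \<Longrightarrow> e \<noteq> f \<Longrightarrow> cinner e f = 0"
    "closure (cvs.span E) = UNIV"
    using E by (auto simp: is_onb_def)
  have "countable E" by (rule orthonormal_countable[OF sep E'(1,2)])
  define g where "g = to_nat_on E"
  have g: "inj_on g E" unfolding g_def by (rule inj_on_to_nat_on) fact
  define e where "e n = (if n \<in> g ` E then the_inv_into E g n else 0)" for n
  have eg: "e (g x) = x" if "x \<in> E" for x using that g by (simp add: e_def the_inv_into_f_f)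
  have e_cases: "(\<exists>x\<in>E. n = g x) \<or> (n \<notin> g ` E \<and> e n = 0)" for n by (auto simp: e_def)
  have "parseval e"
  proof (rule parseval_if_orthogonal_total)
    show "norm (e n) = 1 \<or> e n = 0" for n
      using e_cases[of n] E'(1) eg by auto
    show "cinner (e m) (e n) = 0" if "m \<noteq> n" for m n
    proof (cases "n \<in> g ` E \<and> m \<in> g ` E")
      case True
      then obtain x y where "x \<in> E" "y \<in> E" "n = g x" "m = g y" by blast
      then show ?thesis using that E'(2)[of y x] by (auto simp: eg)
    next
      case False
      then have "e n = 0 \<or> e m = 0" using e_cases[of n] e_cases[of m] by blast
      then show ?thesis by auto
    qed
    have "E \<subseteq> range e" 
    proof
      fix x assume "x \<in> E"
      show "x \<in> range e" using eg[OF \<open>x \<in> E\<close>] by (rule range_eqI[OF sym])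
    qed
    then have "closure (cvs.span E) \<subseteq> closure (cvs.span (range e))"
      by (intro closure_mono cvs.span_mono)
    then show "closure (cvs.span (range e)) = UNIV" using E'(3) by blast
  qed
  moreover have "(F has_sum s) E \<longleftrightarrow> ((\<lambda>n. F (e n)) has_sum s) UNIV"
    if "F 0 = 0" for F :: "'h \<Rightarrow> complex" and s
  proof -
    have "(F has_sum s) E \<longleftrightarrow> (((\<lambda>n. F (e n)) \<circ> g) has_sum s) E"
      by (rule has_sum_cong) (simp add: eg)
    also have "\<dots> \<longleftrightarrow> ((\<lambda>n. F (e n)) has_sum s) (g ` E)"
      by (rule has_sum_reindex[OF g, symmetric])
    also have "\<dots> \<longleftrightarrow> ((\<lambda>n. F (e n)) has_sum s) UNIV"
      by (rule has_sum_cong_neutral) (auto simp: e_def \<open>F 0 = 0\<close>)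
    finally show ?thesis .
  qed
  ultimately show ?thesis by blast
qed

section \<open>Square-summable sequences\<close>

definition sq_summable :: "(nat \<Rightarrow> 'a::real_normed_vector) \<Rightarrow> bool" where
  "sq_summable x \<longleftrightarrow> (\<lambda>n. (norm (x n))\<^sup>2) summable_on UNIV"

lemma sq_summable_bop: "sq_summable a \<Longrightarrow> sq_summable (\<lambda>n. A *\<^sub>V a n)"
proof -
  assume a: "sq_summable a"
  obtain K where K: "K > 0" "\<And>x. norm (A *\<^sub>V x) \<le> K * norm x" using bop_bound[of A] by blast
  have "(\<lambda>n. norm ((norm (A *\<^sub>V a n))\<^sup>2)) summable_on UNIV"
  proof (rule Infinite_Sum.abs_summable_on_comparison_test')
    show "(\<lambda>n. K\<^sup>2 * (norm (a n))\<^sup>2) summable_on UNIV"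
      by (intro summable_on_cmult_right) (use a in \<open>simp add: sq_summable_def\<close>)
    show "norm ((norm (A *\<^sub>V a n))\<^sup>2) \<le> K\<^sup>2 * (norm (a n))\<^sup>2" for n
      using power_mono[OF K(2)[of "a n"], of 2] by (simp add: power_mult_distrib)
  qed
  then show ?thesis by (simp add: sq_summable_def)
qed

lemma sq_summable_scaleC: "sq_summable a \<Longrightarrow> sq_summable (\<lambda>n. c *\<^sub>C (a n :: 'h::chilbert_space))"
  using sq_summable_bop[of a "c *\<^sub>C 1"] by (simp add: bop_simps)

lemma sq_summable_finite: "finite {n. x n \<noteq> 0} \<Longrightarrow> sq_summable x"
  unfolding sq_summable_def
  by (rule finite_nonzero_values_imp_summable_on) (auto elim: rev_finite_subset)

lemma norm_cinner_le_squares: "cmod (cinner x y) \<le> (norm x)\<^sup>2 + (norm y)\<^sup>2"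
  using cinner_Cauchy_Schwarz[of x y] mult_le_sum_squares[of "norm x" "norm y"] by simp

lemma sq_summable_cinner_abs:
  assumes "sq_summable a" "sq_summable b"
  shows "(\<lambda>n. cmod (cinner (a n) (b n))) summable_on UNIV"
  by (rule Infinite_Sum.abs_summable_on_comparison_test'[where g = "\<lambda>n. (norm (a n))\<^sup>2 + (norm (b n))\<^sup>2"])
    (use assms in \<open>auto simp: sq_summable_def intro: summable_on_add norm_cinner_le_squares\<close>)

lemma sq_summable_cinner:
  "sq_summable a \<Longrightarrow> sq_summable b \<Longrightarrow> (\<lambda>n. cinner (a n) (b n)) summable_on UNIV"
  by (rule abs_summable_summable[OF sq_summable_cinner_abs])

lemma parseval_square_double:
  assumes "parseval e" "sq_summable a"
  shows "(\<lambda>(k, n). (cmod (cinner (a k) (e n)))\<^sup>2) summable_on UNIV \<times> UNIV"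
  by (rule summable_on_SigmaI[where g = "\<lambda>k. (norm (a k))\<^sup>2"])
    (use assms parseval_norm in \<open>auto simp: sq_summable_def\<close>)

text \<open>Fubini for the array \<open>\<langle>a\<^sub>k, e\<^sub>n\<rangle>\<langle>e\<^sub>n,
  b\<^sub>k\<rangle>\<close>: Parseval evaluates the sum over \<open>n\<close>, while the sum over
  \<open>k\<close> produces the diagonal entries of a trace.\<close>

lemma parseval_double:
  assumes e: "parseval e" and a: "sq_summable a" and b: "sq_summable b"
  shows "(\<lambda>k. cinner (a k) (e n) * cinner (e n) (b k)) summable_on UNIV"
    and "((\<lambda>n. \<Sum>\<^sub>\<infinity>k. cinner (a k) (e n) * cinner (e n) (b k)) has_sum (\<Sum>\<^sub>\<infinity>k. cinner (a k) (b k))) UNIV"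
proof -
  define F where "F = (\<lambda>(k, n). cinner (a k) (e n) * cinner (e n) (b k))"
  have "(\<lambda>p. norm (F p)) summable_on UNIV \<times> UNIV"
  proof (rule Infinite_Sum.abs_summable_on_comparison_test')
    show "(\<lambda>p. (\<lambda>(k, n). (cmod (cinner (a k) (e n)))\<^sup>2) p + (\<lambda>(k, n). (cmod (cinner (b k) (e n)))\<^sup>2) p) summable_on UNIV \<times> UNIV"
      by (intro summable_on_add parseval_square_double e a b)
    fix p :: "nat \<times> nat"
    obtain k n where p: "p = (k, n)" by (cases p)
    have "cmod (cinner (e n) (b k)) = cmod (cinner (b k) (e n))" by (subst cinner_commute) simp
    then show "norm (F p) \<le> (\<lambda>(k, n). (cmod (cinner (a k) (e n)))\<^sup>2) p + (\<lambda>(k, n). (cmod (cinner (b k) (e n)))\<^sup>2) p"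
      using mult_le_sum_squares[of "cmod (cinner (a k) (e n))" "cmod (cinner (b k) (e n))"]
      by (simp add: F_def p norm_mult)
  qed
  then have F: "F summable_on UNIV \<times> UNIV" by (rule abs_summable_summable)
  have row: "((\<lambda>n. F (k, n)) has_sum cinner (a k) (b k)) UNIV" for k
    using e by (simp add: F_def parseval_def)
  have "((\<lambda>k. cinner (a k) (b k)) has_sum infsum F (UNIV \<times> UNIV)) UNIV"
    by (rule has_sum_SigmaD[OF has_sum_infsum[OF F]]) (rule row)
  then have tot: "(\<Sum>\<^sub>\<infinity>k. cinner (a k) (b k)) = infsum F (UNIV \<times> UNIV)" by (rule infsumI)
  have swap: "((\<lambda>(n, k). F (k, n)) has_sum infsum F (UNIV \<times> UNIV)) (UNIV \<times> UNIV)"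
    using has_sum_infsum[OF F] by (subst (asm) has_sum_swap)
  then have "(\<lambda>(n, k). F (k, n)) summable_on UNIV \<times> UNIV" by (rule has_sum_imp_summable)
  then have col: "(\<lambda>k. F (k, n)) summable_on UNIV" for n
    using summable_on_SigmaD1[of "\<lambda>n k. F (k, n)" UNIV "\<lambda>_. UNIV" n] by simp
  then show "(\<lambda>k. cinner (a k) (e n) * cinner (e n) (b k)) summable_on UNIV" by (simp add: F_def)
  have "((\<lambda>n. \<Sum>\<^sub>\<infinity>k. F (k, n)) has_sum infsum F (UNIV \<times> UNIV)) UNIV"
    by (rule has_sum_SigmaD[OF swap]) (simp add: col)
  then show "((\<lambda>n. \<Sum>\<^sub>\<infinity>k. cinner (a k) (e n) * cinner (e n) (b k)) has_sum (\<Sum>\<^sub>\<infinity>k. cinner (a k) (b k))) UNIV"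
    unfolding tot by (simp add: F_def)
qed

section \<open>Trace class operators as nuclear sums\<close>

text \<open>\<open>T\<close> is the weak sum of the operators
  \<open>a\<^sub>k \<boxtimes> b\<^sub>k\<close>. Two square-summable sequences encode a product of
  two Hilbert-Schmidt operators.\<close>

definition nuclear :: "'h::chilbert_space bop \<Rightarrow> (nat \<Rightarrow> 'h) \<Rightarrow> (nat \<Rightarrow> 'h) \<Rightarrow> bool" where
  "nuclear T a b \<longleftrightarrow> sq_summable a \<and> sq_summable b
     \<and> (\<forall>z w. ((\<lambda>k. cinner (a k) w * cinner z (b k)) has_sum cinner (T *\<^sub>V z) w) UNIV)"

text \<open>The value is free of \<open>e\<close>. This is the basis independence that reconciles
  \<open>op_trace\<close>, which uses one chosen basis, with \<open>trace_class\<close>, which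
  speaks of some basis.\<close>

lemma nuclear_parseval_trace:
  assumes T: "nuclear T a b" and e: "parseval e"
  shows "((\<lambda>n. cinner ((A * T) *\<^sub>V e n) (e n)) has_sum (\<Sum>\<^sub>\<infinity>k. cinner (A *\<^sub>V a k) (b k))) UNIV"
proof -
  have "cinner ((A * T) *\<^sub>V e n) (e n) = (\<Sum>\<^sub>\<infinity>k. cinner (A *\<^sub>V a k) (e n) * cinner (e n) (b k))" for n
    using T unfolding nuclear_def
    by (auto simp: bop_simps cinner_adj intro!: infsumI[symmetric])
  moreover have "((\<lambda>n. \<Sum>\<^sub>\<infinity>k. cinner (A *\<^sub>V a k) (e n) * cinner (e n) (b k)) has_sum (\<Sum>\<^sub>\<infinity>k. cinner (A *\<^sub>V a k) (b k))) UNIV"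
    by (rule parseval_double[OF e]) (use T in \<open>auto simp: nuclear_def sq_summable_bop\<close>)
  ultimately show ?thesis by simp
qed

context
  assumes separable: "separable_space (euclidean :: 'h::chilbert_space topology)"
begin

lemma nuclear_op_trace:
  assumes T: "nuclear (T :: 'h bop) a b"
  shows "op_trace (A * T) = (\<Sum>\<^sub>\<infinity>k. cinner (A *\<^sub>V a k) (b k))"
proof -
  define E where "E = (SOME E. is_onb (E :: 'h set))"
  have "is_onb E" unfolding E_def by (rule someI_ex[OF onb_exists])
  then obtain e where e: "parseval e"
    "\<And>(F :: 'h \<Rightarrow> complex) s. F 0 = 0 \<Longrightarrow> (F has_sum s) E = ((\<lambda>n. F (e n)) has_sum s) UNIV"
    using onb_enumeration[OF separable] by blast
  have "((\<lambda>z. cinner ((A * T) *\<^sub>V z) z) has_sum (\<Sum>\<^sub>\<infinity>k. cinner (A *\<^sub>V a k) (b k))) E"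
    by (subst e(2)) (simp_all add: nuclear_parseval_trace[OF T e(1)])
  then show ?thesis unfolding op_trace_def E_def[symmetric] by (rule infsumI)
qed

text \<open>The trace formula covers all products \<open>S * T\<close>, and \<open>abs_op T\<close>
  is one of them because it has the same norms as \<open>T\<close>.\<close>

lemma trace_class_if_nuclear:
  assumes T: "nuclear (T :: 'h bop) a b"
  shows "T \<in> trace_class"
proof -
  obtain E :: "'h set" where E: "is_onb E" using onb_exists by blast
  then obtain e where e: "parseval e"
    "\<And>(F :: 'h \<Rightarrow> complex) s. F 0 = 0 \<Longrightarrow> (F has_sum s) E = ((\<lambda>n. F (e n)) has_sum s) UNIV"
    using onb_enumeration[OF separable] by blast
  obtain S where S: "abs_op T = S * T"
    by (rule douglas_factorization[of "abs_op T" 1 T]) (simp_all add: norm_abs_op)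
  have "((\<lambda>z. cinner ((S * T) *\<^sub>V z) z) has_sum (\<Sum>\<^sub>\<infinity>k. cinner (S *\<^sub>V a k) (b k))) E"
    by (subst e(2)) (simp_all add: nuclear_parseval_trace[OF T e(1)])
  then have "(\<lambda>z. cinner (abs_op T *\<^sub>V z) z) summable_on E"
    unfolding S by (rule has_sum_imp_summable)
  with E show ?thesis by (auto simp: trace_class_def)
qed

text \<open>Write \<open>T = U|T|\<close> and \<open>|T| = R\<^sup>2\<close>. The sequences are
  \<open>URe\<^sub>n\<close> and \<open>Re\<^sub>n\<close>: summability of
  \<open>\<langle>|T|e\<^sub>n, e\<^sub>n\<rangle>\<close> is square-summability of
  \<open>Re\<^sub>n\<close>, and the Parseval identity between \<open>R\<close> and \<open>R\<close>
  reproduces \<open>T\<close>.\<close>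

lemma nuclear_if_trace_class:
  assumes "(T :: 'h bop) \<in> trace_class"
  shows "\<exists>a b. nuclear T a b"
proof -
  obtain E :: "'h set" where E: "is_onb E" "(\<lambda>z. cinner (abs_op T *\<^sub>V z) z) summable_on E"
    using assms by (auto simp: trace_class_def)
  obtain e where e: "parseval e"
    "\<And>(F :: 'h \<Rightarrow> complex) s. F 0 = 0 \<Longrightarrow> (F has_sum s) E = ((\<lambda>n. F (e n)) has_sum s) UNIV"
    using onb_enumeration[OF separable E(1)] by blast
  obtain U where U: "T = U * abs_op T"
    by (rule douglas_factorization[of T 1 "abs_op T"]) (simp_all add: norm_abs_op)
  obtain R where R: "positive_op R" "R * R = abs_op T"
    using positive_sqrt_exists[OF abs_op(1)] by blast
  have RR: "R *\<^sub>V (R *\<^sub>V z) = abs_op T *\<^sub>V z" for z 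
    unfolding R(2)[symmetric] by (simp add: times_bop.rep_eq)
  have Rself: "cinner (R *\<^sub>V x) y = cinner x (R *\<^sub>V y)" for x y
    by (simp only: cinner_adj positive_op_adj[OF R(1)])
  obtain s where "((\<lambda>z. cinner (abs_op T *\<^sub>V z) z) has_sum s) E" using E(2) by (auto simp: summable_on_def)
  then have "((\<lambda>n. cinner (abs_op T *\<^sub>V e n) (e n)) has_sum s) UNIV" by (subst (asm) e(2)) simp_all
  from has_sum_Re[OF this] have "((\<lambda>n. (norm (R *\<^sub>V e n))\<^sup>2) has_sum Re s) UNIV"
    by (simp add: RR[symmetric] Rself cinner_self)
  then have Re: "sq_summable (\<lambda>n. R *\<^sub>V e n)" unfolding sq_summable_def by (rule has_sum_imp_summable)
  have "nuclear T (\<lambda>n. (U * R) *\<^sub>V e n) (\<lambda>n. R *\<^sub>V e n)"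
    unfolding nuclear_def
  proof (intro conjI allI)
    show "sq_summable (\<lambda>n. R *\<^sub>V e n)" by (rule Re)
    show "sq_summable (\<lambda>n. (U * R) *\<^sub>V e n)" using sq_summable_bop[OF Re, of U] by (simp add: bop_simps)
    fix z w
    have "((\<lambda>n. cinner (R *\<^sub>V z) (e n) * cinner (e n) (adj (U * R) *\<^sub>V w)) has_sum cinner (R *\<^sub>V z) (adj (U * R) *\<^sub>V w)) UNIV"
      using e(1) by (simp add: parseval_def)
    moreover have "cinner (R *\<^sub>V z) (adj (U * R) *\<^sub>V w) = cinner (T *\<^sub>V z) w"
    proof -
      have "(U * R) *\<^sub>V (R *\<^sub>V z) = (U * abs_op T) *\<^sub>V z" by (simp only: times_bop.rep_eq RR)
      then show ?thesis unfolding cinner_adj[symmetric] using U by simp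
    qed
    ultimately show "((\<lambda>n. cinner ((U * R) *\<^sub>V e n) w * cinner z (R *\<^sub>V e n)) has_sum cinner (T *\<^sub>V z) w) UNIV"
      unfolding cinner_adj[symmetric] Rself by (simp only: mult.commute)
  qed
  then show ?thesis by blast
qed

end

text \<open>The series of the vectors \<open>\<langle>z, b\<^sub>k\<rangle>a\<^sub>k\<close>
  converges absolutely in norm, because products of square-summable sequences are summable.\<close>

lemma nuclear_exists:
  fixes a b :: "nat \<Rightarrow> 'h::chilbert_space"
  assumes a: "sq_summable a" and b: "sq_summable b"
  shows "\<exists>T. nuclear T a b"
proof -
  have sab: "(\<lambda>k. norm (b k) * norm (a k)) summable_on UNIV"
  proof -
    have "(\<lambda>k. norm (norm (b k) * norm (a k))) summable_on UNIV"
    proof (rule Infinite_Sum.abs_summable_on_comparison_test')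
      show "(\<lambda>k. (norm (b k))\<^sup>2 + (norm (a k))\<^sup>2) summable_on UNIV"
        using a b by (auto simp: sq_summable_def intro: summable_on_add)
      show "norm (norm (b k) * norm (a k)) \<le> (norm (b k))\<^sup>2 + (norm (a k))\<^sup>2" for k
        using mult_le_sum_squares[of "norm (b k)" "norm (a k)"] by simp
    qed
    then show ?thesis by simp
  qed
  define K where "K = (\<Sum>\<^sub>\<infinity>k. norm (b k) * norm (a k))"
  define t where "t z = (\<Sum>\<^sub>\<infinity>k. cinner z (b k) *\<^sub>C a k)" for z
  have bd: "norm (cinner z (b k) *\<^sub>C a k) \<le> norm z * (norm (b k) * norm (a k))" for z k
    using mult_right_mono[OF cinner_Cauchy_Schwarz[of z "b k"], of "norm (a k)"]
    by (simp add: norm_scaleC mult.assoc)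
  have sz: "(\<lambda>k. norm z * (norm (b k) * norm (a k))) summable_on UNIV" for z
    by (rule summable_on_cmult_right[OF sab])
  have abs: "(\<lambda>k. norm (cinner z (b k) *\<^sub>C a k)) summable_on UNIV" for z
    by (rule Infinite_Sum.abs_summable_on_comparison_test'[OF sz bd])
  have hs: "((\<lambda>k. cinner z (b k) *\<^sub>C a k) has_sum t z) UNIV" for z
    unfolding t_def by (rule has_sum_infsum[OF abs_summable_summable[OF abs]])
  have app: "Abs_bop t *\<^sub>V z = t z" for z
  proof (rule Abs_bop_apply[where K = K])
    show "t (x + y) = t x + t y" for x y
      using has_sum_add[OF hs[of x] hs[of y]]
      by (intro has_sum_unique[OF hs]) (simp add: cinner_add_left scaleC_add_left)
    show "t (c *\<^sub>C x) = c *\<^sub>C t x" for c x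
      using has_sum_bounded_linear[OF scaleC.bounded_linear_right hs[of x], of c]
      by (intro has_sum_unique[OF hs]) (simp add: cinner_scaleC_left scaleC_scaleC)
    show "norm (t x) \<le> K * norm x" for x
    proof -
      have "norm (t x) \<le> norm x * K"
        unfolding K_def infsum_cmult_right[OF sab, symmetric] t_def
        by (rule norm_infsum_le[OF has_sum_infsum[OF abs_summable_summable[OF abs]] has_sum_infsum[OF sz] bd])
      then show ?thesis by (simp add: mult.commute)
    qed
  qed
  have "nuclear (Abs_bop t) a b" unfolding nuclear_def app
  proof (intro conjI allI a b)
    fix z w
    show "((\<lambda>k. cinner (a k) w * cinner z (b k)) has_sum cinner (t z) w) UNIV"
      using has_sum_bounded_linear[OF cinner.bounded_linear_left hs[of z], of w]
      by (simp add: cinner_scaleC_left mult.commute)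
  qed
  then show ?thesis by blast
qed

section \<open>Normal functionals\<close>

text \<open>The concrete form of a \<open>\<sigma>\<close>-weakly continuous functional. The
  topology \<open>sigma_weak\<close> itself is met only in showing that normal maps pull such
  functionals back to such functionals.\<close>

definition normal_functional :: "('h::chilbert_space bop \<Rightarrow> complex) \<Rightarrow> bool" where
  "normal_functional f \<longleftrightarrow> (\<exists>a b. sq_summable a \<and> sq_summable b
     \<and> (\<forall>A. ((\<lambda>k. cinner (A *\<^sub>V a k) (b k)) has_sum f A) UNIV))"

lemma normal_functionalI:
  assumes "sq_summable a" "sq_summable b" "\<And>A. ((\<lambda>k. cinner (A *\<^sub>V a k) (b k)) has_sum f A) UNIV"
  shows "normal_functional f"
  unfolding normal_functional_def using assms by auto

lemma normal_functionalE:
  assumes "normal_functional f"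
  obtains a b where "sq_summable a" "sq_summable b" "\<And>A. ((\<lambda>k. cinner (A *\<^sub>V a k) (b k)) has_sum f A) UNIV"
  using assms unfolding normal_functional_def by auto

lemma normal_functional_add: "normal_functional f \<Longrightarrow> f (A + B) = f A + f B"
proof (erule normal_functionalE)
  fix a b assume h: "\<And>A. ((\<lambda>k. cinner (A *\<^sub>V a k) (b k)) has_sum f A) UNIV"
  show "f (A + B) = f A + f B"
    using has_sum_add[OF h[of A] h[of B]]
    by (intro has_sum_unique[OF h]) (simp add: bop_simps cinner_add_left)
qed

lemma normal_functional_scaleC: "normal_functional f \<Longrightarrow> f (c *\<^sub>C A) = c * f A"
proof (erule normal_functionalE)
  fix a b assume h: "\<And>A. ((\<lambda>k. cinner (A *\<^sub>V a k) (b k)) has_sum f A) UNIV"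
  show "f (c *\<^sub>C A) = c * f A"
    using has_sum_cmult_right[OF h[of A], of c]
    by (intro has_sum_unique[OF h]) (simp add: bop_simps cinner_scaleC_left)
qed

lemma normal_functional_0: "normal_functional f \<Longrightarrow> f 0 = 0"
  using normal_functional_add[of f 0 0] by simp

lemma normal_functional_diff: "normal_functional f \<Longrightarrow> f (A - B) = f A - f B"
  using normal_functional_add[of f "A - B" B] by simp

text \<open>Interleaving along the bijection \<open>sum_decode\<close> keeps the index set
  \<open>nat\<close>; it serves to add two functionals and to place two vectors of
  \<open>\<ell>\<^sup>2(H)\<close> side by side.\<close>

lemma has_sum_sum_decode:
  assumes f: "(f has_sum s) UNIV" and g: "(g has_sum t) UNIV"
  shows "((\<lambda>n. case_sum f g (sum_decode n)) has_sum (s + t :: 'a::topological_comm_monoid_add)) UNIV"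
proof -
  have "(case_sum f g has_sum s) (range Inl)"
    by (subst has_sum_reindex) (use f in \<open>simp_all add: o_def\<close>)
  moreover have "(case_sum f g has_sum t) (range Inr)"
    by (subst has_sum_reindex) (use g in \<open>simp_all add: o_def\<close>)
  moreover have "range Inl \<inter> range Inr = {}" by auto
  ultimately have "(case_sum f g has_sum (s + t)) (range Inl \<union> range Inr)"
    by (rule has_sum_Un_disjoint)
  then have "(case_sum f g has_sum (s + t)) UNIV" by (simp add: UNIV_sum)
  then show ?thesis
    by (subst has_sum_reindex_bij_betw[OF bij_sum_decode])
qed

lemma sq_summable_sum_decode:
  "sq_summable a \<Longrightarrow> sq_summable b \<Longrightarrow> sq_summable (\<lambda>n. case_sum a b (sum_decode n))"
proof -
  assume ab: "sq_summable a" "sq_summable b"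
  then obtain s t where "((\<lambda>n. (norm (a n))\<^sup>2) has_sum s) UNIV" "((\<lambda>n. (norm (b n))\<^sup>2) has_sum t) UNIV"
    by (auto simp: sq_summable_def summable_on_def)
  note h = has_sum_imp_summable[OF has_sum_sum_decode[OF this]]
  have "(norm (case_sum a b (sum_decode n)))\<^sup>2
      = case_sum (\<lambda>n. (norm (a n))\<^sup>2) (\<lambda>n. (norm (b n))\<^sup>2) (sum_decode n)" for n
    by (cases "sum_decode n") simp_all
  then show ?thesis unfolding sq_summable_def using h by simp
qed

lemma normal_functional_plus:
  assumes "normal_functional f" "normal_functional g"
  shows "normal_functional (\<lambda>A. f A + g A)"
proof -
  obtain a b where f: "sq_summable a" "sq_summable b" "\<And>A. ((\<lambda>k. cinner (A *\<^sub>V a k) (b k)) has_sum f A) UNIV"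
    using assms(1) by (rule normal_functionalE) blast
  obtain a' b' where g: "sq_summable a'" "sq_summable b'" "\<And>A. ((\<lambda>k. cinner (A *\<^sub>V a' k) (b' k)) has_sum g A) UNIV"
    using assms(2) by (rule normal_functionalE) blast
  have eq: "cinner (A *\<^sub>V case_sum a a' (sum_decode n)) (case_sum b b' (sum_decode n))
      = case_sum (\<lambda>k. cinner (A *\<^sub>V a k) (b k)) (\<lambda>k. cinner (A *\<^sub>V a' k) (b' k)) (sum_decode n)" for A n
    by (cases "sum_decode n") simp_all
  show ?thesis
    by (rule normal_functionalI[OF sq_summable_sum_decode[OF f(1) g(1)] sq_summable_sum_decode[OF f(2) g(2)]])
      (unfold eq, rule has_sum_sum_decode[OF f(3) g(3)])
qed

lemma normal_functional_compose:
  assumes "normal_functional f"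
  shows "normal_functional (\<lambda>X. f (A * X * B))"
proof -
  obtain a b where f: "sq_summable a" "sq_summable b" "\<And>A. ((\<lambda>k. cinner (A *\<^sub>V a k) (b k)) has_sum f A) UNIV"
    using assms by (rule normal_functionalE) blast
  show ?thesis
  proof (rule normal_functionalI[OF sq_summable_bop[OF f(1)] sq_summable_bop[OF f(2)]])
    fix X
    have "cinner (X *\<^sub>V (B *\<^sub>V a k)) (adj A *\<^sub>V b k) = cinner ((A * X * B) *\<^sub>V a k) (b k)" for k
      by (simp add: bop_simps cinner_adj)
    then show "((\<lambda>k. cinner (X *\<^sub>V (B *\<^sub>V a k)) (adj A *\<^sub>V b k)) has_sum f (A * X * B)) UNIV"
      using f(3)[of "A * X * B"] by (simp only:)
  qed
qed

lemma normal_functional_mult: "normal_functional f \<Longrightarrow> normal_functional (\<lambda>A. c * f A)"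
  using normal_functional_compose[of f "c *\<^sub>C 1" 1]
  by (simp add: bop_mult_scaleC_left normal_functional_scaleC)

lemma normal_functional_minus:
  "normal_functional f \<Longrightarrow> normal_functional g \<Longrightarrow> normal_functional (\<lambda>A. f A - g A)"
  using normal_functional_plus[of f "\<lambda>A. (-1) * g A"] normal_functional_mult[of g "-1"] by simp

lemma normal_functional_zero: "normal_functional (\<lambda>_. 0)"
  by (rule normal_functionalI[of "\<lambda>_. 0" "\<lambda>_. 0"]) (simp_all add: sq_summable_def)

lemma normal_functional_sum:
  "finite I \<Longrightarrow> (\<And>i. i \<in> I \<Longrightarrow> normal_functional (f i)) \<Longrightarrow> normal_functional (\<lambda>A. \<Sum>i\<in>I. f i A)"
  by (induction I rule: finite_induct) (simp_all add: normal_functional_zero normal_functional_plus)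

lemma normal_functional_vector: "normal_functional (\<lambda>A. cinner (A *\<^sub>V u) v)"
proof (rule normal_functionalI)
  let ?a = "\<lambda>w n. if n = (0::nat) then w else 0 :: 'a"
  show "sq_summable (?a u)" "sq_summable (?a v)"
    by (rule sq_summable_finite, rule finite_subset[of _ "{0}"], auto)+
  show "((\<lambda>k. cinner (A *\<^sub>V ?a u k) (?a v k)) has_sum cinner (A *\<^sub>V u) v) UNIV" for A
    by (rule has_sum_finite_neutralI[of "{0}"]) auto
qed

text \<open>\<open>T\<close> is the nuclear operator representing \<open>f\<close>. What matters is
  that the values on rank one operators become continuous in both vectors.\<close>

lemma normal_functional_rank_one:
  assumes "normal_functional f"
  obtains T where "\<And>x y. f (x \<boxtimes> y) = cinner (T *\<^sub>V x) y"
proof -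
  obtain a b where f: "sq_summable a" "sq_summable b" "\<And>A. ((\<lambda>k. cinner (A *\<^sub>V a k) (b k)) has_sum f A) UNIV"
    using assms by (rule normal_functionalE) blast
  obtain T where T: "nuclear T a b" using nuclear_exists[OF f(1,2)] by auto
  have "f (x \<boxtimes> y) = cinner (T *\<^sub>V x) y" for x y
  proof (rule has_sum_unique)
    show "((\<lambda>k. cinner (a k) y * cinner x (b k)) has_sum f (x \<boxtimes> y)) UNIV"
      using f(3)[of "x \<boxtimes> y"] by (simp add: bop_simps cinner_scaleC_left)
    show "((\<lambda>k. cinner (a k) y * cinner x (b k)) has_sum cinner (T *\<^sub>V x) y) UNIV"
      using T by (simp add: nuclear_def)
  qed
  then show thesis by (rule that)
qed

text \<open>\<open>AB\<^sup>*\<close> is the sum of the operators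
  \<open>Ae\<^sub>n \<boxtimes> Be\<^sub>n\<close>. The case \<open>A = B\<close> serves positivity,
  the case \<open>B = 1\<close> shows that rank one operators determine \<open>f\<close>.\<close>

lemma normal_functional_expand:
  assumes "normal_functional f" and e: "parseval e"
  shows "((\<lambda>n. f ((A *\<^sub>V e n) \<boxtimes> (B *\<^sub>V e n))) has_sum f (A * adj B)) UNIV"
proof -
  obtain a b where f: "sq_summable a" "sq_summable b" "\<And>A. ((\<lambda>k. cinner (A *\<^sub>V a k) (b k)) has_sum f A) UNIV"
    using assms(1) by (rule normal_functionalE) blast
  let ?a = "\<lambda>k. adj B *\<^sub>V a k" and ?b = "\<lambda>k. adj A *\<^sub>V b k"
  have row: "cinner (((A *\<^sub>V e n) \<boxtimes> (B *\<^sub>V e n)) *\<^sub>V a k) (b k) = cinner (?a k) (e n) * cinner (e n) (?b k)" for n k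
    by (simp add: bop_simps cinner_scaleC_left cinner_adj_left cinner_adj)
  have tot: "cinner (?a k) (?b k) = cinner ((A * adj B) *\<^sub>V a k) (b k)" for k
    by (simp add: bop_simps cinner_adj)
  have "f ((A *\<^sub>V e n) \<boxtimes> (B *\<^sub>V e n)) = (\<Sum>\<^sub>\<infinity>k. cinner (?a k) (e n) * cinner (e n) (?b k))" for n
    using f(3)[of "(A *\<^sub>V e n) \<boxtimes> (B *\<^sub>V e n)"] unfolding row by (rule infsumI[symmetric])
  moreover have "f (A * adj B) = (\<Sum>\<^sub>\<infinity>k. cinner (?a k) (?b k))"
    using f(3)[of "A * adj B"] unfolding tot by (rule infsumI[symmetric])
  ultimately show ?thesis
    using parseval_double(2)[OF e sq_summable_bop[OF f(1)] sq_summable_bop[OF f(2)], of "adj B" "adj A"] by simp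
qed

text \<open>Linear algebra: such an \<open>f\<close> is a combination of the members of
  \<open>G\<close>. Unless \<open>g\<close> vanishes on the common kernel of the others, some
  \<open>A0\<close> in that kernel has \<open>g A0 \<noteq> 0\<close>, and subtracting the multiple
  of \<open>g\<close> that agrees with \<open>f\<close> at \<open>A0\<close> removes
  \<open>g\<close> from the list.\<close>

lemma normal_functional_if_kernel:
  fixes f :: "'h::chilbert_space bop \<Rightarrow> complex"
  assumes "finite G" "\<And>g. g \<in> G \<Longrightarrow> normal_functional g"
    and "\<And>A B. f (A + B) = f A + f B" "\<And>c A. f (c *\<^sub>C A) = c * f A"
    and "\<And>A. (\<forall>g\<in>G. g A = 0) \<Longrightarrow> f A = 0"
  shows "normal_functional f"
  using assms
proof (induction G arbitrary: f rule: finite_induct)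
  case empty
  then have "f = (\<lambda>_. 0)" by auto
  then show ?case using normal_functional_zero by simp
next
  case (insert g G)
  note add = insert.prems(2) and sc = insert.prems(3)
  have g: "normal_functional g" using insert.prems(1) by simp
  show ?case
  proof (cases "\<exists>A0. (\<forall>h\<in>G. h A0 = 0) \<and> g A0 \<noteq> 0")
    case False
    show ?thesis
    proof (rule insert.IH)
      show "f A = 0" if "\<forall>h\<in>G. h A = 0" for A
        by (rule insert.prems(4)) (use that False in auto)
    qed (use insert.prems(1) add sc in simp_all)
  next
    case True
    then obtain A0 where A0: "\<forall>h\<in>G. h A0 = 0" "g A0 \<noteq> 0" by auto
    define c where "c = f A0 / g A0"
    have "normal_functional (\<lambda>A. f A - c * g A)"
    proof (rule insert.IH)
      show "normal_functional h" if "h \<in> G" for h using insert.prems(1) that by simp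
      show "f (A + B) - c * g (A + B) = (f A - c * g A) + (f B - c * g B)" for A B
        by (simp add: add normal_functional_add[OF g] algebra_simps)
      show "f (d *\<^sub>C A) - c * g (d *\<^sub>C A) = d * (f A - c * g A)" for d A
        by (simp add: sc normal_functional_scaleC[OF g] algebra_simps)
      fix A assume A: "\<forall>h\<in>G. h A = 0"
      \<comment> \<open>Moving \<open>A\<close> along \<open>A0\<close> by
        \<open>d = -(g A / g A0)\<close> reaches the kernel of \<open>g\<close> without leaving that
        of \<open>G\<close>.\<close>
      obtain d where d: "d * g A0 = - g A" "d * f A0 = - (c * g A)"
        using A0(2) by (intro that[of "- (g A / g A0)"]) (simp_all add: c_def)
      have "h (A + d *\<^sub>C A0) = 0" if "h \<in> insert g G" for h
      proof (cases "h = g")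
        case True
        then show ?thesis by (simp add: normal_functional_add[OF g] normal_functional_scaleC[OF g] d(1))
      next
        case False
        then have hG: "h \<in> G" using that by simp
        then have h: "normal_functional h" using insert.prems(1) by simp
        have "h A = 0" "h A0 = 0" using A A0(1) hG by blast+
        then show ?thesis by (simp add: normal_functional_add[OF h] normal_functional_scaleC[OF h])
      qed
      then have "f (A + d *\<^sub>C A0) = 0" by (intro insert.prems(4)) simp
      then show "f A - c * g A = 0" by (simp add: add sc d(2))
    qed
    from normal_functional_plus[OF this normal_functional_mult[OF g, of c]] show ?thesis by simp
  qed
qed

context
  assumes separable: "separable_space (euclidean :: 'h::chilbert_space topology)"
begin

lemma normal_functional_trace:
  assumes "(T :: 'h bop) \<in> trace_class"
  shows "normal_functional (\<lambda>A. op_trace (A * T))"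
proof -
  obtain a b where T: "nuclear T a b" using nuclear_if_trace_class[OF separable assms] by auto
  then have ab: "sq_summable a" "sq_summable b" by (simp_all add: nuclear_def)
  show ?thesis
    by (rule normal_functionalI[OF ab], unfold nuclear_op_trace[OF separable T])
      (intro has_sum_infsum sq_summable_cinner sq_summable_bop ab)
qed

lemma normal_functional_as_trace:
  assumes "normal_functional (f :: 'h bop \<Rightarrow> complex)"
  shows "\<exists>T\<in>trace_class. \<forall>A. f A = op_trace (A * T)"
proof -
  obtain a b where f: "sq_summable a" "sq_summable b" "\<And>A. ((\<lambda>k. cinner (A *\<^sub>V a k) (b k)) has_sum f A) UNIV"
    using assms(1) by (rule normal_functionalE) blast
  obtain T where T: "nuclear T a b" using nuclear_exists[OF f(1,2)] by auto
  have "f A = op_trace (A * T)" for A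
    unfolding nuclear_op_trace[OF separable T] using f(3) by (rule infsumI[symmetric])
  then show ?thesis using trace_class_if_nuclear[OF separable T] by auto
qed

text \<open>The open set contains a neighbourhood of \<open>0\<close> cut out by finitely many
  normal functionals. Their common kernel is a subspace on which \<open>f\<close> stays bounded, so
  \<open>f\<close> vanishes there.\<close>

lemma normal_functional_if_open:
  fixes f :: "'h bop \<Rightarrow> complex"
  assumes add: "\<And>A B. f (A + B) = f A + f B" and sc: "\<And>c A. f (c *\<^sub>C A) = c * f A"
    and op: "openin sigma_weak {A. cmod (f A) < 1}"
  shows "normal_functional f"
proof -
  \<comment> \<open>The topology is given by a subbasis; induction over its generation turns
    subbasic sets into neighbourhoods given by finitely many functionals.\<close>
  define nbhd where "nbhd U A \<longleftrightarrow> (\<exists>G \<delta>. finite G \<and> (\<forall>g\<in>G. normal_functional g) \<and> \<delta> > 0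
    \<and> (\<forall>A'. (\<forall>g\<in>G. cmod (g (A' - A)) < \<delta>) \<longrightarrow> A' \<in> U))" for U and A :: "'h bop"
  have "\<forall>A\<in>U. nbhd U A"
    if "generate_topology_on {{A. op_trace (A * B) \<in> V} | (B :: 'h bop) V. B \<in> trace_class \<and> open V} U" for U
    using that
  proof (induction rule: generate_topology_on.induct)
    case Empty
    show ?case by simp
  next
    case (Int U V)
    show ?case
    proof
      fix A assume "A \<in> U \<inter> V"
      then have "nbhd U A" "nbhd V A" using Int.IH by simp_all
      then obtain G \<delta> G' \<delta>' where G: "finite G" "\<forall>g\<in>G. normal_functional g" "\<delta> > 0"
          "\<And>A'. (\<forall>g\<in>G. cmod (g (A' - A)) < \<delta>) \<Longrightarrow> A' \<in> U"
        and G': "finite G'" "\<forall>g\<in>G'. normal_functional g" "\<delta>' > 0"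
          "\<And>A'. (\<forall>g\<in>G'. cmod (g (A' - A)) < \<delta>') \<Longrightarrow> A' \<in> V"
        unfolding nbhd_def by auto
      show "nbhd (U \<inter> V) A" unfolding nbhd_def
        by (rule exI[of _ "G \<union> G'"], rule exI[of _ "min \<delta> \<delta>'"]) (use G G' in auto)
    qed
  next
    case (UN K)
    show ?case
    proof
      fix A assume "A \<in> \<Union>K"
      then obtain k where k: "k \<in> K" "A \<in> k" by auto
      then have "nbhd k A" using UN.IH by simp
      then show "nbhd (\<Union>K) A" unfolding nbhd_def using k(1) by (elim exE conjE) (intro exI conjI, auto)
    qed
  next
    case (Basis U)
    then obtain B :: "'h bop" and V where BV: "U = {A. op_trace (A * B) \<in> V}" "B \<in> trace_class" "open V" by auto
    define g where "g = (\<lambda>A. op_trace (A * B))"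
    have g: "normal_functional g" unfolding g_def by (rule normal_functional_trace[OF BV(2)])
    show ?case
    proof
      fix A assume "A \<in> U"
      then have "g A \<in> V" by (simp add: BV(1) g_def)
      then obtain \<delta> where \<delta>: "\<delta> > 0" "\<And>z. dist z (g A) < \<delta> \<Longrightarrow> z \<in> V"
        using BV(3) unfolding open_dist by auto
      show "nbhd U A" unfolding nbhd_def
      proof (rule exI[of _ "{g}"], rule exI[of _ \<delta>], intro conjI allI impI)
        fix A' assume "\<forall>g\<in>{g}. cmod (g (A' - A)) < \<delta>"
        then have "dist (g A') (g A) < \<delta>" by (simp add: normal_functional_diff[OF g] dist_norm)
        from \<delta>(2)[OF this] show "A' \<in> U" by (simp add: BV(1) g_def)
      qed (use \<delta>(1) g in simp_all)
    qed
  qed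
  moreover have f0: "f 0 = 0" using add[of 0 0] by simp
  ultimately have "nbhd {A. cmod (f A) < 1} 0"
    using op unfolding sigma_weak_def openin_topology_generated_by_iff by auto
  then obtain G \<delta> where G: "finite G" "\<forall>g\<in>G. normal_functional g" "\<delta> > 0"
    "\<And>A'. (\<forall>g\<in>G. cmod (g (A' - 0)) < \<delta>) \<Longrightarrow> A' \<in> {A. cmod (f A) < 1}"
    unfolding nbhd_def by auto
  show ?thesis
  proof (rule normal_functional_if_kernel[OF G(1) _ add sc])
    show "normal_functional g" if "g \<in> G" for g using G(2) that by simp
    fix A assume A: "\<forall>g\<in>G. g A = 0"
    show "f A = 0"
    proof (rule ccontr)
      assume "f A \<noteq> 0"
      \<comment> \<open>Rescaling keeps \<open>A\<close> in the kernel but makes the value of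
        \<open>f\<close> equal to \<open>1\<close>, outside the open disc.\<close>
      have "(1 / f A) *\<^sub>C A \<in> {A. cmod (f A) < 1}"
      proof (rule G(4), intro ballI)
        fix g assume gG: "g \<in> G"
        then have "normal_functional g" using G(2) by simp
        moreover have "g A = 0" using gG A by blast
        ultimately have "g ((1 / f A) *\<^sub>C A) = 0" by (simp add: normal_functional_scaleC)
        then show "cmod (g ((1 / f A) *\<^sub>C A - 0)) < \<delta>" using G(3) by simp
      qed
      then show False using \<open>f A \<noteq> 0\<close> by (simp add: sc)
    qed
  qed
qed

text \<open>By linearity, openness of the preimage of one set is enough, the set on which
  \<open>f\<close> takes values in the unit disc.\<close>

lemma normal_map_normal_functional:
  fixes \<Phi> :: "'h bop \<Rightarrow> 'h bop"
  assumes \<Phi>: "normal_map \<Phi>" "linear_map_on UNIV \<Phi>" and f: "normal_functional f"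
  shows "normal_functional (\<lambda>A. f (\<Phi> A))"
proof (rule normal_functional_if_open)
  show "f (\<Phi> (A + B)) = f (\<Phi> A) + f (\<Phi> B)" for A B
    using \<Phi>(2) by (simp add: linear_map_on_def normal_functional_add[OF f])
  show "f (\<Phi> (c *\<^sub>C A)) = c * f (\<Phi> A)" for c A
    using \<Phi>(2) by (simp add: linear_map_on_def normal_functional_scaleC[OF f])
  obtain T where T: "T \<in> trace_class" "\<And>A. f A = op_trace (A * T)"
    using normal_functional_as_trace[OF f] by auto
  have "openin sigma_weak {A. op_trace (A * T) \<in> ball 0 1}"
    unfolding sigma_weak_def
    by (rule topology_generated_by_Basis) (use T(1) open_ball in blast)
  from openin_continuous_map_preimage[OF \<Phi>(1)[unfolded normal_map_def] this]
  have "openin sigma_weak {A \<in> topspace sigma_weak. f (\<Phi> A) \<in> ball 0 1}" by (simp add: T(2))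
  \<comment> \<open>The subbasis contains the whole space, by the choice \<open>V = UNIV\<close>, so
    the preimage needs no restriction.\<close>
  moreover have "topspace sigma_weak = (UNIV :: 'h bop set)"
  proof -
    have "UNIV \<in> {{A. op_trace (A * B) \<in> V} | (B :: 'h bop) V. B \<in> trace_class \<and> open V}"
      using T(1) by (intro CollectI exI[of _ T] exI[of _ UNIV]) auto
    then show ?thesis unfolding sigma_weak_def topology_generated_by_topspace by blast
  qed
  ultimately show "openin sigma_weak {A. cmod (f (\<Phi> A)) < 1}" by simp
qed

lemma parseval_exists: "\<exists>e :: nat \<Rightarrow> 'h. parseval e"
  using onb_exists onb_enumeration[OF separable] by blast

text \<open>The values on \<open>x \<boxtimes> y\<close> extend from \<open>D\<close> to all vectors
  by continuity, and the expansion along a Parseval sequence then reaches every operator.\<close>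

lemma normal_functional_eqI:
  fixes f g :: "'h bop \<Rightarrow> complex"
  assumes f: "normal_functional f" and g: "normal_functional g" and D: "closure D = UNIV"
    and eq: "\<And>x y. x \<in> D \<Longrightarrow> y \<in> D \<Longrightarrow> f (x \<boxtimes> y) = g (x \<boxtimes> y)"
  shows "f A = g A"
proof -
  obtain S where S: "\<And>x y. f (x \<boxtimes> y) = cinner (S *\<^sub>V x) y" using normal_functional_rank_one[OF f] by auto
  obtain T where T: "\<And>x y. g (x \<boxtimes> y) = cinner (T *\<^sub>V x) y" using normal_functional_rank_one[OF g] by auto
  have ST: "cinner (S *\<^sub>V x) y = cinner (T *\<^sub>V x) y" for x y
  proof -
    have "x \<in> closure D" "y \<in> closure D" using D by simp_all
    then obtain a b where a: "\<And>n. a n \<in> D" "a \<longlonglongrightarrow> x" and b: "\<And>n. b n \<in> D" "b \<longlonglongrightarrow> y"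
      unfolding closure_sequential by auto
    have "(\<lambda>n. cinner (S *\<^sub>V a n) (b n)) \<longlonglongrightarrow> cinner (S *\<^sub>V x) y"
      by (intro cinner.tendsto bop_apply_tendsto a b)
    moreover have "cinner (S *\<^sub>V a n) (b n) = cinner (T *\<^sub>V a n) (b n)" for n
      using eq[OF a(1) b(1)] by (simp add: S T)
    moreover have "(\<lambda>n. cinner (T *\<^sub>V a n) (b n)) \<longlonglongrightarrow> cinner (T *\<^sub>V x) y"
      by (intro cinner.tendsto bop_apply_tendsto a b)
    ultimately show ?thesis by (auto intro: LIMSEQ_unique)
  qed
  obtain e :: "nat \<Rightarrow> 'h" where e: "parseval e" using parseval_exists by auto
  have "f (A * adj 1) = g (A * adj 1)"
    using normal_functional_expand[OF f e, of A 1] normal_functional_expand[OF g e, of A 1]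
    unfolding S T ST by (rule has_sum_unique)
  then show ?thesis by simp
qed

text \<open>\<open>ZZ\<^sup>*\<close> expands into the operators
  \<open>Ze\<^sub>n \<boxtimes> Ze\<^sub>n\<close>, so rank one operators suffice as tests, and
  among them a dense set of vectors, the nonnegative reals being closed.\<close>

lemma normal_functional_positive:
  fixes f :: "'h bop \<Rightarrow> complex"
  assumes f: "normal_functional f" and D: "closure D = UNIV"
    and pos: "\<And>x. x \<in> D \<Longrightarrow> f (x \<boxtimes> x) \<in> \<real>\<^sub>\<ge>\<^sub>0"
  shows "f (Z * adj Z) \<in> \<real>\<^sub>\<ge>\<^sub>0"
proof -
  obtain T where T: "\<And>x y. f (x \<boxtimes> y) = cinner (T *\<^sub>V x) y" using normal_functional_rank_one[OF f] by auto
  have pos': "f (x \<boxtimes> x) \<in> \<real>\<^sub>\<ge>\<^sub>0" for x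
  proof -
    have "x \<in> closure D" using D by simp
    then obtain a where a: "\<And>n. a n \<in> D" "a \<longlonglongrightarrow> x" unfolding closure_sequential by auto
    have lim: "(\<lambda>n. cinner (T *\<^sub>V a n) (a n)) \<longlonglongrightarrow> cinner (T *\<^sub>V x) x"
      by (intro cinner.tendsto bop_apply_tendsto a)
    have mem: "cinner (T *\<^sub>V a n) (a n) \<in> \<real>\<^sub>\<ge>\<^sub>0" for n using pos[OF a(1)] by (simp add: T)
    show ?thesis unfolding T
      by (rule closed_sequentially[OF closed_nonneg_Reals_complex mem lim])
  qed
  obtain e :: "nat \<Rightarrow> 'h" where e: "parseval e" using parseval_exists by auto
  note s = normal_functional_expand[OF f e, of Z Z]
  have "0 \<le> Re (f (Z * adj Z))"
    by (rule has_sum_nonneg[OF has_sum_Re[OF s]]) (use pos' in \<open>simp add: complex_nonneg_Reals_iff\<close>)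
  moreover have "Im (f (Z * adj Z)) = 0"
  proof (rule has_sum_unique[OF has_sum_Im[OF s]])
    have "Im (f (x \<boxtimes> x)) = 0" for x using pos'[of x] by (simp add: complex_nonneg_Reals_iff)
    then show "((\<lambda>n. Im (f ((Z *\<^sub>V e n) \<boxtimes> (Z *\<^sub>V e n)))) has_sum 0) UNIV" by simp
  qed
  ultimately show ?thesis by (simp add: complex_nonneg_Reals_iff)
qed

end

section \<open>The Hilbert space of square-summable sequences\<close>

lemma sq_summable_add:
  fixes a b :: "nat \<Rightarrow> 'h::chilbert_space"
  assumes "sq_summable a" "sq_summable b"
  shows "sq_summable (\<lambda>n. a n + b n)"
proof -
  have "(\<lambda>n. norm ((norm (a n + b n))\<^sup>2)) summable_on UNIV"
  proof (rule Infinite_Sum.abs_summable_on_comparison_test')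
    show "(\<lambda>n. 2 * (norm (a n))\<^sup>2 + 2 * (norm (b n))\<^sup>2) summable_on UNIV"
      using assms by (auto simp: sq_summable_def intro!: summable_on_add summable_on_cmult_right)
    show "norm ((norm (a n + b n))\<^sup>2) \<le> 2 * (norm (a n))\<^sup>2 + 2 * (norm (b n))\<^sup>2" for n
    proof -
      have "(norm (a n + b n))\<^sup>2 \<le> 2 * (norm (a n))\<^sup>2 + 2 * (norm (b n))\<^sup>2"
        using norm_add_square[of "a n" "b n"] norm_diff_square[of "a n" "b n"] zero_le_power2[of "norm (a n - b n)"]
        by linarith
      then show ?thesis by (simp only: real_norm_def abs_of_nonneg[OF zero_le_power2])
    qed
  qed
  then show ?thesis by (simp add: sq_summable_def)
qed

lemma sq_summable_uminus: "sq_summable a \<Longrightarrow> sq_summable (\<lambda>n. - a n)"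
  by (simp add: sq_summable_def)

lemma sq_summable_diff:
  fixes a b :: "nat \<Rightarrow> 'h::chilbert_space"
  shows "sq_summable a \<Longrightarrow> sq_summable b \<Longrightarrow> sq_summable (\<lambda>n. a n - b n)"
  using sq_summable_add[of a "\<lambda>n. - b n"] by (simp add: sq_summable_uminus)

text \<open>\<open>\<ell>\<^sup>2(H)\<close> as a type of the class \<open>chilbert_space\<close>,
  so that adjoints and projections are available on it unchanged.\<close>

typedef (overloaded) 'h l2 = "{x :: nat \<Rightarrow> 'h::chilbert_space. sq_summable x}"
  morphisms l2_nth Abs_l2
  by (rule exI[of _ "\<lambda>_. 0"]) (simp add: sq_summable_def)

setup_lifting type_definition_l2

lemma l2_eqI: "(\<And>n. l2_nth x n = l2_nth y n) \<Longrightarrow> x = y"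
  by (simp add: l2_nth_inject[symmetric] fun_eq_iff)

lemma sq_summable_l2_nth: "sq_summable (l2_nth x)"
  using l2_nth[of x] by simp

lemma l2_nth_Abs: "sq_summable a \<Longrightarrow> l2_nth (Abs_l2 a) = a"
  by (simp add: Abs_l2_inverse)

instantiation l2 :: (chilbert_space) real_vector
begin

lift_definition zero_l2 :: "'a l2" is "\<lambda>_. 0" by (simp add: sq_summable_def)
lift_definition plus_l2 :: "'a l2 \<Rightarrow> 'a l2 \<Rightarrow> 'a l2" is "\<lambda>x y n. x n + y n" by (rule sq_summable_add)
lift_definition minus_l2 :: "'a l2 \<Rightarrow> 'a l2 \<Rightarrow> 'a l2" is "\<lambda>x y n. x n - y n" by (rule sq_summable_diff)
lift_definition uminus_l2 :: "'a l2 \<Rightarrow> 'a l2" is "\<lambda>x n. - x n" by (rule sq_summable_uminus)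
lift_definition scaleR_l2 :: "real \<Rightarrow> 'a l2 \<Rightarrow> 'a l2" is "\<lambda>r x n. r *\<^sub>R x n"
  by (simp add: scaleR_scaleC sq_summable_scaleC)

instance
  by standard (rule l2_eqI, simp add: zero_l2.rep_eq plus_l2.rep_eq minus_l2.rep_eq uminus_l2.rep_eq
      scaleR_l2.rep_eq algebra_simps)+

end

instantiation l2 :: (chilbert_space) complex_vector
begin

lift_definition scaleC_l2 :: "complex \<Rightarrow> 'a l2 \<Rightarrow> 'a l2" is "\<lambda>c x n. c *\<^sub>C x n"
  by (rule sq_summable_scaleC)

instance
  by standard (rule l2_eqI, simp add: plus_l2.rep_eq scaleC_l2.rep_eq scaleC_add_right scaleC_add_left scaleC_scaleC)+

end

lemmas l2_simps = zero_l2.rep_eq plus_l2.rep_eq minus_l2.rep_eq uminus_l2.rep_eq scaleR_l2.rep_eq scaleC_l2.rep_eq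

instantiation l2 :: (chilbert_space) real_normed_vector
begin

definition norm_l2 :: "'a l2 \<Rightarrow> real" where
  "norm_l2 x = sqrt (\<Sum>\<^sub>\<infinity>n. (norm (l2_nth x n))\<^sup>2)"
definition sgn_l2 :: "'a l2 \<Rightarrow> 'a l2" where "sgn_l2 x = x /\<^sub>R norm x"
definition dist_l2 :: "'a l2 \<Rightarrow> 'a l2 \<Rightarrow> real" where "dist_l2 x y = norm (x - y)"
definition uniformity_l2 :: "('a l2 \<times> 'a l2) filter" where
  "uniformity_l2 = (INF e\<in>{0<..}. principal {(x, y). dist x y < e})"
definition open_l2 :: "'a l2 set \<Rightarrow> bool" where
  "open_l2 U \<longleftrightarrow> (\<forall>x\<in>U. eventually (\<lambda>(x', y). x' = x \<longrightarrow> y \<in> U) uniformity)"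

lemma l2_norm_has_sum: "((\<lambda>n. (norm (l2_nth x n))\<^sup>2) has_sum (norm x)\<^sup>2) UNIV"
proof -
  have "(norm x)\<^sup>2 = (\<Sum>\<^sub>\<infinity>n. (norm (l2_nth x n))\<^sup>2)"
    unfolding norm_l2_def by (rule real_sqrt_pow2) (simp add: infsum_nonneg)
  then show ?thesis using sq_summable_l2_nth[of x] by (simp add: sq_summable_def)
qed

lemma l2_norm_nonneg: "0 \<le> norm (x :: 'a l2)"
  unfolding norm_l2_def by (simp add: infsum_nonneg)

lemma L2_set_le_l2_norm: "L2_set (\<lambda>n. norm (l2_nth x n)) {..<N} \<le> norm x"
proof -
  have "(\<Sum>n<N. (norm (l2_nth x n))\<^sup>2) \<le> (norm x)\<^sup>2"
    by (rule finite_sum_le_has_sum[OF l2_norm_has_sum]) auto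
  then show ?thesis unfolding L2_set_def by (rule real_le_lsqrt[OF l2_norm_nonneg])
qed

text \<open>Reduces norm estimates to finite sections, where Minkowski's inequality is
  \<open>L2_set_triangle_ineq\<close>.\<close>

lemma l2_norm_leI:
  assumes "\<And>N. L2_set (\<lambda>n. norm (l2_nth x n)) {..<N} \<le> c"
  shows "norm x \<le> c"
proof -
  have c: "c \<ge> 0" using assms[of 0] by simp
  have "(\<lambda>N. \<Sum>n<N. (norm (l2_nth x n))\<^sup>2) \<longlonglongrightarrow> (norm x)\<^sup>2"
    using has_sum_imp_sums[OF l2_norm_has_sum[of x]] by (simp add: sums_def)
  moreover have "(\<Sum>n<N. (norm (l2_nth x n))\<^sup>2) \<le> c\<^sup>2" for N
    using assms[of N] unfolding L2_set_def by (rule sqrt_le_D)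
  ultimately have "(norm x)\<^sup>2 \<le> c\<^sup>2" by (intro LIMSEQ_le_const2) auto
  then show ?thesis using c by (rule power2_le_imp_le)
qed

instance
proof
  fix x y :: "'a l2" and r :: real
  show "dist x y = norm (x - y)" by (rule dist_l2_def)
  show "sgn x = x /\<^sub>R norm x" by (rule sgn_l2_def)
  show "uniformity = (INF e\<in>{0<..}. principal {(x :: 'a l2, y). dist x y < e})" by (rule uniformity_l2_def)
  show "open U \<longleftrightarrow> (\<forall>x\<in>U. eventually (\<lambda>(x', y). x' = x \<longrightarrow> y \<in> U) uniformity)" for U :: "'a l2 set"
    by (rule open_l2_def)
  show "norm x = 0 \<longleftrightarrow> x = 0"
  proof
    assume n: "norm x = 0"
    have "(norm (l2_nth x n))\<^sup>2 = 0" for n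
      using finite_sum_le_has_sum[OF l2_norm_has_sum[of x], of "{n}"] n by simp
    then show "x = 0" by (intro l2_eqI) (simp add: l2_simps)
  qed (simp add: norm_l2_def l2_simps)
  show "norm (x + y) \<le> norm x + norm y"
  proof (rule l2_norm_leI)
    fix N
    have "L2_set (\<lambda>n. norm (l2_nth (x + y) n)) {..<N} \<le> L2_set (\<lambda>n. norm (l2_nth x n) + norm (l2_nth y n)) {..<N}"
      by (rule L2_set_mono) (simp_all add: l2_simps norm_triangle_ineq)
    also have "\<dots> \<le> L2_set (\<lambda>n. norm (l2_nth x n)) {..<N} + L2_set (\<lambda>n. norm (l2_nth y n)) {..<N}"
      by (rule L2_set_triangle_ineq)
    also have "\<dots> \<le> norm x + norm y" by (intro add_mono L2_set_le_l2_norm)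
    finally show "L2_set (\<lambda>n. norm (l2_nth (x + y) n)) {..<N} \<le> norm x + norm y" .
  qed
  show "norm (r *\<^sub>R x) = \<bar>r\<bar> * norm x"
    by (simp add: norm_l2_def l2_simps power_mult_distrib infsum_cmult_right' real_sqrt_mult)
qed

end

lemma norm_l2_nth_le: "norm (l2_nth x n) \<le> norm x"
proof -
  have "(norm (l2_nth x n))\<^sup>2 \<le> (norm x)\<^sup>2"
    using finite_sum_le_has_sum[OF l2_norm_has_sum[of x], of "{n}"] by simp
  then show ?thesis by (rule power2_le_imp_le) simp
qed

instance l2 :: (chilbert_space) banach
proof
  fix X :: "nat \<Rightarrow> 'a l2"
  assume X: "Cauchy X"
  have "Cauchy (\<lambda>m. l2_nth (X m) n)" for n
  proof (rule metric_CauchyI)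
    fix e :: real assume "0 < e"
    then obtain M where M: "\<And>m k. m \<ge> M \<Longrightarrow> k \<ge> M \<Longrightarrow> dist (X m) (X k) < e"
      using metric_CauchyD[OF X] by blast
    show "\<exists>M. \<forall>m\<ge>M. \<forall>k\<ge>M. dist (l2_nth (X m) n) (l2_nth (X k) n) < e"
    proof (intro exI allI impI)
      fix m k assume "M \<le> m" "M \<le> k"
      have "dist (l2_nth (X m) n) (l2_nth (X k) n) \<le> dist (X m) (X k)"
        using norm_l2_nth_le[of "X m - X k" n] by (simp add: dist_norm l2_simps)
      also have "\<dots> < e" by (rule M) fact+
      finally show "dist (l2_nth (X m) n) (l2_nth (X k) n) < e" .
    qed
  qed
  then have "\<forall>n. \<exists>l. (\<lambda>m. l2_nth (X m) n) \<longlonglongrightarrow> l"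
    by (simp add: Cauchy_convergent_iff convergent_def)
  from choice[OF this] obtain y where y: "\<And>n. (\<lambda>m. l2_nth (X m) n) \<longlonglongrightarrow> y n" by auto
  \<comment> \<open>The Cauchy estimate on a finite section survives the limit in the second index,
    with a bound that does not depend on the length of the section.\<close>
  have tail: "\<exists>M. \<forall>m\<ge>M. \<forall>K. L2_set (\<lambda>n. norm (l2_nth (X m) n - y n)) {..<K} \<le> e" if "e > 0" for e
  proof -
    obtain M where M: "\<And>m k. m \<ge> M \<Longrightarrow> k \<ge> M \<Longrightarrow> dist (X m) (X k) < e"
      using metric_CauchyD[OF X \<open>e > 0\<close>] by blast
    show ?thesis
    proof (intro exI allI impI)
      fix m K assume m: "M \<le> m"
      show "L2_set (\<lambda>n. norm (l2_nth (X m) n - y n)) {..<K} \<le> e"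
      proof (rule LIMSEQ_le_const2)
        show "(\<lambda>k. L2_set (\<lambda>n. norm (l2_nth (X m) n - l2_nth (X k) n)) {..<K})
            \<longlonglongrightarrow> L2_set (\<lambda>n. norm (l2_nth (X m) n - y n)) {..<K}"
          unfolding L2_set_def by (intro tendsto_intros y)
        show "\<exists>N. \<forall>k\<ge>N. L2_set (\<lambda>n. norm (l2_nth (X m) n - l2_nth (X k) n)) {..<K} \<le> e"
        proof (intro exI allI impI)
          fix k assume "M \<le> k"
          then have "norm (X m - X k) < e" using M[OF m] by (simp add: dist_norm)
          then show "L2_set (\<lambda>n. norm (l2_nth (X m) n - l2_nth (X k) n)) {..<K} \<le> e"
            using L2_set_le_l2_norm[of "X m - X k" K] by (simp add: l2_simps)
        qed
      qed
    qed
  qed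
  obtain M where M: "\<And>K. L2_set (\<lambda>n. norm (l2_nth (X M) n - y n)) {..<K} \<le> 1"
    using tail[of 1] by auto
  have "summable (\<lambda>n. (norm (l2_nth (X M) n - y n))\<^sup>2)"
  proof (rule bounded_imp_summable)
    show "(\<Sum>k\<le>n. (norm (l2_nth (X M) k - y k))\<^sup>2) \<le> 1\<^sup>2" for n
      using sqrt_le_D[OF M[of "Suc n", unfolded L2_set_def]] by (simp add: lessThan_Suc_atMost)
  qed simp
  then have "sq_summable (\<lambda>n. l2_nth (X M) n - y n)"
    unfolding sq_summable_def by (rule summable_nonneg_imp_summable_on) simp
  from sq_summable_diff[OF sq_summable_l2_nth[of "X M"] this] have sy: "sq_summable y" by simp
  have "X \<longlonglongrightarrow> Abs_l2 y"
  proof (rule LIMSEQ_I)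
    fix e :: real assume "0 < e"
    then obtain M where M: "\<And>m K. m \<ge> M \<Longrightarrow> L2_set (\<lambda>n. norm (l2_nth (X m) n - y n)) {..<K} \<le> e / 2"
      using tail[of "e / 2"] by auto
    have "norm (X m - Abs_l2 y) < e" if "m \<ge> M" for m
    proof -
      have "norm (X m - Abs_l2 y) \<le> e / 2"
      proof (rule l2_norm_leI)
        fix K
        have "l2_nth (X m - Abs_l2 y) n = l2_nth (X m) n - y n" for n by (simp add: l2_simps l2_nth_Abs[OF sy])
        then show "L2_set (\<lambda>n. norm (l2_nth (X m - Abs_l2 y) n)) {..<K} \<le> e / 2"
          using M[OF that, of K] by (simp only:)
      qed
      then show ?thesis using \<open>0 < e\<close> by simp
    qed
    then show "\<exists>no. \<forall>n\<ge>no. norm (X n - Abs_l2 y) < e" by blast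
  qed
  then show "convergent X" by (auto simp: convergent_def)
qed

instantiation l2 :: (chilbert_space) chilbert_space
begin

definition cinner_l2 :: "'a l2 \<Rightarrow> 'a l2 \<Rightarrow> complex" where
  "cinner_l2 x y = (\<Sum>\<^sub>\<infinity>n. cinner (l2_nth x n) (l2_nth y n))"

lemma l2_cinner_has_sum: "((\<lambda>n. cinner (l2_nth x n) (l2_nth y n)) has_sum cinner x y) UNIV"
  unfolding cinner_l2_def by (intro has_sum_infsum sq_summable_cinner sq_summable_l2_nth)

instance
proof
  fix x y z :: "'a l2" and r :: real and a :: complex
  show "r *\<^sub>R x = complex_of_real r *\<^sub>C x"
    by (rule l2_eqI) (simp add: l2_simps scaleR_scaleC)
  show "cinner (x + y) z = cinner x z + cinner y z"
    using has_sum_add[OF l2_cinner_has_sum[of x z] l2_cinner_has_sum[of y z]]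
    by (intro has_sum_unique[OF l2_cinner_has_sum]) (simp add: l2_simps cinner_add_left)
  show "cinner (a *\<^sub>C x) y = a * cinner x y"
    using has_sum_cmult_right[OF l2_cinner_has_sum[of x y], of a]
    by (intro has_sum_unique[OF l2_cinner_has_sum]) (simp add: l2_simps cinner_scaleC_left)
  show "cinner x y = cnj (cinner y x)"
    unfolding cinner_l2_def infsum_cnj[symmetric] by (intro infsum_cong) (rule cinner_commute)
  show "cinner x x = complex_of_real ((norm x)\<^sup>2)"
    unfolding cinner_l2_def cinner_self
    by (rule infsumI) (rule has_sum_of_real[OF l2_norm_has_sum])
qed

end

definition l2_single :: "nat \<Rightarrow> 'h::chilbert_space \<Rightarrow> 'h l2" where
  "l2_single j h = Abs_l2 (\<lambda>n. if n = j then h else 0)"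

lemma l2_nth_single: "l2_nth (l2_single j h) n = (if n = j then h else 0)"
proof -
  have "sq_summable (\<lambda>n. if n = j then h else 0)"
    by (rule sq_summable_finite, rule finite_subset[of _ "{j}"]) auto
  then show ?thesis by (simp add: l2_single_def l2_nth_Abs)
qed

lemma cinner_l2_single: "cinner x (l2_single j h) = cinner (l2_nth x j) h"
  by (rule has_sum_unique[OF l2_cinner_has_sum])
    (rule has_sum_finite_neutralI[of "{j}"], auto simp: l2_nth_single)

lemma norm_l2_single: "norm (l2_single j h) = norm h"
proof -
  have "complex_of_real ((norm (l2_single j h))\<^sup>2) = complex_of_real ((norm h)\<^sup>2)"
    unfolding cinner_self[symmetric] cinner_l2_single by (simp add: l2_nth_single)
  then have "(norm (l2_single j h))\<^sup>2 = (norm h)\<^sup>2" by (simp only: of_real_eq_iff)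
  then show ?thesis by (simp add: power2_eq_iff_nonneg)
qed

text \<open>For the adjoints, pairing with \<open>l2_single n h\<close> reads off the coordinates of
  an arbitrary image vector, so no density of finitely supported vectors is involved.\<close>

lemma l2_bop_eqI:
  fixes S T :: "'h::chilbert_space l2 bop"
  assumes "\<And>j h. S *\<^sub>V l2_single j h = T *\<^sub>V l2_single j h"
  shows "S = T"
proof -
  have "adj S *\<^sub>V y = adj T *\<^sub>V y" for y
  proof (rule l2_eqI, rule cinner_extI)
    fix n h
    have "cinner (adj S *\<^sub>V y) (l2_single n h) = cinner (adj T *\<^sub>V y) (l2_single n h)"
      unfolding cinner_adj_left assms ..
    then show "cinner (l2_nth (adj S *\<^sub>V y) n) h = cinner (l2_nth (adj T *\<^sub>V y) n) h"
      by (simp add: cinner_l2_single)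
  qed
  then have "adj S = adj T" by (rule bop_eqI)
  then have "adj (adj S) = adj (adj T)" by simp
  then show ?thesis by simp
qed

text \<open>The amplification \<open>1 \<otimes> A\<close>. It turns every normal functional into a
  vector functional.\<close>

definition ampl :: "'h::chilbert_space bop \<Rightarrow> 'h l2 bop" where
  "ampl A = Abs_bop (\<lambda>x. Abs_l2 (\<lambda>n. A *\<^sub>V l2_nth x n))"

lemma l2_nth_ampl: "l2_nth (ampl A *\<^sub>V x) n = A *\<^sub>V l2_nth x n"
proof -
  obtain K where K: "K > 0" "\<And>x. norm (A *\<^sub>V x) \<le> K * norm x" using bop_bound[of A] by blast
  define t where "t = (\<lambda>x. Abs_l2 (\<lambda>n. A *\<^sub>V l2_nth x n))"
  have nth: "l2_nth (t x) n = A *\<^sub>V l2_nth x n" for x n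
    unfolding t_def by (subst l2_nth_Abs) (intro sq_summable_bop sq_summable_l2_nth, rule refl)
  have "Abs_bop t *\<^sub>V x = t x"
  proof (rule Abs_bop_apply[where K = K])
    show "t (x + y) = t x + t y" for x y
      by (rule l2_eqI) (simp add: nth l2_simps bop_apply_add)
    show "t (c *\<^sub>C x) = c *\<^sub>C t x" for c x
      by (rule l2_eqI) (simp add: nth l2_simps bop_apply_scaleC)
    show "norm (t x) \<le> K * norm x" for x
    proof (rule l2_norm_leI)
      fix N
      have "L2_set (\<lambda>n. norm (l2_nth (t x) n)) {..<N} \<le> L2_set (\<lambda>n. K * norm (l2_nth x n)) {..<N}"
        by (rule L2_set_mono) (simp_all add: nth K(2))
      also have "\<dots> = K * L2_set (\<lambda>n. norm (l2_nth x n)) {..<N}"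
        using K(1) by (simp add: L2_set_right_distrib)
      also have "\<dots> \<le> K * norm x" using K(1) by (intro mult_left_mono L2_set_le_l2_norm) simp
      finally show "L2_set (\<lambda>n. norm (l2_nth (t x) n)) {..<N} \<le> K * norm x" .
    qed
  qed
  then show ?thesis by (simp add: ampl_def t_def[symmetric] nth)
qed

lemma adj_ampl: "adj (ampl A) = ampl (adj A)"
proof (rule adj_eqI)
  fix x y
  have "((\<lambda>n. cinner (A *\<^sub>V l2_nth x n) (l2_nth y n)) has_sum cinner (ampl A *\<^sub>V x) y) UNIV"
    using l2_cinner_has_sum[of "ampl A *\<^sub>V x" y] by (simp add: l2_nth_ampl)
  moreover have "((\<lambda>n. cinner (A *\<^sub>V l2_nth x n) (l2_nth y n)) has_sum cinner x (ampl (adj A) *\<^sub>V y)) UNIV"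
    using l2_cinner_has_sum[of x "ampl (adj A) *\<^sub>V y"] by (simp add: l2_nth_ampl cinner_adj)
  ultimately show "cinner (ampl A *\<^sub>V x) y = cinner x (ampl (adj A) *\<^sub>V y)" by (rule has_sum_unique)
qed

lemma ampl_single: "ampl A *\<^sub>V l2_single j h = l2_single j (A *\<^sub>V h)"
  by (rule l2_eqI) (simp add: l2_nth_ampl l2_nth_single)

section \<open>Density\<close>

text \<open>The entries of the projection onto the closure of \<open>{X\<xi> | X \<in> \<A>}\<close> commute with \<open>S\<close>, so they
  are scalars and the projection commutes with every amplified operator.\<close>

lemma density:
  fixes S \<A> :: "'h::chilbert_space bop set"
  assumes one: "1 \<in> \<A>" and add: "\<And>X Y. X \<in> \<A> \<Longrightarrow> Y \<in> \<A> \<Longrightarrow> X + Y \<in> \<A>"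
    and sc: "\<And>c X. X \<in> \<A> \<Longrightarrow> c *\<^sub>C X \<in> \<A>"
    and mult: "\<And>s X. s \<in> S \<Longrightarrow> X \<in> \<A> \<Longrightarrow> s * X \<in> \<A>"
    and S_adj: "\<And>s. s \<in> S \<Longrightarrow> adj s \<in> S" and S_comm: "commutant S \<subseteq> range (\<lambda>c. c *\<^sub>C 1)"
  shows "\<exists>X. (\<forall>n. X n \<in> \<A>) \<and> (\<lambda>n. ampl (X n) *\<^sub>V \<xi>) \<longlonglongrightarrow> ampl Z *\<^sub>V \<xi>"
proof -
  define L where "L = (\<lambda>X. ampl X *\<^sub>V \<xi>) ` \<A>"
  define K where "K = closure L"
  have "csubspace L"
  proof (rule csubspaceI)
    have "0 *\<^sub>C 1 \<in> \<A>" by (intro sc one)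
    moreover have "0 = ampl (0 *\<^sub>C 1) *\<^sub>V \<xi>"
      by (rule l2_eqI) (simp add: l2_nth_ampl l2_simps bop_simps)
    ultimately show "0 \<in> L" unfolding L_def by (rule image_eqI[rotated])
    fix x y c assume "x \<in> L" "y \<in> L"
    then obtain X Y where XY: "X \<in> \<A>" "x = ampl X *\<^sub>V \<xi>" "Y \<in> \<A>" "y = ampl Y *\<^sub>V \<xi>"
      unfolding L_def by auto
    have "x + y = ampl (X + Y) *\<^sub>V \<xi>" unfolding XY
      by (rule l2_eqI) (simp add: l2_nth_ampl l2_simps bop_simps)
    then show "x + y \<in> L" unfolding L_def using add[OF XY(1,3)] by (rule image_eqI)
    have "c *\<^sub>C x = ampl (c *\<^sub>C X) *\<^sub>V \<xi>" unfolding XY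
      by (rule l2_eqI) (simp add: l2_nth_ampl l2_simps bop_simps)
    then show "c *\<^sub>C x \<in> L" unfolding L_def using sc[OF XY(1)] by (rule image_eqI)
  qed
  then have K: "csubspace K" "closed K" unfolding K_def by (simp_all add: csubspace_closure)
  have inv: "ampl s *\<^sub>V x \<in> K" if s: "s \<in> S" and x: "x \<in> K" for s x
  proof -
    obtain l where l: "\<And>n. l n \<in> L" "l \<longlonglongrightarrow> x" using x unfolding K_def closure_sequential by auto
    have mem: "ampl s *\<^sub>V l n \<in> L" for n
    proof -
      obtain X where X: "X \<in> \<A>" "l n = ampl X *\<^sub>V \<xi>" using l(1)[of n] unfolding L_def by auto
      have "ampl s *\<^sub>V l n = ampl (s * X) *\<^sub>V \<xi>" unfolding X
        by (rule l2_eqI) (simp add: l2_nth_ampl bop_simps)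
      then show ?thesis unfolding L_def using mult[OF s X(1)] by (rule image_eqI)
    qed
    have lim: "(\<lambda>n. ampl s *\<^sub>V l n) \<longlonglongrightarrow> ampl s *\<^sub>V x" by (rule bop_apply_tendsto[OF l(2)])
    show ?thesis unfolding K_def closure_sequential
      by (rule exI[of _ "\<lambda>n. ampl s *\<^sub>V l n"]) (simp add: mem lim)
  qed
  define P where "P = proj K"
  have Ps: "P * ampl s = ampl s * P" if "s \<in> S" for s
    unfolding P_def by (rule proj_commutes[OF K]) (simp_all add: inv that adj_ampl S_adj)
  obtain C where C: "C > 0" "\<And>x. norm (P *\<^sub>V x) \<le> C * norm x" using bop_bound[of P] by blast
  define p where "p i j = Abs_bop (\<lambda>h. l2_nth (P *\<^sub>V l2_single j h) i)" for i j
  have single_add: "l2_single j (g + h) = l2_single j g + l2_single j h" for j and g h :: 'h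
    by (rule l2_eqI) (simp add: l2_nth_single l2_simps)
  have single_sc: "l2_single j (c *\<^sub>C h) = c *\<^sub>C l2_single j h" for j c and h :: 'h
    by (rule l2_eqI) (simp add: l2_nth_single l2_simps)
  have p: "p i j *\<^sub>V h = l2_nth (P *\<^sub>V l2_single j h) i" for i j h
    unfolding p_def
  proof (rule Abs_bop_apply[where K = C])
    show "norm (l2_nth (P *\<^sub>V l2_single j x) i) \<le> C * norm x" for x
      using norm_l2_nth_le[of "P *\<^sub>V l2_single j x" i] C(2)[of "l2_single j x"] by (simp add: norm_l2_single)
  qed (simp_all add: single_add single_sc bop_apply_add bop_apply_scaleC l2_simps)
  have entry: "(p i j * T) *\<^sub>V h = l2_nth ((P * ampl T) *\<^sub>V l2_single j h) i"
    "(T * p i j) *\<^sub>V h = l2_nth ((ampl T * P) *\<^sub>V l2_single j h) i" for i j T h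
    by (simp_all add: bop_simps p l2_nth_ampl ampl_single)
  have "p i j \<in> commutant S" for i j
    unfolding commutant_def
  proof (intro CollectI ballI bop_eqI)
    fix s h assume "s \<in> S"
    then show "(p i j * s) *\<^sub>V h = (s * p i j) *\<^sub>V h" unfolding entry by (simp only: Ps)
  qed
  then have scal: "\<exists>c. p i j = c *\<^sub>C 1" for i j using S_comm by blast
  have "P * ampl Z = ampl Z * P"
  proof (rule l2_bop_eqI, rule l2_eqI)
    fix j i h
    obtain c where c: "p i j = c *\<^sub>C 1" using scal by blast
    have "(p i j * Z) *\<^sub>V h = (Z * p i j) *\<^sub>V h"
      unfolding c by (simp add: bop_mult_scaleC_left bop_mult_scaleC_right)
    then show "l2_nth ((P * ampl Z) *\<^sub>V l2_single j h) i = l2_nth ((ampl Z * P) *\<^sub>V l2_single j h) i"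
      unfolding entry .
  qed
  then have "(P * ampl Z) *\<^sub>V \<xi> = (ampl Z * P) *\<^sub>V \<xi>" by simp
  then have eq: "P *\<^sub>V (ampl Z *\<^sub>V \<xi>) = ampl Z *\<^sub>V (P *\<^sub>V \<xi>)" by (simp only: times_bop.rep_eq)
  \<comment> \<open>The unit of the algebra puts \<open>\<xi>\<close> itself into \<open>K\<close>;
    then \<open>ampl Z *\<^sub>V \<xi>\<close> equals
    \<open>ampl Z *\<^sub>V (P *\<^sub>V \<xi>)\<close>, which is in the range of
    \<open>P\<close>.\<close>
  have "\<xi> = ampl 1 *\<^sub>V \<xi>" by (rule l2_eqI) (simp add: l2_nth_ampl bop_simps)
  then have "\<xi> \<in> L" unfolding L_def using one by (rule image_eqI)
  then have "\<xi> \<in> K" unfolding K_def using closure_subset by auto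
  then have "P *\<^sub>V \<xi> = \<xi>" unfolding P_def by (rule proj_fixes[OF K])
  then have "ampl Z *\<^sub>V \<xi> \<in> K" using eq proj_mem[OF K, of "ampl Z *\<^sub>V \<xi>"] by (simp add: P_def)
  then obtain l where l: "\<And>n. l n \<in> L" "l \<longlonglongrightarrow> ampl Z *\<^sub>V \<xi>"
    unfolding K_def closure_sequential by auto
  have "\<forall>n. \<exists>X. X \<in> \<A> \<and> l n = ampl X *\<^sub>V \<xi>" using l(1) unfolding L_def by auto
  from choice[OF this] obtain X where X: "\<And>n. X n \<in> \<A>" "\<And>n. l n = ampl (X n) *\<^sub>V \<xi>" by auto
  then show ?thesis using l(2) by (intro exI[of _ X]) (simp add: X(2)[symmetric])
qed

section \<open>Normal functionals and dense subalgebras\<close>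

lemma normal_functional_l2:
  assumes "normal_functional f"
  obtains \<xi> \<eta> where "\<And>A. f A = cinner (ampl A *\<^sub>V \<xi>) \<eta>"
proof -
  obtain a b where f: "sq_summable a" "sq_summable b" "\<And>A. ((\<lambda>k. cinner (A *\<^sub>V a k) (b k)) has_sum f A) UNIV"
    using assms by (rule normal_functionalE) blast
  have "f A = cinner (ampl A *\<^sub>V Abs_l2 a) (Abs_l2 b)" for A
    by (rule has_sum_unique[OF f(3)])
      (use l2_cinner_has_sum[of "ampl A *\<^sub>V Abs_l2 a" "Abs_l2 b"] in \<open>simp add: l2_nth_ampl l2_nth_Abs f(1,2)\<close>)
  then show thesis by (rule that)
qed

lemma ampl_mult: "ampl (A * B) = ampl A * ampl B"
  by (rule bop_eqI, rule l2_eqI) (simp add: bop_simps l2_nth_ampl)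

lemma ampl_diff: "ampl (A - B) = ampl A - ampl B"
  by (rule bop_eqI, rule l2_eqI) (simp add: bop_simps l2_nth_ampl l2_simps)

text \<open>The direct sum of \<open>\<xi>\<close> and \<open>\<eta>\<close>, re-indexed by
  \<open>nat\<close>: one application of the density argument to it approximates at both vectors
  simultaneously.\<close>

definition l2_join :: "'h::chilbert_space l2 \<Rightarrow> 'h l2 \<Rightarrow> 'h l2" where
  "l2_join \<xi> \<eta> = Abs_l2 (\<lambda>n. case_sum (l2_nth \<xi>) (l2_nth \<eta>) (sum_decode n))"

lemma norm_ampl_l2_join:
  "(norm (ampl A *\<^sub>V l2_join \<xi> \<eta>))\<^sup>2 = (norm (ampl A *\<^sub>V \<xi>))\<^sup>2 + (norm (ampl A *\<^sub>V \<eta>))\<^sup>2"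
proof (rule has_sum_unique[OF l2_norm_has_sum])
  have "(norm (l2_nth (ampl A *\<^sub>V l2_join \<xi> \<eta>) n))\<^sup>2
      = case_sum (\<lambda>n. (norm (l2_nth (ampl A *\<^sub>V \<xi>) n))\<^sup>2) (\<lambda>n. (norm (l2_nth (ampl A *\<^sub>V \<eta>) n))\<^sup>2) (sum_decode n)" for n
    unfolding l2_nth_ampl l2_join_def l2_nth_Abs[OF sq_summable_sum_decode[OF sq_summable_l2_nth sq_summable_l2_nth]]
    by (cases "sum_decode n") simp_all
  then show "((\<lambda>n. (norm (l2_nth (ampl A *\<^sub>V l2_join \<xi> \<eta>) n))\<^sup>2) has_sum
      (norm (ampl A *\<^sub>V \<xi>))\<^sup>2 + (norm (ampl A *\<^sub>V \<eta>))\<^sup>2) UNIV"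
    using has_sum_sum_decode[OF l2_norm_has_sum[of "ampl A *\<^sub>V \<xi>"] l2_norm_has_sum[of "ampl A *\<^sub>V \<eta>"]]
    by (simp only:)
qed

lemma ampl_tendsto_if_join:
  assumes "(\<lambda>n. ampl (X n) *\<^sub>V l2_join \<xi> \<eta>) \<longlonglongrightarrow> ampl Z *\<^sub>V l2_join \<xi> \<eta>"
  shows "(\<lambda>n. ampl (X n) *\<^sub>V \<xi>) \<longlonglongrightarrow> ampl Z *\<^sub>V \<xi>" "(\<lambda>n. ampl (X n) *\<^sub>V \<eta>) \<longlonglongrightarrow> ampl Z *\<^sub>V \<eta>"
proof -
  have lim: "(\<lambda>n. norm (ampl (X n - Z) *\<^sub>V l2_join \<xi> \<eta>)) \<longlonglongrightarrow> 0"
    using tendsto_norm_zero[OF LIM_zero[OF assms]] by (simp add: ampl_diff minus_bop.rep_eq)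
  have le: "norm (ampl A *\<^sub>V \<xi>) \<le> norm (ampl A *\<^sub>V l2_join \<xi> \<eta>)"
    "norm (ampl A *\<^sub>V \<eta>) \<le> norm (ampl A *\<^sub>V l2_join \<xi> \<eta>)" for A
    by (rule power2_le_imp_le; simp add: norm_ampl_l2_join)+
  have *: "(\<lambda>n. ampl (X n) *\<^sub>V \<theta>) \<longlonglongrightarrow> ampl Z *\<^sub>V \<theta>"
    if "\<And>A. norm (ampl A *\<^sub>V \<theta>) \<le> norm (ampl A *\<^sub>V l2_join \<xi> \<eta>)" for \<theta>
  proof (rule LIM_zero_cancel, rule tendsto_norm_zero_cancel, rule tendsto_sandwich[OF _ _ tendsto_const lim])
    show "\<forall>\<^sub>F n in sequentially. norm (ampl (X n) *\<^sub>V \<theta> - ampl Z *\<^sub>V \<theta>) \<le> norm (ampl (X n - Z) *\<^sub>V l2_join \<xi> \<eta>)"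
      using that[of "X n - Z" for n] by (simp add: ampl_diff minus_bop.rep_eq)
  qed simp
  show "(\<lambda>n. ampl (X n) *\<^sub>V \<xi>) \<longlonglongrightarrow> ampl Z *\<^sub>V \<xi>" by (rule *) (rule le(1))
  show "(\<lambda>n. ampl (X n) *\<^sub>V \<eta>) \<longlonglongrightarrow> ampl Z *\<^sub>V \<eta>" by (rule *) (rule le(2))
qed

section \<open>Commutants and the algebra generated by \<open>M\<close> and its commutant\<close>

lemma commutant_one: "1 \<in> commutant S"
  and commutant_mult: "A \<in> commutant S \<Longrightarrow> B \<in> commutant S \<Longrightarrow> A * B \<in> commutant S"
  and commutant_scaleC: "A \<in> commutant S \<Longrightarrow> c *\<^sub>C A \<in> commutant S"
  and commutant_add: "A \<in> commutant S \<Longrightarrow> B \<in> commutant S \<Longrightarrow> A + B \<in> commutant S"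
proof -
  show "1 \<in> commutant S" by (simp add: commutant_def)
  show "A \<in> commutant S \<Longrightarrow> c *\<^sub>C A \<in> commutant S"
    by (simp add: commutant_def bop_mult_scaleC_left bop_mult_scaleC_right)
  show "A \<in> commutant S \<Longrightarrow> B \<in> commutant S \<Longrightarrow> A + B \<in> commutant S"
    by (simp add: commutant_def distrib_left distrib_right)
  assume A: "A \<in> commutant S" and B: "B \<in> commutant S"
  show "A * B \<in> commutant S" unfolding commutant_def
  proof (intro CollectI ballI)
    fix C assume "C \<in> S"
    then have "A * C = C * A" "B * C = C * B" using A B by (auto simp: commutant_def)
    then have "A * (B * C) = C * A * B" by (simp add: mult.assoc[symmetric])
    then show "A * B * C = C * (A * B)" by (simp only: mult.assoc)
  qed
qed

lemma commutant_adj: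
  assumes "\<And>A. A \<in> S \<Longrightarrow> adj A \<in> S" and A: "A \<in> commutant S"
  shows "adj A \<in> commutant S"
  unfolding commutant_def
proof (intro CollectI ballI)
  fix B assume "B \<in> S"
  then have "A * adj B = adj B * A" using assms by (auto simp: commutant_def)
  then have "adj (A * adj B) = adj (adj B * A)" by simp
  then show "adj A * B = B * adj A" by (simp add: adj_mult)
qed

definition alg_gen :: "'h::chilbert_space bop set \<Rightarrow> 'h bop set" where
  "alg_gen M = {\<Sum>i<n. A i * B i | (n :: nat) A B. \<forall>i<n. A i \<in> commutant M \<and> B i \<in> M}"

lemma alg_genI:
  fixes n :: nat
  shows "(\<And>i. i < n \<Longrightarrow> A i \<in> commutant M \<and> B i \<in> M) \<Longrightarrow> (\<Sum>i<n. A i * B i) \<in> alg_gen M"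
  unfolding alg_gen_def by (intro CollectI exI[of _ n] exI[of _ A] exI[of _ B]) auto

lemma alg_genE:
  assumes "X \<in> alg_gen M"
  obtains n :: nat and A B where "\<And>i. i < n \<Longrightarrow> A i \<in> commutant M \<and> B i \<in> M" "X = (\<Sum>i<n. A i * B i)"
  using assms unfolding alg_gen_def by auto

lemma alg_gen_prod: "A \<in> commutant M \<Longrightarrow> B \<in> M \<Longrightarrow> A * B \<in> alg_gen M"
  using alg_genI[of "Suc 0" "\<lambda>_. A" M "\<lambda>_. B"] by simp

lemma sum_append_lessThan:
  fixes f g :: "nat \<Rightarrow> 'a::comm_monoid_add"
  shows "(\<Sum>i<n + m. if i < n then f i else g (i - n)) = sum f {..<n} + sum g {..<m}"
  by (induction m) (simp_all add: add.assoc)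

lemma alg_gen_add: "X \<in> alg_gen M \<Longrightarrow> Y \<in> alg_gen M \<Longrightarrow> X + Y \<in> alg_gen M"
proof -
  assume "X \<in> alg_gen M" "Y \<in> alg_gen M"
  then obtain n m :: nat and A B C D where
    X: "\<And>i. i < n \<Longrightarrow> A i \<in> commutant M \<and> B i \<in> M" "X = (\<Sum>i<n. A i * B i)" and
    Y: "\<And>i. i < m \<Longrightarrow> C i \<in> commutant M \<and> D i \<in> M" "Y = (\<Sum>i<m. C i * D i)"
    by (elim alg_genE) blast
  have "X + Y = (\<Sum>i<n + m. (if i < n then A i else C (i - n)) * (if i < n then B i else D (i - n)))"
    unfolding X(2) Y(2) sum_append_lessThan[symmetric] by (rule sum.cong) auto
  also have "\<dots> \<in> alg_gen M"
    by (rule alg_genI) (use X(1) Y(1) in auto)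
  finally show ?thesis .
qed

lemma bop_scaleC_sum: "c *\<^sub>C (\<Sum>i\<in>I. f i :: 'h::chilbert_space bop) = (\<Sum>i\<in>I. c *\<^sub>C f i)"
  by (rule cvs.scale_sum_right)

lemma alg_gen_scaleC: "X \<in> alg_gen M \<Longrightarrow> c *\<^sub>C X \<in> alg_gen M"
proof (erule alg_genE)
  fix n :: nat and A B
  assume AB: "\<And>i. i < n \<Longrightarrow> A i \<in> commutant M \<and> B i \<in> M" "X = (\<Sum>i<n. A i * B i)"
  have "c *\<^sub>C X = (\<Sum>i<n. (c *\<^sub>C A i) * B i)"
    unfolding AB(2) bop_scaleC_sum bop_mult_scaleC_left ..
  also have "\<dots> \<in> alg_gen M" by (rule alg_genI) (use AB(1) in \<open>auto intro: commutant_scaleC\<close>)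
  finally show "c *\<^sub>C X \<in> alg_gen M" .
qed

lemma adj_sum: "adj (\<Sum>i\<in>I. f i) = (\<Sum>i\<in>I. adj (f i))"
proof -
  have z: "adj 0 = (0 :: 'a bop)" by (rule adj_eqI) (simp add: bop_simps)
  show ?thesis by (induction I rule: infinite_finite_induct) (simp_all add: z adj_add)
qed

lemma bop_sum_apply: "(\<Sum>i\<in>I. f i) *\<^sub>V x = (\<Sum>i\<in>I. f i *\<^sub>V x)"
  by (induction I rule: infinite_finite_induct) (simp_all add: bop_simps)

lemma bop_eq_if_dense:
  assumes D: "closure D = UNIV" and eq: "\<And>x. x \<in> D \<Longrightarrow> S *\<^sub>V x = T *\<^sub>V x"
  shows "S = T"
proof (rule bop_eqI)
  fix x
  have "x \<in> closure D" using D by simp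
  then obtain a where a: "\<And>n. a n \<in> D" "a \<longlonglongrightarrow> x" unfolding closure_sequential by auto
  have "(\<lambda>n. S *\<^sub>V a n) \<longlonglongrightarrow> T *\<^sub>V x" unfolding eq[OF a(1)] by (rule bop_apply_tendsto[OF a(2)])
  from LIMSEQ_unique[OF bop_apply_tendsto[OF a(2)] this] show "S *\<^sub>V x = T *\<^sub>V x" .
qed

context
  fixes M :: "'h::chilbert_space bop set"
  assumes M: "factor M"
begin

lemma factor_adj: "A \<in> M \<Longrightarrow> adj A \<in> M"
  and factor_bicommutant: "commutant (commutant M) = M"
  using M by (auto simp: factor_def von_neumann_algebra_def)

lemma factor_one: "1 \<in> M"
  and factor_mult: "A \<in> M \<Longrightarrow> B \<in> M \<Longrightarrow> A * B \<in> M"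
  using commutant_one[of "commutant M"] commutant_mult[of A "commutant M" B] by (simp_all add: factor_bicommutant)

lemma factor_commutant_adj: "A \<in> commutant M \<Longrightarrow> adj A \<in> commutant M"
  by (rule commutant_adj[OF factor_adj])

lemma alg_gen_one: "1 \<in> alg_gen M"
  using alg_gen_prod[OF commutant_one factor_one] by simp

text \<open>An operator commuting with \<open>M\<close> and \<open>M'\<close> lies in the
  intersection of \<open>M'\<close> and \<open>M'' = M\<close>, which is scalar for a
  factor.\<close>

lemma alg_gen_dense: "\<exists>X. (\<forall>n. X n \<in> alg_gen M) \<and> (\<lambda>n. ampl (X n) *\<^sub>V \<xi>) \<longlonglongrightarrow> ampl Z *\<^sub>V \<xi>"
proof (rule density[where S = "M \<union> commutant M"])
  show "1 \<in> alg_gen M" by (rule alg_gen_one)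
  show "X + Y \<in> alg_gen M" if "X \<in> alg_gen M" "Y \<in> alg_gen M" for X Y using that by (rule alg_gen_add)
  show "c *\<^sub>C X \<in> alg_gen M" if "X \<in> alg_gen M" for c X using that by (rule alg_gen_scaleC)
  show "adj s \<in> M \<union> commutant M" if "s \<in> M \<union> commutant M" for s
    using that factor_adj factor_commutant_adj by blast
  have "commutant (M \<union> commutant M) \<subseteq> commutant M \<inter> commutant (commutant M)"
    by (auto simp: commutant_def)
  also have "\<dots> = range (\<lambda>c. c *\<^sub>C 1)" using M unfolding factor_bicommutant factor_def by blast
  finally show "commutant (M \<union> commutant M) \<subseteq> range (\<lambda>c. c *\<^sub>C 1)" .
  show "s * X \<in> alg_gen M" if s: "s \<in> M \<union> commutant M" and X: "X \<in> alg_gen M" for s X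
  proof -
    obtain n :: nat and A B where AB: "\<And>i. i < n \<Longrightarrow> A i \<in> commutant M \<and> B i \<in> M" "X = (\<Sum>i<n. A i * B i)"
      using X by (rule alg_genE) blast
    from s show ?thesis
    proof
      assume sM: "s \<in> M"
      have "s * X = (\<Sum>i<n. A i * (s * B i))"
        unfolding AB(2) sum_distrib_left
      proof (rule sum.cong[OF refl])
        fix i assume "i \<in> {..<n}"
        then have "A i * s = s * A i" using AB(1)[of i] sM by (simp add: commutant_def)
        then show "s * (A i * B i) = A i * (s * B i)" by (simp add: mult.assoc[symmetric])
      qed
      also have "\<dots> \<in> alg_gen M" by (rule alg_genI) (use AB(1) factor_mult[OF sM] in auto)
      finally show ?thesis .
    next
      assume sM: "s \<in> commutant M"
      have "s * X = (\<Sum>i<n. (s * A i) * B i)"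
        unfolding AB(2) sum_distrib_left by (simp add: mult.assoc)
      also have "\<dots> \<in> alg_gen M" by (rule alg_genI) (use AB(1) commutant_mult[OF sM] in auto)
      finally show ?thesis .
    qed
  qed
qed

text \<open>Applied to differences of matrix coefficients, this extends identities between normal
  maps from the algebra to all of \<open>B(H)\<close>.\<close>

lemma normal_functional_zero_if_alg_gen:
  assumes f: "normal_functional f" and z: "\<And>X. X \<in> alg_gen M \<Longrightarrow> f X = 0"
  shows "f Z = 0"
proof -
  obtain \<xi> \<eta> where f': "\<And>A. f A = cinner (ampl A *\<^sub>V \<xi>) \<eta>" using normal_functional_l2[OF f] by auto
  obtain X where X: "\<And>n. X n \<in> alg_gen M" "(\<lambda>n. ampl (X n) *\<^sub>V \<xi>) \<longlonglongrightarrow> ampl Z *\<^sub>V \<xi>"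
    using alg_gen_dense[of \<xi> Z] by auto
  have "(\<lambda>n. cinner (ampl (X n) *\<^sub>V \<xi>) \<eta>) \<longlonglongrightarrow> f Z"
    unfolding f' by (intro cinner.tendsto X tendsto_const)
  then have "(\<lambda>n. 0) \<longlonglongrightarrow> f Z" unfolding f'[symmetric] z[OF X(1)] .
  from LIMSEQ_unique[OF this tendsto_const] show ?thesis .
qed

text \<open>In amplified form the value at \<open>A\<^sup>*A\<close> is
  \<open>\<langle>A\<xi>, A\<eta>\<rangle>\<close>, so the approximating elements must converge
  strongly at \<open>\<xi>\<close> and at \<open>\<eta>\<close> along the same sequence, which
  \<open>l2_join\<close> provides.\<close>

lemma normal_functional_positive_if_alg_gen:
  assumes f: "normal_functional f" and pos: "\<And>X. X \<in> alg_gen M \<Longrightarrow> f (adj X * X) \<in> \<real>\<^sub>\<ge>\<^sub>0"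
  shows "f (adj Z * Z) \<in> \<real>\<^sub>\<ge>\<^sub>0"
proof -
  obtain \<xi> \<eta> where f': "\<And>A. f A = cinner (ampl A *\<^sub>V \<xi>) \<eta>" using normal_functional_l2[OF f] by auto
  have f'': "f (adj A * A) = cinner (ampl A *\<^sub>V \<xi>) (ampl A *\<^sub>V \<eta>)" for A
    unfolding f' ampl_mult times_bop.rep_eq adj_ampl[symmetric] cinner_adj_left ..
  obtain X where X: "\<And>n. X n \<in> alg_gen M" "(\<lambda>n. ampl (X n) *\<^sub>V l2_join \<xi> \<eta>) \<longlonglongrightarrow> ampl Z *\<^sub>V l2_join \<xi> \<eta>"
    using alg_gen_dense[of "l2_join \<xi> \<eta>" Z] by auto
  have lim: "(\<lambda>n. cinner (ampl (X n) *\<^sub>V \<xi>) (ampl (X n) *\<^sub>V \<eta>)) \<longlonglongrightarrow> f (adj Z * Z)"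
    unfolding f'' by (intro cinner.tendsto ampl_tendsto_if_join[OF X(2)])
  have mem: "cinner (ampl (X n) *\<^sub>V \<xi>) (ampl (X n) *\<^sub>V \<eta>) \<in> \<real>\<^sub>\<ge>\<^sub>0" for n
    using pos[OF X(1), of n] unfolding f'' .
  show ?thesis by (rule closed_sequentially[OF closed_nonneg_Reals_complex mem lim])
qed

text \<open>A vector separating for \<open>M\<close> is cyclic for \<open>M'\<close>: the projection
  onto the closure of \<open>M'x\<^sub>0\<close> lies in \<open>M'' = M\<close>, and its complement
  annihilates \<open>x\<^sub>0\<close>.\<close>

lemma commutant_orbit_dense:
  assumes sep: "separating_vector M x\<^sub>0"
  shows "closure {A *\<^sub>V x\<^sub>0 | A. A \<in> commutant M} = UNIV"
proof -
  define L where "L = {A *\<^sub>V x\<^sub>0 | A. A \<in> commutant M}"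
  define K where "K = closure L"
  have L: "x \<in> L \<longleftrightarrow> (\<exists>A\<in>commutant M. x = A *\<^sub>V x\<^sub>0)" for x unfolding L_def by auto
  have "csubspace L"
  proof (rule csubspaceI)
    have "0 *\<^sub>C 1 \<in> commutant M" by (intro commutant_scaleC commutant_one)
    then show "0 \<in> L" unfolding L by (rule bexI[rotated]) (simp add: bop_simps)
    fix x y c assume "x \<in> L" "y \<in> L"
    then obtain A B where AB: "A \<in> commutant M" "x = A *\<^sub>V x\<^sub>0" "B \<in> commutant M" "y = B *\<^sub>V x\<^sub>0"
      unfolding L by auto
    show "x + y \<in> L" unfolding L using commutant_add[OF AB(1,3)]
      by (rule bexI[rotated]) (simp add: AB bop_simps)
    have "c *\<^sub>C x = (c *\<^sub>C A) *\<^sub>V x\<^sub>0" by (simp add: AB bop_simps)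
    then show "c *\<^sub>C x \<in> L" unfolding L using commutant_scaleC[OF AB(1)] by blast
  qed
  then have K: "csubspace K" "closed K" unfolding K_def by (simp_all add: csubspace_closure)
  have inv: "s *\<^sub>V x \<in> K" if s: "s \<in> commutant M" and x: "x \<in> K" for s x
  proof -
    obtain l where l: "\<And>n. l n \<in> L" "l \<longlonglongrightarrow> x" using x unfolding K_def closure_sequential by auto
    have mem: "s *\<^sub>V l n \<in> L" for n
    proof -
      obtain A where A: "A \<in> commutant M" "l n = A *\<^sub>V x\<^sub>0" using l(1)[of n] unfolding L by auto
      show ?thesis unfolding L using commutant_mult[OF s A(1)]
        by (rule bexI[rotated]) (simp add: A bop_simps)
    qed
    have lim: "(\<lambda>n. s *\<^sub>V l n) \<longlonglongrightarrow> s *\<^sub>V x" by (rule bop_apply_tendsto[OF l(2)])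
    show ?thesis unfolding K_def closure_sequential
      by (rule exI[of _ "\<lambda>n. s *\<^sub>V l n"]) (simp add: mem lim)
  qed
  have "proj K * s = s * proj K" if "s \<in> commutant M" for s
    by (rule proj_commutes[OF K]) (simp_all add: inv that factor_commutant_adj)
  then have "1 - proj K \<in> commutant (commutant M)"
    by (simp add: commutant_def left_diff_distrib right_diff_distrib)
  then have mem: "1 - proj K \<in> M" unfolding factor_bicommutant .
  have "x\<^sub>0 \<in> L" unfolding L using commutant_one by (rule bexI[rotated]) (simp add: bop_simps)
  then have "x\<^sub>0 \<in> K" unfolding K_def using closure_subset by auto
  then have "(1 - proj K) *\<^sub>V x\<^sub>0 = 0" by (simp add: bop_simps proj_fixes[OF K])
  then have "1 - proj K = 0" using sep mem unfolding separating_vector_def by blast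
  then have "proj K = 1" by simp
  then have "x \<in> K" for x using proj_mem[OF K, of x] by (simp add: one_bop.rep_eq)
  then show ?thesis unfolding K_def L_def by auto
qed

section \<open>The normal extension of a map in \<open>CB_sigma M\<close>\<close>

context
  assumes separable: "separable_space (euclidean :: 'h topology)"
begin

lemma normal_extension_functional:
  assumes "normal_extension M \<phi> \<Phi>"
  shows "normal_functional (\<lambda>A. cinner (\<Phi> A *\<^sub>V u) v)"
  by (rule normal_map_normal_functional[OF separable _ _ normal_functional_vector])
    (use assms in \<open>simp_all add: normal_extension_def\<close>)

lemma normal_extension_sum:
  fixes n :: nat
  assumes "normal_extension M \<phi> \<Phi>" "\<And>i. i < n \<Longrightarrow> A i \<in> commutant M \<and> B i \<in> M"
  shows "\<Phi> (\<Sum>i<n. A i * B i) = (\<Sum>i<n. A i * \<phi> (B i))"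
proof -
  have "\<forall>(n::nat) A' B. (\<forall>i<n. A' i \<in> commutant M \<and> B i \<in> M) \<longrightarrow> \<Phi> (\<Sum>i<n. A' i * B i) = (\<Sum>i<n. A' i * \<phi> (B i))"
    using assms(1) unfolding normal_extension_def by auto
  from this[rule_format, of n A B] assms(2) show ?thesis by simp
qed

lemma normal_extension_prod:
  assumes "normal_extension M \<phi> \<Phi>" "A \<in> commutant M" "B \<in> M"
  shows "\<Phi> (A * B) = A * \<phi> B"
  using normal_extension_sum[OF assms(1), of "Suc 0" "\<lambda>_. A" "\<lambda>_. B"] assms by simp

lemma normal_extension_eq:
  assumes "normal_extension M \<phi> \<Phi>" "B \<in> M"
  shows "\<Phi> B = \<phi> B"
  using normal_extension_prod[OF assms(1) commutant_one assms(2)] by simp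

text \<open>Gives the description in \<open>tilde\<close> its meaning.\<close>

lemma normal_extension_unique:
  assumes \<Phi>: "normal_extension M \<phi> \<Phi>" and \<Psi>: "normal_extension M \<phi> \<Psi>"
  shows "\<Phi> = \<Psi>"
proof
  fix A
  show "\<Phi> A = \<Psi> A"
  proof (rule bop_extI)
    fix u v
    have "cinner (\<Phi> A *\<^sub>V u) v - cinner (\<Psi> A *\<^sub>V u) v = 0"
    proof (rule normal_functional_zero_if_alg_gen[where f = "\<lambda>A. cinner (\<Phi> A *\<^sub>V u) v - cinner (\<Psi> A *\<^sub>V u) v"])
      show "normal_functional (\<lambda>A. cinner (\<Phi> A *\<^sub>V u) v - cinner (\<Psi> A *\<^sub>V u) v)"
        by (intro normal_functional_minus normal_extension_functional[OF \<Phi>] normal_extension_functional[OF \<Psi>])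
      fix X assume "X \<in> alg_gen M"
      then obtain n :: nat and A B where AB: "\<And>i. i < n \<Longrightarrow> A i \<in> commutant M \<and> B i \<in> M" "X = (\<Sum>i<n. A i * B i)"
        by (rule alg_genE) blast
      have "\<Phi> X = \<Psi> X"
        unfolding AB(2) using AB(1)
        by (subst normal_extension_sum[OF \<Phi>], assumption, subst normal_extension_sum[OF \<Psi>]) auto
      then show "cinner (\<Phi> X *\<^sub>V u) v - cinner (\<Psi> X *\<^sub>V u) v = 0" by simp
    qed
    then show "cinner (\<Phi> A *\<^sub>V u) v = cinner (\<Psi> A *\<^sub>V u) v" by simp
  qed
qed

lemma normal_extension_tilde:
  assumes "\<phi> \<in> CB_sigma M"
  shows "normal_extension M \<phi> (tilde M \<phi>)"
proof -
  obtain \<Phi> where \<Phi>: "normal_extension M \<phi> \<Phi>" using assms by (auto simp: CB_sigma_def)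
  have "tilde M \<phi> = \<Phi>"
    unfolding tilde_def by (rule the_equality[where P = "normal_extension M \<phi>", OF \<Phi>]) (rule normal_extension_unique[OF _ \<Phi>])
  then show ?thesis using \<Phi> by simp
qed

text \<open>On a sum of products \<open>C\<^sub>iD\<^sub>i\<close> the factor \<open>B\<close> is
  moved past \<open>D\<^sub>i\<close>, and afterwards back past \<open>\<phi>(D\<^sub>i)\<close>;
  the second move is legitimate because \<open>\<phi>\<close> takes values in \<open>M\<close>. Both
  sides have normal matrix coefficients in \<open>X\<close>.\<close>

lemma normal_extension_bimodule:
  assumes \<Phi>: "normal_extension M \<phi> \<Phi>" and A: "A \<in> commutant M" and B: "B \<in> commutant M"
    and \<phi>: "\<And>X. X \<in> M \<Longrightarrow> \<phi> X \<in> M"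
  shows "\<Phi> (A * X * B) = A * \<Phi> X * B"
proof (rule bop_extI)
  fix u v
  have f: "normal_functional (\<lambda>X. cinner (\<Phi> (A * X * B) *\<^sub>V u) v)"
    by (rule normal_functional_compose[OF normal_extension_functional[OF \<Phi>]])
  have g: "normal_functional (\<lambda>X. cinner (\<Phi> X *\<^sub>V (B *\<^sub>V u)) (adj A *\<^sub>V v))"
    by (rule normal_extension_functional[OF \<Phi>])
  have "cinner (\<Phi> (A * X * B) *\<^sub>V u) v - cinner (\<Phi> X *\<^sub>V (B *\<^sub>V u)) (adj A *\<^sub>V v) = 0"
  proof (rule normal_functional_zero_if_alg_gen[OF normal_functional_minus[OF f g]])
    fix X assume "X \<in> alg_gen M"
    then obtain n :: nat and C D where CD: "\<And>i. i < n \<Longrightarrow> C i \<in> commutant M \<and> D i \<in> M" "X = (\<Sum>i<n. C i * D i)"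
      by (rule alg_genE) blast
    have "A * X * B = (\<Sum>i<n. (A * C i * B) * D i)"
      unfolding CD(2) sum_distrib_left sum_distrib_right
    proof (rule sum.cong[OF refl])
      fix i assume "i \<in> {..<n}"
      then have "B * D i = D i * B" using CD(1)[of i] B by (simp add: commutant_def)
      then show "A * (C i * D i) * B = A * C i * B * D i" by (simp add: mult.assoc)
    qed
    then have "\<Phi> (A * X * B) = \<Phi> (\<Sum>i<n. (A * C i * B) * D i)" by simp
    also have "\<dots> = (\<Sum>i<n. (A * C i * B) * \<phi> (D i))"
      by (rule normal_extension_sum[OF \<Phi>]) (use CD(1) A B in \<open>auto intro!: commutant_mult\<close>)
    also have "\<dots> = A * (\<Sum>i<n. C i * \<phi> (D i)) * B"
      unfolding sum_distrib_left sum_distrib_right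
    proof (rule sum.cong[OF refl])
      fix i assume "i \<in> {..<n}"
      then have "B * \<phi> (D i) = \<phi> (D i) * B" using CD(1)[of i] B \<phi> by (simp add: commutant_def)
      then show "A * C i * B * \<phi> (D i) = A * (C i * \<phi> (D i)) * B" by (simp add: mult.assoc)
    qed
    also have "(\<Sum>i<n. C i * \<phi> (D i)) = \<Phi> X"
      unfolding CD(2) using CD(1) by (subst normal_extension_sum[OF \<Phi>]) auto
    finally show "cinner (\<Phi> (A * X * B) *\<^sub>V u) v - cinner (\<Phi> X *\<^sub>V (B *\<^sub>V u)) (adj A *\<^sub>V v) = 0"
      by (simp add: bop_simps cinner_adj)
  qed
  then show "cinner (\<Phi> (A * X * B) *\<^sub>V u) v = cinner ((A * \<Phi> X * B) *\<^sub>V u) v"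
    by (simp add: bop_simps cinner_adj)
qed

text \<open>For \<open>X\<close> a sum of products \<open>A\<^sub>iB\<^sub>i\<close>, commuting the
  two algebras rewrites \<open>\<langle>\<Phi>(X\<^sup>*X)u, u\<rangle>\<close> as the quadratic
  form of the matrix \<open>\<phi>(B\<^sub>i\<^sup>*B\<^sub>j)\<close> at the tuple
  \<open>A\<^sub>ju\<close>. The size of the matrix is the number of summands of \<open>X\<close>,
  hence the need for complete positivity.\<close>

lemma normal_extension_positive_if_cp:
  assumes \<Phi>: "normal_extension M \<phi> \<Phi>" and cp: "completely_positive_on M \<phi>"
    and \<phi>: "\<And>X. X \<in> M \<Longrightarrow> \<phi> X \<in> M"
  shows "positive_op (\<Phi> (adj Z * Z))"
  unfolding positive_op_def
proof
  fix u
  show "cinner (\<Phi> (adj Z * Z) *\<^sub>V u) u \<in> \<real>\<^sub>\<ge>\<^sub>0"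
  proof (rule normal_functional_positive_if_alg_gen[OF normal_extension_functional[OF \<Phi>]])
    fix X assume "X \<in> alg_gen M"
    then obtain n :: nat and A B where AB: "\<And>i. i < n \<Longrightarrow> A i \<in> commutant M \<and> B i \<in> M" "X = (\<Sum>i<n. A i * B i)"
      by (rule alg_genE) blast
    have lin: "\<Phi> (S + T) = \<Phi> S + \<Phi> T" "\<Phi> (c *\<^sub>C S) = c *\<^sub>C \<Phi> S" for S T c
      using \<Phi> by (simp_all add: normal_extension_def linear_map_on_def)
    have \<Phi>0: "\<Phi> 0 = 0" using lin(1)[of 0 0] by simp
    have \<Phi>sum: "\<Phi> (\<Sum>i\<in>I. f i) = (\<Sum>i\<in>I. \<Phi> (f i))" for I :: "nat set" and f
      by (induction I rule: infinite_finite_induct) (simp_all add: \<Phi>0 lin)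
    have "adj X * X = (\<Sum>i<n. \<Sum>j<n. (adj (A i) * A j) * (adj (B i) * B j))"
      unfolding AB(2) adj_sum sum_product
    proof (intro sum.cong refl)
      fix i j assume "i \<in> {..<n}" "j \<in> {..<n}"
      then have B: "adj (B i) \<in> M" "adj (A i) \<in> commutant M" and A: "A j \<in> commutant M"
        using AB(1) by (auto intro: factor_adj factor_commutant_adj)
      have 1: "adj (B i) * adj (A i) = adj (A i) * adj (B i)" using B by (simp add: commutant_def)
      have 2: "adj (B i) * A j = A j * adj (B i)" using B A by (simp add: commutant_def)
      have "adj (A i * B i) * (A j * B j) = adj (A i) * (adj (B i) * A j) * B j"
        by (simp only: adj_mult 1 mult.assoc)
      also have "\<dots> = (adj (A i) * A j) * (adj (B i) * B j)" unfolding 2 by (simp only: mult.assoc)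
      finally show "adj (A i * B i) * (A j * B j) = (adj (A i) * A j) * (adj (B i) * B j)" .
    qed
    then have "\<Phi> (adj X * X) = (\<Sum>i<n. \<Sum>j<n. (adj (A i) * A j) * \<phi> (adj (B i) * B j))"
      by (simp only: \<Phi>sum) (intro sum.cong refl normal_extension_prod[OF \<Phi>] commutant_mult
        factor_commutant_adj factor_mult factor_adj, use AB(1) in auto)
    then have eq: "cinner (\<Phi> (adj X * X) *\<^sub>V u) u
        = tuple_inner n (mat_apply n (amplify \<phi> (\<lambda>i j. adj (B i) * B j)) (\<lambda>j. A j *\<^sub>V u)) (\<lambda>j. A j *\<^sub>V u)"
    proof -
      have "cinner (((adj (A i) * A j) * \<phi> (adj (B i) * B j)) *\<^sub>V u) u
          = cinner (\<phi> (adj (B i) * B j) *\<^sub>V (A j *\<^sub>V u)) (A i *\<^sub>V u)" if "i < n" "j < n" for i j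
      proof -
        have "adj (B i) * B j \<in> M" using AB(1) that by (intro factor_mult factor_adj) auto
        then have "\<phi> (adj (B i) * B j) \<in> M" by (rule \<phi>)
        then have "A j * \<phi> (adj (B i) * B j) = \<phi> (adj (B i) * B j) * A j"
          using AB(1)[OF \<open>j < n\<close>] by (simp add: commutant_def)
        then have "(adj (A i) * A j) * \<phi> (adj (B i) * B j) = adj (A i) * (\<phi> (adj (B i) * B j) * A j)"
          by (simp only: mult.assoc)
        then show ?thesis by (simp only: times_bop.rep_eq cinner_adj_left)
      qed
      then show ?thesis
        unfolding \<open>\<Phi> (adj X * X) = _\<close> tuple_inner_def mat_apply_def amplify_def bop_sum_apply cinner.sum_left
        by (intro sum.cong refl) simp
    qed
    \<comment> \<open>A Gram matrix: its form at \<open>x\<close> is the squared norm of the sum of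
      the \<open>B\<^sub>jx\<^sub>j\<close>.\<close>
    have "mat_positive n (\<lambda>i j. adj (B i) * B j)"
      unfolding mat_positive_def
    proof
      fix x :: "nat \<Rightarrow> 'h"
      let ?s = "\<Sum>j<n. B j *\<^sub>V x j"
      have "tuple_inner n (mat_apply n (\<lambda>i j. adj (B i) * B j) x) x = cinner ?s ?s"
        unfolding tuple_inner_def mat_apply_def cinner.sum_left cinner.sum_right times_bop.rep_eq cinner_adj_left
        by (rule refl)
      then show "tuple_inner n (mat_apply n (\<lambda>i j. adj (B i) * B j) x) x \<in> \<real>\<^sub>\<ge>\<^sub>0"
        unfolding cinner_self by (simp only: nonneg_Reals_of_real_iff zero_le_power2)
    qed
    moreover have "(\<lambda>i j. adj (B i) * B j) \<in> matrices n M"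
      unfolding matrices_def using AB(1) by (auto intro!: factor_mult factor_adj)
    ultimately have "mat_positive n (amplify \<phi> (\<lambda>i j. adj (B i) * B j))"
      using cp unfolding completely_positive_on_def by blast
    then show "cinner (\<Phi> (adj X * X) *\<^sub>V u) u \<in> \<real>\<^sub>\<ge>\<^sub>0"
      unfolding eq mat_positive_def by blast
  qed
qed

end

end

section \<open>Kraus decompositions\<close>

lemma nonneg_Reals_iff_Re: "z \<in> \<real>\<^sub>\<ge>\<^sub>0 \<longleftrightarrow> Re z \<ge> 0 \<and> Im z = 0"
  by (auto simp: complex_nonneg_Reals_iff)

lemma sums_nonneg_Reals:
  assumes "f sums s" "\<And>k. f k \<in> \<real>\<^sub>\<ge>\<^sub>0"
  shows "s \<in> (\<real>\<^sub>\<ge>\<^sub>0 :: complex set)"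
proof (rule closed_sequentially[OF closed_nonneg_Reals_complex])
  show "(\<Sum>k<n. f k) \<in> \<real>\<^sub>\<ge>\<^sub>0" for n
    using assms(2) by (simp add: nonneg_Reals_iff_Re sum_nonneg)
  show "(\<lambda>n. \<Sum>k<n. f k) \<longlonglongrightarrow> s" using assms(1) by (simp add: sums_def)
qed

text \<open>Each term of the series contributes the form of \<open>A\<close> at the tuple
  \<open>V\<^sub>kx\<^sub>j\<close>. Weak convergence is enough, and \<open>S\<close> is left open
  so that \<open>M\<close> and \<open>B(H)\<close> are both covered.\<close>

lemma completely_positive_if_kraus:
  assumes lin: "linear_map_on S \<phi>"
    and kraus: "\<And>A u w. A \<in> S \<Longrightarrow> (\<lambda>k::nat. cinner (A *\<^sub>V (V k *\<^sub>V u)) (V k *\<^sub>V w)) sums cinner (\<phi> A *\<^sub>V u) w"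
  shows "completely_positive_on S \<phi>"
  unfolding completely_positive_on_def mat_positive_def
proof (intro conjI lin allI ballI impI)
  fix n A x
  assume A: "A \<in> matrices n S" and pos: "\<forall>x. tuple_inner n (mat_apply n A x) x \<in> \<real>\<^sub>\<ge>\<^sub>0"
  have "(\<lambda>k. \<Sum>i<n. \<Sum>j<n. cinner (A i j *\<^sub>V (V k *\<^sub>V x j)) (V k *\<^sub>V x i))
      sums (\<Sum>i<n. \<Sum>j<n. cinner (\<phi> (A i j) *\<^sub>V x j) (x i))"
    by (intro sums_sum kraus) (use A in \<open>auto simp: matrices_def\<close>)
  then have "(\<lambda>k. tuple_inner n (mat_apply n A (\<lambda>j. V k *\<^sub>V x j)) (\<lambda>j. V k *\<^sub>V x j))
      sums tuple_inner n (mat_apply n (amplify \<phi> A) x) x"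
    by (simp add: tuple_inner_def mat_apply_def amplify_def cinner.sum_left)
  then show "tuple_inner n (mat_apply n (amplify \<phi> A) x) x \<in> \<real>\<^sub>\<ge>\<^sub>0"
    by (rule sums_nonneg_Reals) (simp add: pos)
qed

lemma positive_map_if_completely_positive:
  assumes "completely_positive_on S \<phi>"
  shows "positive_map_on S \<phi>"
  unfolding positive_map_on_def
proof (intro conjI ballI impI)
  show "linear_map_on S \<phi>" using assms by (simp add: completely_positive_on_def)
  fix A assume A: "A \<in> S" "positive_op A"
  have "(\<lambda>_ _. A) \<in> matrices 1 S" using A(1) by (simp add: matrices_def)
  moreover have "mat_positive 1 (\<lambda>_ _. A)"
    using A(2) by (simp add: mat_positive_def tuple_inner_def mat_apply_def positive_op_def)
  ultimately have "mat_positive 1 (amplify \<phi> (\<lambda>_ _. A))"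
    using assms unfolding completely_positive_on_def by blast
  then have "tuple_inner 1 (mat_apply 1 (amplify \<phi> (\<lambda>_ _. A)) (\<lambda>_. x)) (\<lambda>_. x) \<in> \<real>\<^sub>\<ge>\<^sub>0" for x
    unfolding mat_positive_def by blast
  then show "positive_op (\<phi> A)"
    by (simp add: tuple_inner_def mat_apply_def amplify_def positive_op_def)
qed

section \<open>Norms of operator matrices and the completely bounded norm\<close>

lemma tuple_norm_L2_set: "tuple_norm n x = L2_set (\<lambda>i. norm (x i)) {..<n}"
  by (simp add: tuple_norm_def L2_set_def)

lemma tuple_inner_le: "Re (tuple_inner n x y) \<le> tuple_norm n x * tuple_norm n y"
proof -
  have "Re (tuple_inner n x y) \<le> (\<Sum>i<n. \<bar>norm (x i)\<bar> * \<bar>norm (y i)\<bar>)"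
    unfolding tuple_inner_def Re_sum
    by (intro sum_mono) (simp add: order_trans[OF complex_Re_le_cmod cinner_Cauchy_Schwarz])
  also have "\<dots> \<le> tuple_norm n x * tuple_norm n y"
    unfolding tuple_norm_L2_set by (rule L2_set_mult_ineq)
  finally show ?thesis .
qed

lemma tuple_norm_square: "(tuple_norm n x)\<^sup>2 = (\<Sum>i<n. (norm (x i))\<^sup>2)"
  by (simp add: tuple_norm_def sum_nonneg)

lemma tuple_norm_nonneg: "0 \<le> tuple_norm n x"
  by (simp add: tuple_norm_def sum_nonneg)

lemma tuple_norm_scaleC: "tuple_norm n (\<lambda>i. c *\<^sub>C x i) = cmod c * tuple_norm n x"
  unfolding tuple_norm_L2_set norm_scaleC by (simp add: L2_set_right_distrib)

text \<open>\<open>mat_norm\<close> is a supremum of reals; without this bound it could not be used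
  as an upper bound.\<close>

lemma mat_apply_bounded:
  fixes A :: "nat \<Rightarrow> nat \<Rightarrow> 'h::chilbert_space bop"
  shows "bdd_above ((\<lambda>x. tuple_norm n (mat_apply n A x)) ` {x. tuple_norm n x \<le> 1})"
proof -
  have "\<exists>K. K > 0 \<and> (\<forall>x. norm (A i j *\<^sub>V x) \<le> K * norm x)" for i j
    using bop_bound[of "A i j"] by blast
  then have "\<forall>p. \<exists>K. K > 0 \<and> (\<forall>x. norm (A (fst p) (snd p) *\<^sub>V x) \<le> K * norm x)" by blast
  from choice[OF this] obtain k where
    k: "\<forall>p. k p > 0 \<and> (\<forall>x. norm (A (fst p) (snd p) *\<^sub>V x) \<le> k p * norm x)" ..
  define K where "K i j = k (i, j)" for i j
  have K: "K i j > 0" "norm (A i j *\<^sub>V x) \<le> K i j * norm x" for i j x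
    unfolding K_def using k[rule_format, of "(i, j)"] by simp_all
  show ?thesis
  proof (rule bdd_aboveI2)
    fix x :: "nat \<Rightarrow> 'h" assume "x \<in> {x. tuple_norm n x \<le> 1}"
    then have x: "tuple_norm n x \<le> 1" by simp
    have le1: "norm (x j) \<le> 1" if "j < n" for j
      using member_le_L2_set[of "{..<n}" j "\<lambda>i. norm (x i)"] that x by (simp add: tuple_norm_L2_set)
    have "tuple_norm n (mat_apply n A x) \<le> (\<Sum>i<n. norm (mat_apply n A x i))"
      unfolding tuple_norm_L2_set by (rule L2_set_le_sum) simp
    also have "\<dots> \<le> (\<Sum>i<n. \<Sum>j<n. K i j)"
    proof (rule sum_mono)
      fix i
      have "norm (mat_apply n A x i) \<le> (\<Sum>j<n. norm (A i j *\<^sub>V x j))"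
        unfolding mat_apply_def by (rule norm_sum)
      also have "\<dots> \<le> (\<Sum>j<n. K i j)"
      proof (rule sum_mono)
        fix j assume "j \<in> {..<n}"
        then have "K i j * norm (x j) \<le> K i j * 1"
          using le1[of j] K(1)[of i j] by (intro mult_left_mono) auto
        then show "norm (A i j *\<^sub>V x j) \<le> K i j" using K(2)[of i j "x j"] by simp
      qed
      finally show "norm (mat_apply n A x i) \<le> (\<Sum>j<n. K i j)" .
    qed
    finally show "tuple_norm n (mat_apply n A x) \<le> (\<Sum>i<n. \<Sum>j<n. K i j)" .
  qed
qed

lemma tuple_norm_le_mat_norm: "tuple_norm n x \<le> 1 \<Longrightarrow> tuple_norm n (mat_apply n A x) \<le> mat_norm n A"
  unfolding mat_norm_def by (rule cSUP_upper[OF _ mat_apply_bounded]) simp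

lemma mat_norm_le:
  assumes "\<And>x. tuple_norm n x \<le> 1 \<Longrightarrow> tuple_norm n (mat_apply n A x) \<le> c"
  shows "mat_norm n A \<le> c"
  unfolding mat_norm_def
proof (rule cSUP_least)
  have "tuple_norm n (\<lambda>_. 0 :: 'a) \<le> 1" by (simp add: tuple_norm_def)
  then show "{x. tuple_norm n (x :: nat \<Rightarrow> 'a) \<le> 1} \<noteq> {}" by blast
qed (simp add: assms)

lemma mat_norm_contraction:
  assumes "mat_norm n A \<le> 1"
  shows "tuple_norm n (mat_apply n A x) \<le> tuple_norm n x"
proof (cases "tuple_norm n x = 0")
  \<comment> \<open>Only the entries below \<open>n\<close> are known to vanish, and
    \<open>mat_apply\<close> reads no others.\<close>
  case True
  have "norm (x i) \<le> 0" if "i < n" for i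
    using member_le_L2_set[of "{..<n}" i "\<lambda>i. norm (x i)"] that True by (simp add: tuple_norm_L2_set)
  then have "mat_apply n A x = (\<lambda>_. 0)" unfolding mat_apply_def by (intro ext sum.neutral) simp
  then show ?thesis using tuple_norm_nonneg[of n x] by (simp add: tuple_norm_def)
next
  case False
  define t where "t = tuple_norm n x"
  have t: "t > 0" using False tuple_norm_nonneg[of n x] by (simp add: t_def)
  let ?c = "complex_of_real (1 / t)"
  have "tuple_norm n (\<lambda>i. ?c *\<^sub>C x i) = 1"
    unfolding tuple_norm_scaleC t_def[symmetric] using t by (simp add: norm_divide)
  then have "tuple_norm n (mat_apply n A (\<lambda>i. ?c *\<^sub>C x i)) \<le> 1"
    using tuple_norm_le_mat_norm[of n "\<lambda>i. ?c *\<^sub>C x i" A] assms by simp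
  also have "mat_apply n A (\<lambda>i. ?c *\<^sub>C x i) = (\<lambda>i. ?c *\<^sub>C mat_apply n A x i)"
    unfolding mat_apply_def bop_apply_scaleC by (simp add: cvs.scale_sum_right)
  finally have "tuple_norm n (mat_apply n A x) / t \<le> 1"
    unfolding tuple_norm_scaleC using t by (simp add: norm_divide)
  then show ?thesis using t by (simp add: t_def)
qed

text \<open>The bound needs no operator norm of the amplified map: \<open>\<parallel>\<phi>\<^sub>n(A)x\<parallel>\<^sup>2\<close> is a sum over \<open>k\<close> of inner
  products of \<open>A(V\<^sub>k x)\<close> with \<open>V\<^sub>k(\<phi>\<^sub>n(A)x)\<close>, and weighted AM-GM makes it absorb itself.\<close>

lemma kraus_mat_norm_le:
  assumes kraus: "\<And>A u w. A \<in> S \<Longrightarrow> (\<lambda>k::nat. cinner (A *\<^sub>V (V k *\<^sub>V u)) (V k *\<^sub>V w)) sums cinner (\<phi> A *\<^sub>V u) w"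
    and one: "1 \<in> S" and c: "c > 0" "\<And>u. Re (cinner (\<phi> 1 *\<^sub>V u) u) \<le> c * (norm u)\<^sup>2"
    and A: "A \<in> matrices n S" "mat_norm n A \<le> 1"
  shows "mat_norm n (amplify \<phi> A) \<le> c"
proof (rule mat_norm_le)
  fix x :: "nat \<Rightarrow> 'a" assume x: "tuple_norm n x \<le> 1"
  define y where "y = mat_apply n (amplify \<phi> A) x"
  define p where "p z k = tuple_norm n (\<lambda>i. V k *\<^sub>V z i)" for z :: "nat \<Rightarrow> 'a" and k
  have p_sums: "(\<lambda>k. (p z k)\<^sup>2) sums (\<Sum>i<n. Re (cinner (\<phi> 1 *\<^sub>V z i) (z i)))" for z
  proof -
    have "(\<lambda>k. (norm (V k *\<^sub>V z i))\<^sup>2) sums Re (cinner (\<phi> 1 *\<^sub>V z i) (z i))" for i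
      using sums_Re[OF kraus[OF one, of "z i" "z i"]] by (simp add: bop_simps cinner_self)
    then show ?thesis unfolding p_def tuple_norm_square by (rule sums_sum)
  qed
  have p_le: "(\<Sum>i<n. Re (cinner (\<phi> 1 *\<^sub>V z i) (z i))) \<le> c * (tuple_norm n z)\<^sup>2" for z
    unfolding tuple_norm_square sum_distrib_left by (intro sum_mono c)
  have "(\<lambda>k. \<Sum>i<n. \<Sum>j<n. cinner (A i j *\<^sub>V (V k *\<^sub>V x j)) (V k *\<^sub>V y i))
      sums (\<Sum>i<n. \<Sum>j<n. cinner (\<phi> (A i j) *\<^sub>V x j) (y i))"
    by (intro sums_sum kraus) (use A in \<open>auto simp: matrices_def\<close>)
  then have inner_sums: "(\<lambda>k. tuple_inner n (mat_apply n A (\<lambda>j. V k *\<^sub>V x j)) (\<lambda>j. V k *\<^sub>V y j)) sums tuple_inner n y y"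
    by (simp add: tuple_inner_def y_def mat_apply_def amplify_def cinner.sum_left)
  have inner_y: "tuple_inner n y y = of_real ((tuple_norm n y)\<^sup>2)"
    unfolding tuple_norm_square tuple_inner_def cinner_self by simp
  have ysums: "(\<lambda>k. Re (tuple_inner n (mat_apply n A (\<lambda>j. V k *\<^sub>V x j)) (\<lambda>j. V k *\<^sub>V y j)))
      sums (tuple_norm n y)\<^sup>2"
    using sums_Re[OF inner_sums] unfolding inner_y Re_complex_of_real .
  have term_le: "Re (tuple_inner n (mat_apply n A (\<lambda>j. V k *\<^sub>V x j)) (\<lambda>j. V k *\<^sub>V y j))
      \<le> (c / 2) * (p x k)\<^sup>2 + (1 / (2 * c)) * (p y k)\<^sup>2" for k
  proof -
    have "Re (tuple_inner n (mat_apply n A (\<lambda>j. V k *\<^sub>V x j)) (\<lambda>j. V k *\<^sub>V y j))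
        \<le> tuple_norm n (mat_apply n A (\<lambda>j. V k *\<^sub>V x j)) * p y k"
      unfolding p_def by (rule tuple_inner_le)
    also have "\<dots> \<le> p x k * p y k"
      unfolding p_def by (intro mult_right_mono mat_norm_contraction A(2) tuple_norm_nonneg)
    \<comment> \<open>The weights are chosen so that, once \<open>\<phi>(1)\<close> is bounded by
      \<open>c\<close>, the part with \<open>y\<close> contributes exactly half of the squared norm
      of \<open>y\<close>.\<close>
    also have "\<dots> \<le> (c / 2) * (p x k)\<^sup>2 + (1 / (2 * c)) * (p y k)\<^sup>2"
    proof -
      have "0 \<le> (c * p x k - p y k)\<^sup>2 / (2 * c)" using c(1) by simp
      also have "\<dots> = (c / 2) * (p x k)\<^sup>2 + (1 / (2 * c)) * (p y k)\<^sup>2 - p x k * p y k"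
        using c(1) by (simp add: power2_eq_square field_simps)
      finally show ?thesis by simp
    qed
    finally show ?thesis .
  qed
  have "(tuple_norm n y)\<^sup>2 \<le> (c / 2) * (\<Sum>i<n. Re (cinner (\<phi> 1 *\<^sub>V x i) (x i)))
      + (1 / (2 * c)) * (\<Sum>i<n. Re (cinner (\<phi> 1 *\<^sub>V y i) (y i)))"
    by (rule sums_le[OF term_le ysums]) (intro sums_add sums_mult p_sums)
  also have "\<dots> \<le> (c / 2) * (c * (tuple_norm n x)\<^sup>2) + (1 / (2 * c)) * (c * (tuple_norm n y)\<^sup>2)"
    using c(1) by (intro add_mono mult_left_mono p_le) auto
  also have "\<dots> = (c\<^sup>2 * (tuple_norm n x)\<^sup>2 + (tuple_norm n y)\<^sup>2) / 2"
    using c(1) by (simp add: power2_eq_square field_simps)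
  finally have "(tuple_norm n y)\<^sup>2 \<le> (c * tuple_norm n x)\<^sup>2" by (simp add: power_mult_distrib)
  then have "tuple_norm n y \<le> c * tuple_norm n x"
    by (rule power2_le_imp_le) (use c(1) tuple_norm_nonneg[of n x] in simp)
  also have "\<dots> \<le> c" using mult_left_mono[OF x, of c] c(1) by simp
  finally show "tuple_norm n (mat_apply n (amplify \<phi> A) x) \<le> c" unfolding y_def .
qed

text \<open>A first, crude constant \<open>c\<close> shows that the set under the supremum is
  bounded. After that, the single entry at the unit of size one compares the norm of
  \<open>\<phi>(1)\<close> with \<open>cb_norm_on\<close>.\<close>

lemma kraus_le_cb_norm:
  assumes kraus: "\<And>A u w. A \<in> S \<Longrightarrow> (\<lambda>k::nat. cinner (A *\<^sub>V (V k *\<^sub>V u)) (V k *\<^sub>V w)) sums cinner (\<phi> A *\<^sub>V u) w"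
    and one: "1 \<in> S"
  shows "Re (cinner (\<phi> 1 *\<^sub>V u) u) \<le> cb_norm_on S \<phi> * (norm u)\<^sup>2"
proof (cases "u = 0")
  case False
  obtain c where c: "c > 0" "\<And>u. norm (\<phi> 1 *\<^sub>V u) \<le> c * norm u" using bop_bound[of "\<phi> 1"] by blast
  have c': "Re (cinner (\<phi> 1 *\<^sub>V u) u) \<le> c * (norm u)\<^sup>2" for u
  proof -
    have "Re (cinner (\<phi> 1 *\<^sub>V u) u) \<le> norm (\<phi> 1 *\<^sub>V u) * norm u"
      by (rule order_trans[OF complex_Re_le_cmod cinner_Cauchy_Schwarz])
    also have "\<dots> \<le> (c * norm u) * norm u" by (intro mult_right_mono c) simp
    finally show ?thesis by (simp add: power2_eq_square mult.assoc)
  qed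
  \<comment> \<open>All entries are \<open>1\<close>, but it is used only at size one, where it is
    the identity matrix.\<close>
  let ?I = "\<lambda>(i::nat) (j::nat). 1 :: 'a bop"
  let ?\<S> = "{(n, A). A \<in> matrices n S \<and> mat_norm n A \<le> 1}"
  have t1: "tuple_norm 1 x = norm (x 0)" for x :: "nat \<Rightarrow> 'a" by (simp add: tuple_norm_def)
  have m1: "mat_apply 1 B x = (\<lambda>i. B i 0 *\<^sub>V x 0)" for B :: "nat \<Rightarrow> nat \<Rightarrow> 'a bop" and x
    by (simp add: mat_apply_def)
  have "mat_norm 1 ?I \<le> 1"
    by (rule mat_norm_le) (simp only: t1 m1 one_bop.rep_eq)
  moreover have "?I \<in> matrices 1 S" using one by (simp add: matrices_def)
  ultimately have mem: "(1, ?I) \<in> ?\<S>" by simp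
  have "bdd_above ((\<lambda>(n, A). mat_norm n (amplify \<phi> A)) ` ?\<S>)"
  proof (rule bdd_aboveI2)
    fix q assume "q \<in> ?\<S>"
    then obtain n A where "q = (n, A)" "A \<in> matrices n S" "mat_norm n A \<le> 1" by auto
    then show "(\<lambda>(n, A). mat_norm n (amplify \<phi> A)) q \<le> c"
      using kraus_mat_norm_le[OF kraus one c(1) c'] by simp
  qed
  from cSUP_upper[OF mem this] have le: "mat_norm 1 (amplify \<phi> ?I) \<le> cb_norm_on S \<phi>"
    by (simp add: cb_norm_on_def)
  define v where "v = complex_of_real (1 / norm u) *\<^sub>C u"
  have v: "norm v = 1" using False by (simp add: v_def norm_scaleC norm_divide)
  have "tuple_norm 1 (mat_apply 1 (amplify \<phi> ?I) (\<lambda>_. v)) \<le> cb_norm_on S \<phi>"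
    by (rule order_trans[OF tuple_norm_le_mat_norm le]) (simp only: t1 v order_refl)
  then have "norm (\<phi> 1 *\<^sub>V v) \<le> cb_norm_on S \<phi>" by (simp only: t1 m1 amplify_def)
  then have "norm (\<phi> 1 *\<^sub>V u) \<le> cb_norm_on S \<phi> * norm u"
    using False by (simp add: v_def bop_apply_scaleC norm_scaleC norm_divide field_simps)
  then have "norm (\<phi> 1 *\<^sub>V u) * norm u \<le> cb_norm_on S \<phi> * norm u * norm u"
    by (rule mult_right_mono) simp
  moreover have "Re (cinner (\<phi> 1 *\<^sub>V u) u) \<le> norm (\<phi> 1 *\<^sub>V u) * norm u"
    by (rule order_trans[OF complex_Re_le_cmod cinner_Cauchy_Schwarz])
  ultimately show ?thesis by (simp add: power2_eq_square mult.assoc)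
qed simp

text \<open>The inequality \<open>y \<boxtimes> y \<le> \<parallel>y\<parallel>\<^sup>2 1\<close>,
  for an \<open>f\<close> known to be positive only on special rank one operators. With
  \<open>t = \<parallel>y\<parallel>\<^sup>2\<close> the difference \<open>Z\<close> is self-adjoint
  with \<open>Z\<^sup>2 = tZ\<close>, so \<open>tZ\<close> has the form \<open>ZZ\<^sup>*\<close>
  without taking a square root.\<close>

lemma normal_functional_rank_one_le:
  fixes f :: "'h::chilbert_space bop \<Rightarrow> complex"
  assumes sep: "separable_space (euclidean :: 'h topology)"
    and f: "normal_functional f" and D: "closure D = UNIV"
    and pos: "\<And>x. x \<in> D \<Longrightarrow> f (x \<boxtimes> x) \<in> \<real>\<^sub>\<ge>\<^sub>0"
  shows "Re (f (y \<boxtimes> y)) \<le> (norm y)\<^sup>2 * Re (f 1)"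
proof (cases "y = 0")
  case True
  then have "y \<boxtimes> y = 0" by (intro bop_eqI) (simp add: bop_simps)
  then show ?thesis using True by (simp add: normal_functional_0[OF f])
next
  case False
  define t where "t = (norm y)\<^sup>2"
  have t: "t > 0" using False by (simp add: t_def)
  define Z where "Z = complex_of_real t *\<^sub>C 1 - y \<boxtimes> y"
  have adjZ: "adj Z = Z"
    unfolding Z_def
    by (rule adj_eqI) (simp add: bop_simps cinner.diff_left cinner.diff_right cinner_scaleC_left
        cinner_scaleC_right, subst cinner_commute, simp)
  have "Z * Z = complex_of_real t *\<^sub>C Z"
  proof (rule bop_eqI)
    fix x
    have "cinner y y = complex_of_real t" by (simp add: cinner_self t_def)
    then show "(Z * Z) *\<^sub>V x = (complex_of_real t *\<^sub>C Z) *\<^sub>V x"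
      by (simp add: Z_def bop_simps cinner.diff_left cinner_scaleC_left scaleC_scaleC scaleC_diff_right mult.commute)
  qed
  then have "f (complex_of_real t *\<^sub>C Z) \<in> \<real>\<^sub>\<ge>\<^sub>0"
    using normal_functional_positive[OF sep f D pos, of Z] by (simp add: adjZ)
  then have "0 \<le> t * (t * Re (f 1) - Re (f (y \<boxtimes> y)))"
    by (simp add: Z_def normal_functional_scaleC[OF f] normal_functional_diff[OF f] nonneg_Reals_iff_Re)
  then show ?thesis using t by (simp add: zero_le_mult_iff t_def)
qed

section \<open>Kraus operators and the predual for a fixed extension\<close>

context
  fixes M :: "'h::chilbert_space bop set" and x\<^sub>0 :: 'h and \<phi> \<Phi> :: "'h bop \<Rightarrow> 'h bop"
  assumes M: "factor M" and separable: "separable_space (euclidean :: 'h topology)"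
    and sep: "separating_vector M x\<^sub>0"
    and \<Phi>: "normal_extension M \<phi> \<Phi>" and \<phi>M: "\<phi> ` M \<subseteq> M"
begin

lemma image_in_factor: "X \<in> M \<Longrightarrow> \<phi> X \<in> M"
  using \<phi>M by blast

lemma extension_commutant_orbit:
  assumes A: "A \<in> commutant M" and B: "B \<in> commutant M"
  shows "\<Phi> ((A *\<^sub>V x\<^sub>0) \<boxtimes> (B *\<^sub>V x\<^sub>0)) = A * \<Phi> (x\<^sub>0 \<boxtimes> x\<^sub>0) * adj B"
proof -
  have "(A *\<^sub>V x\<^sub>0) \<boxtimes> (B *\<^sub>V x\<^sub>0) = A * (x\<^sub>0 \<boxtimes> x\<^sub>0) * adj B"
    by (simp add: mult_rank_one rank_one_mult)
  then show ?thesis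
    using normal_extension_bimodule[OF M separable \<Phi> A factor_commutant_adj[OF M B] image_in_factor, of "x\<^sub>0 \<boxtimes> x\<^sub>0"] by simp
qed

text \<open>Positivity of \<open>\<Phi>\<close> is assumed at
  \<open>x\<^sub>0 \<boxtimes> x\<^sub>0\<close> only; the bimodule property transports the square
  root found there along the orbit of the commutant.\<close>

lemma kraus_exists:
  assumes C: "positive_op (\<Phi> (x\<^sub>0 \<boxtimes> x\<^sub>0))"
  shows "\<exists>V. (\<forall>k::nat. V k \<in> M) \<and>
    (\<forall>A u w. (\<lambda>k. cinner (A *\<^sub>V (V k *\<^sub>V u)) (V k *\<^sub>V w)) sums cinner (\<Phi> A *\<^sub>V u) w)"
proof -
  define D where "D = {A *\<^sub>V x\<^sub>0 | A. A \<in> commutant M}"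
  have D: "closure D = UNIV" unfolding D_def by (rule commutant_orbit_dense[OF M sep])
  have D_iff: "x \<in> D \<longleftrightarrow> (\<exists>A\<in>commutant M. x = A *\<^sub>V x\<^sub>0)" for x unfolding D_def by auto
  note nf = normal_extension_functional[OF M separable \<Phi>]
  obtain c where c: "c > 0" "\<And>u. norm (\<Phi> 1 *\<^sub>V u) \<le> c * norm u" using bop_bound[of "\<Phi> 1"] by blast
  obtain e :: "nat \<Rightarrow> 'h" where e: "parseval e" using parseval_exists[OF separable] by auto
  obtain R where R: "positive_op R" "R * R = \<Phi> (x\<^sub>0 \<boxtimes> x\<^sub>0)" using positive_sqrt_exists[OF C] by blast
  have Rself: "cinner (R *\<^sub>V x) y = cinner x (R *\<^sub>V y)" for x y
    by (simp only: cinner_adj positive_op_adj[OF R(1)])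
  define v where "v k = R *\<^sub>V e k" for k
  \<comment> \<open>Parseval for the inner product of \<open>RB\<^sup>*u\<close> with
    \<open>RA\<^sup>*w\<close>, which is a matrix coefficient of \<open>ACB\<^sup>*\<close>.\<close>
  have expand: "((\<lambda>k. cinner u (B *\<^sub>V v k) * cinner (A *\<^sub>V v k) w) has_sum
      cinner (\<Phi> ((A *\<^sub>V x\<^sub>0) \<boxtimes> (B *\<^sub>V x\<^sub>0)) *\<^sub>V u) w) UNIV"
    if A: "A \<in> commutant M" and B: "B \<in> commutant M" for A B u w
  proof -
    have "((\<lambda>k. cinner (R *\<^sub>V (adj B *\<^sub>V u)) (e k) * cinner (e k) (R *\<^sub>V (adj A *\<^sub>V w))) has_sum
        cinner (R *\<^sub>V (adj B *\<^sub>V u)) (R *\<^sub>V (adj A *\<^sub>V w))) UNIV"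
      using e unfolding parseval_def by blast
    moreover have "cinner (R *\<^sub>V (adj B *\<^sub>V u)) (e k) = cinner u (B *\<^sub>V v k)" for k
      unfolding Rself v_def cinner_adj_left ..
    moreover have "cinner (e k) (R *\<^sub>V (adj A *\<^sub>V w)) = cinner (A *\<^sub>V v k) w" for k
      unfolding Rself[symmetric] v_def cinner_adj ..
    moreover have "cinner (R *\<^sub>V (adj B *\<^sub>V u)) (R *\<^sub>V (adj A *\<^sub>V w))
        = cinner (\<Phi> ((A *\<^sub>V x\<^sub>0) \<boxtimes> (B *\<^sub>V x\<^sub>0)) *\<^sub>V u) w"
      unfolding extension_commutant_orbit[OF A B] R(2)[symmetric] times_bop.rep_eq cinner_adj[symmetric] Rself[symmetric] ..
    ultimately show ?thesis by simp
  qed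
  have square: "((\<lambda>k. (cmod (cinner u (A *\<^sub>V v k)))\<^sup>2) has_sum Re (cinner (\<Phi> ((A *\<^sub>V x\<^sub>0) \<boxtimes> (A *\<^sub>V x\<^sub>0)) *\<^sub>V u) u)) UNIV"
    if A: "A \<in> commutant M" for A u
    using has_sum_Re[OF expand[OF A A, of u u]] by (simp add: cmod_cinner_mult del: times_complex.sel)
  have pos: "cinner (\<Phi> (x \<boxtimes> x) *\<^sub>V u) u \<in> \<real>\<^sub>\<ge>\<^sub>0" if xD: "x \<in> D" for x u
  proof -
    obtain A where A: "A \<in> commutant M" "x = A *\<^sub>V x\<^sub>0" using xD unfolding D_iff by auto
    have "cinner u (A *\<^sub>V v k) * cinner (A *\<^sub>V v k) u \<in> \<real>\<^sub>\<ge>\<^sub>0" for k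
      by (subst cinner_commute[of _ u]) (simp add: complex_norm_square[symmetric] nonneg_Reals_of_real_iff del: of_real_power)
    with has_sum_imp_sums[OF expand[OF A(1) A(1), of u u]] show ?thesis
      unfolding A(2) by (rule sums_nonneg_Reals)
  qed
  have bound: "norm (A *\<^sub>V v k) \<le> sqrt c * norm (A *\<^sub>V x\<^sub>0)" if A: "A \<in> commutant M" for A k
  proof -
    \<comment> \<open>Testing the series of squares at \<open>u = Av\<^sub>k\<close> itself: its
      \<open>k\<close>-th term is the fourth power of the norm of \<open>u\<close>, while the total
      is at most quadratic in \<open>u\<close>.\<close>
    define u where "u = A *\<^sub>V v k"
    have "((norm u)\<^sup>2)\<^sup>2 = (cmod (cinner u (A *\<^sub>V v k)))\<^sup>2"
      unfolding u_def[symmetric] cinner_self by (simp del: of_real_power add: norm_of_real)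
    also have "\<dots> \<le> Re (cinner (\<Phi> ((A *\<^sub>V x\<^sub>0) \<boxtimes> (A *\<^sub>V x\<^sub>0)) *\<^sub>V u) u)"
      using finite_sum_le_has_sum[OF square[OF A, of u], of "{k}"] by simp
    also have "\<dots> \<le> (norm (A *\<^sub>V x\<^sub>0))\<^sup>2 * Re (cinner (\<Phi> 1 *\<^sub>V u) u)"
      by (rule normal_functional_rank_one_le[OF separable nf D pos])
    also have "\<dots> \<le> (norm (A *\<^sub>V x\<^sub>0))\<^sup>2 * (c * (norm u)\<^sup>2)"
    proof (rule mult_left_mono)
      have "Re (cinner (\<Phi> 1 *\<^sub>V u) u) \<le> norm (\<Phi> 1 *\<^sub>V u) * norm u"
        by (rule order_trans[OF complex_Re_le_cmod cinner_Cauchy_Schwarz])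
      also have "\<dots> \<le> (c * norm u) * norm u" by (intro mult_right_mono c) simp
      finally show "Re (cinner (\<Phi> 1 *\<^sub>V u) u) \<le> c * (norm u)\<^sup>2" by (simp add: power2_eq_square mult.assoc)
    qed simp
    finally have "(norm u)\<^sup>2 * (norm u)\<^sup>2 \<le> (c * (norm (A *\<^sub>V x\<^sub>0))\<^sup>2) * (norm u)\<^sup>2"
      by (simp only: power2_eq_square[of "(norm u)\<^sup>2"] mult_ac)
    then have "(norm u)\<^sup>2 \<le> c * (norm (A *\<^sub>V x\<^sub>0))\<^sup>2"
      using c(1) by (cases "u = 0") (simp, simp only: mult_le_cancel_right_pos zero_less_power zero_less_norm_iff not_False_eq_True)
    also have "\<dots> = (sqrt c * norm (A *\<^sub>V x\<^sub>0))\<^sup>2" using c(1) by (simp add: power_mult_distrib)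
    finally have "norm u \<le> sqrt c * norm (A *\<^sub>V x\<^sub>0)"
      by (rule power2_le_imp_le) (use c(1) in simp)
    then show ?thesis unfolding u_def .
  qed
  have "\<exists>W. \<forall>A\<in>commutant M. W *\<^sub>V (A *\<^sub>V x\<^sub>0) = A *\<^sub>V v k" for k
  proof -
    \<comment> \<open>Working with the graph leaves well-definedness to the bound:
      \<open>Ax\<^sub>0 = 0\<close> forces \<open>Av\<^sub>k = 0\<close>.\<close>
    define G where "G = (\<lambda>A. (A *\<^sub>V x\<^sub>0, A *\<^sub>V v k)) ` commutant M"
    have G: "(a, b) \<in> G \<longleftrightarrow> (\<exists>A\<in>commutant M. a = A *\<^sub>V x\<^sub>0 \<and> b = A *\<^sub>V v k)" for a b
      unfolding G_def by auto
    have "\<exists>W. \<forall>(a, b)\<in>G. W *\<^sub>V a = b"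
    proof (rule bounded_graph_extension[where K = "sqrt c"])
      fix a b a' b' assume "(a, b) \<in> G" "(a', b') \<in> G"
      then obtain A A' where A: "A \<in> commutant M" "a = A *\<^sub>V x\<^sub>0 \<and> b = A *\<^sub>V v k"
        "A' \<in> commutant M" "a' = A' *\<^sub>V x\<^sub>0 \<and> b' = A' *\<^sub>V v k" unfolding G by auto
      show "(a + a', b + b') \<in> G" unfolding G using commutant_add[OF A(1,3)]
        by (rule bexI[rotated]) (simp add: A bop_simps)
    next
      fix d a b assume "(a, b) \<in> G"
      then obtain A where A: "A \<in> commutant M" "a = A *\<^sub>V x\<^sub>0 \<and> b = A *\<^sub>V v k" unfolding G by auto
      have "d *\<^sub>C a = (d *\<^sub>C A) *\<^sub>V x\<^sub>0 \<and> d *\<^sub>C b = (d *\<^sub>C A) *\<^sub>V v k" by (simp add: A bop_simps)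
      then show "(d *\<^sub>C a, d *\<^sub>C b) \<in> G" unfolding G using commutant_scaleC[OF A(1)] by blast
      show "norm b \<le> sqrt c * norm a" using bound[OF A(1)] A(2) by simp
    next
      have "0 = (0 *\<^sub>C 1) *\<^sub>V x\<^sub>0 \<and> 0 = (0 *\<^sub>C 1) *\<^sub>V v k" by (simp add: bop_simps)
      then show "(0, 0) \<in> G" unfolding G using commutant_scaleC[OF commutant_one] by blast
    qed (use c(1) in simp)
    then show ?thesis unfolding G_def by auto
  qed
  then have "\<forall>k. \<exists>W. \<forall>A\<in>commutant M. W *\<^sub>V (A *\<^sub>V x\<^sub>0) = A *\<^sub>V v k" by blast
  from choice[OF this] obtain W where W: "\<And>k A. A \<in> commutant M \<Longrightarrow> W k *\<^sub>V (A *\<^sub>V x\<^sub>0) = A *\<^sub>V v k" by auto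
  define V where "V k = adj (W k)" for k
  have "W k \<in> commutant (commutant M)" for k
    unfolding commutant_def[of "commutant M"]
  proof (intro CollectI ballI bop_eq_if_dense[OF D])
    fix B x assume B: "B \<in> commutant M" and "x \<in> D"
    then obtain A where A: "A \<in> commutant M" "x = A *\<^sub>V x\<^sub>0" unfolding D_iff by auto
    have "W k *\<^sub>V (B *\<^sub>V x) = W k *\<^sub>V ((B * A) *\<^sub>V x\<^sub>0)" by (simp add: A bop_simps)
    also have "\<dots> = B *\<^sub>V (W k *\<^sub>V x)"
      unfolding W[OF commutant_mult[OF B A(1)]] A(2) W[OF A(1)] by (simp add: bop_simps)
    finally show "(W k * B) *\<^sub>V x = (B * W k) *\<^sub>V x" by (simp add: bop_simps)
  qed
  then have VM: "V k \<in> M" for k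
    unfolding V_def by (intro factor_adj[OF M]) (simp add: factor_bicommutant[OF M])
  have rank: "cinner ((x \<boxtimes> y) *\<^sub>V (V k *\<^sub>V u)) (V k *\<^sub>V w) = cinner u (W k *\<^sub>V y) * cinner (W k *\<^sub>V x) w" for x y k u w
    by (simp add: V_def bop_simps cinner_scaleC_left cinner_adj_left cinner_adj)
  have agree: "((\<lambda>k. cinner ((x \<boxtimes> y) *\<^sub>V (V k *\<^sub>V u)) (V k *\<^sub>V w)) has_sum cinner (\<Phi> (x \<boxtimes> y) *\<^sub>V u) w) UNIV"
    if xyD: "x \<in> D" "y \<in> D" for x y u w
  proof -
    obtain A B where A: "A \<in> commutant M" "x = A *\<^sub>V x\<^sub>0" and B: "B \<in> commutant M" "y = B *\<^sub>V x\<^sub>0"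
      using xyD unfolding D_iff by auto
    show ?thesis unfolding rank A(2) B(2) W[OF A(1)] W[OF B(1)] by (rule expand[OF A(1) B(1), unfolded A(2) B(2)])
  qed
  have sqV: "sq_summable (\<lambda>k. V k *\<^sub>V u)" for u
  proof -
    have partial: "(\<Sum>k<N. (norm (V k *\<^sub>V u))\<^sup>2) \<le> Re (cinner (\<Phi> 1 *\<^sub>V u) u)" for N
    proof -
      \<comment> \<open>On operators \<open>x \<boxtimes> x\<close> with \<open>x\<close> in
        \<open>D\<close> this is the tail of a series of nonnegative terms; positivity then carries
        over to the unit, where it bounds the partial sums of the squared norms of
        \<open>V\<^sub>ku\<close>.\<close>
      define h where "h = (\<lambda>A. cinner (\<Phi> A *\<^sub>V u) u - (\<Sum>k<N. cinner (A *\<^sub>V (V k *\<^sub>V u)) (V k *\<^sub>V u)))"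
      have h: "normal_functional h" unfolding h_def
        by (intro normal_functional_minus nf normal_functional_sum normal_functional_vector finite_lessThan)
      have "h (x \<boxtimes> x) \<in> \<real>\<^sub>\<ge>\<^sub>0" if "x \<in> D" for x
      proof -
        have k: "cinner ((x \<boxtimes> x) *\<^sub>V (V k *\<^sub>V u)) (V k *\<^sub>V u) = of_real ((cmod (cinner u (W k *\<^sub>V x)))\<^sup>2)" for k
          unfolding rank by (subst cinner_commute[of _ u]) (simp add: complex_norm_square del: of_real_power)
        note s = agree[OF that that, of u u, unfolded k]
        have re: "((\<lambda>k. (cmod (cinner u (W k *\<^sub>V x)))\<^sup>2) has_sum Re (cinner (\<Phi> (x \<boxtimes> x) *\<^sub>V u) u)) UNIV"
          using has_sum_Re[OF s] by (simp del: of_real_power)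
        have "Re (h (x \<boxtimes> x)) \<ge> 0"
          unfolding h_def k using finite_sum_le_has_sum[OF re, of "{..<N}"] by (simp del: of_real_power)
        moreover have "Im (h (x \<boxtimes> x)) = 0"
          unfolding h_def k using pos[OF that, of u] by (simp add: nonneg_Reals_iff_Re del: of_real_power)
        ultimately show ?thesis by (simp add: nonneg_Reals_iff_Re)
      qed
      from normal_functional_positive[OF separable h D this, of 1]
      have "0 \<le> Re (h 1)" by (simp add: nonneg_Reals_iff_Re)
      then show ?thesis by (simp add: h_def bop_simps cinner_self)
    qed
    have "summable (\<lambda>k. (norm (V k *\<^sub>V u))\<^sup>2)"
      by (rule bounded_imp_summable) (use partial[of "Suc n" for n] in \<open>auto simp: lessThan_Suc_atMost\<close>)
    then show ?thesis unfolding sq_summable_def by (rule summable_nonneg_imp_summable_on) simp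
  qed
  \<comment> \<open>Square-summability makes the series a normal functional of \<open>A\<close>, so
    its agreement with \<open>\<Phi>\<close> on rank one operators from \<open>D\<close> extends to
    every \<open>A\<close>.\<close>
  have "(\<lambda>k. cinner (A *\<^sub>V (V k *\<^sub>V u)) (V k *\<^sub>V w)) sums cinner (\<Phi> A *\<^sub>V u) w" for A u w
  proof -
    define g where "g A = (\<Sum>\<^sub>\<infinity>k. cinner (A *\<^sub>V (V k *\<^sub>V u)) (V k *\<^sub>V w))" for A
    have g: "((\<lambda>k. cinner (A *\<^sub>V (V k *\<^sub>V u)) (V k *\<^sub>V w)) has_sum g A) UNIV" for A
      unfolding g_def by (intro has_sum_infsum sq_summable_cinner sq_summable_bop sqV)
    have "normal_functional g" by (rule normal_functionalI[OF sqV sqV g])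
    then have "g A = cinner (\<Phi> A *\<^sub>V u) w"
    proof (rule normal_functional_eqI[OF separable _ nf D])
      show "g (x \<boxtimes> y) = cinner (\<Phi> (x \<boxtimes> y) *\<^sub>V u) w" if "x \<in> D" "y \<in> D" for x y
        by (rule has_sum_unique[OF g agree[OF that]])
    qed
    then show ?thesis using has_sum_imp_sums[OF g[of A]] by simp
  qed
  with VM show ?thesis by blast
qed

text \<open>The trace of \<open>(x \<boxtimes> y) * C\<close> is
  \<open>\<langle>Cx, y\<rangle>\<close>, so the defining duality, tested on rank one operators,
  fixes all matrix coefficients of \<open>C\<close>. That gives both the formula and the uniqueness
  which the description in \<open>predual_map\<close> requires.\<close>

lemma predual_map_rank_one:
  "predual_map \<Phi> (x\<^sub>0 \<boxtimes> x\<^sub>0) \<in> trace_class"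
  "cinner (predual_map \<Phi> (x\<^sub>0 \<boxtimes> x\<^sub>0) *\<^sub>V x) y = cinner (\<Phi> (x \<boxtimes> y) *\<^sub>V x\<^sub>0) x\<^sub>0"
proof -
  have tr: "op_trace (A * (u \<boxtimes> v)) = cinner (A *\<^sub>V u) v" for A and u v :: 'h
  proof -
    let ?a = "\<lambda>w n. if n = (0::nat) then w else 0 :: 'h"
    have sq: "sq_summable (?a w)" for w by (rule sq_summable_finite, rule finite_subset[of _ "{0}"]) auto
    have "nuclear (u \<boxtimes> v) (?a u) (?a v)"
      unfolding nuclear_def by (intro conjI sq allI, rule has_sum_finite_neutralI[of "{0}"])
        (auto simp: bop_simps cinner_scaleC_left mult.commute)
    from nuclear_op_trace[OF separable this, of A]
    have "op_trace (A * (u \<boxtimes> v)) = (\<Sum>\<^sub>\<infinity>k. cinner (A *\<^sub>V ?a u k) (?a v k))" .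
    also have "\<dots> = cinner (A *\<^sub>V u) v"
      by (rule infsumI, rule has_sum_finite_neutralI[of "{0}"]) auto
    finally show ?thesis .
  qed
  let ?P = "\<lambda>C. C \<in> trace_class \<and> (\<forall>A. op_trace (A * C) = op_trace (\<Phi> A * (x\<^sub>0 \<boxtimes> x\<^sub>0)))"
  have entry: "cinner (C *\<^sub>V x) y = cinner (\<Phi> (x \<boxtimes> y) *\<^sub>V x\<^sub>0) x\<^sub>0" if C: "?P C" for C x y
  proof -
    obtain a b where ab: "nuclear C a b" using nuclear_if_trace_class[OF separable] C by blast
    have "cinner (\<Phi> (x \<boxtimes> y) *\<^sub>V x\<^sub>0) x\<^sub>0 = op_trace ((x \<boxtimes> y) * C)" using C by (simp add: tr)
    also have "\<dots> = (\<Sum>\<^sub>\<infinity>k. cinner (a k) y * cinner x (b k))"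
      unfolding nuclear_op_trace[OF separable ab] by (simp add: bop_simps cinner_scaleC_left)
    also have "\<dots> = cinner (C *\<^sub>V x) y" by (rule infsumI) (use ab in \<open>simp add: nuclear_def\<close>)
    finally show ?thesis by simp
  qed
  obtain C where C: "C \<in> trace_class" "\<And>A. cinner (\<Phi> A *\<^sub>V x\<^sub>0) x\<^sub>0 = op_trace (A * C)"
    using normal_functional_as_trace[OF separable normal_extension_functional[OF M separable \<Phi>, of x\<^sub>0 x\<^sub>0]] by auto
  have PC: "?P C" using C by (simp add: tr)
  have "predual_map \<Phi> (x\<^sub>0 \<boxtimes> x\<^sub>0) = C"
    unfolding predual_map_def
  proof (rule the_equality[where P = ?P, OF PC])
    fix C' assume "?P C'"
    show "C' = C" by (rule bop_extI) (simp only: entry[OF \<open>?P C'\<close>] entry[OF PC])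
  qed
  then show "predual_map \<Phi> (x\<^sub>0 \<boxtimes> x\<^sub>0) \<in> trace_class"
    "cinner (predual_map \<Phi> (x\<^sub>0 \<boxtimes> x\<^sub>0) *\<^sub>V x) y = cinner (\<Phi> (x \<boxtimes> y) *\<^sub>V x\<^sub>0) x\<^sub>0"
    using C(1) entry[OF PC] by simp_all
qed

text \<open>By the bimodule property \<open>\<langle>\<Phi>(y \<boxtimes> y)A'x\<^sub>0, A'x\<^sub>0\<rangle>\<close> is a diagonal value of the predual at
  \<open>A'\<^sup>*y\<close>, and the vectors \<open>A'x\<^sub>0\<close> are dense.\<close>

lemma extension_positive_if_predual_positive:
  assumes pos: "positive_op (predual_map \<Phi> (x\<^sub>0 \<boxtimes> x\<^sub>0))"
  shows "positive_op (\<Phi> (y \<boxtimes> y))"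
  unfolding positive_op_def
proof
  fix u
  have "u \<in> closure {A *\<^sub>V x\<^sub>0 | A. A \<in> commutant M}"
    using commutant_orbit_dense[OF M sep] by simp
  then obtain a where a: "\<And>n. a n \<in> {A *\<^sub>V x\<^sub>0 | A. A \<in> commutant M}" "a \<longlonglongrightarrow> u"
    unfolding closure_sequential by auto
  have lim: "(\<lambda>n. cinner (\<Phi> (y \<boxtimes> y) *\<^sub>V a n) (a n)) \<longlonglongrightarrow> cinner (\<Phi> (y \<boxtimes> y) *\<^sub>V u) u"
    by (intro cinner.tendsto bop_apply_tendsto a)
  have mem: "cinner (\<Phi> (y \<boxtimes> y) *\<^sub>V a n) (a n) \<in> \<real>\<^sub>\<ge>\<^sub>0" for n
  proof -
    obtain A where A: "A \<in> commutant M" "a n = A *\<^sub>V x\<^sub>0" using a(1)[of n] by auto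
    have "cinner (\<Phi> (y \<boxtimes> y) *\<^sub>V a n) (a n) = cinner ((adj A * \<Phi> (y \<boxtimes> y) * A) *\<^sub>V x\<^sub>0) x\<^sub>0"
      unfolding A(2) times_bop.rep_eq cinner_adj_left ..
    also have "adj A * \<Phi> (y \<boxtimes> y) * A = \<Phi> (adj A * (y \<boxtimes> y) * A)"
      by (rule normal_extension_bimodule[OF M separable \<Phi> factor_commutant_adj[OF M A(1)] A(1) image_in_factor, symmetric])
    also have "adj A * (y \<boxtimes> y) * A = (adj A *\<^sub>V y) \<boxtimes> (adj A *\<^sub>V y)"
      by (simp add: mult_rank_one rank_one_mult)
    also have "cinner (\<Phi> ((adj A *\<^sub>V y) \<boxtimes> (adj A *\<^sub>V y)) *\<^sub>V x\<^sub>0) x\<^sub>0 \<in> \<real>\<^sub>\<ge>\<^sub>0"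
      using pos unfolding positive_op_def predual_map_rank_one(2)[symmetric] by blast
    finally show ?thesis .
  qed
  show "cinner (\<Phi> (y \<boxtimes> y) *\<^sub>V u) u \<in> \<real>\<^sub>\<ge>\<^sub>0"
    by (rule closed_sequentially[OF closed_nonneg_Reals_complex mem lim])
qed

end

lemma positive_op_rank_one: "positive_op (x \<boxtimes> x)"
  unfolding positive_op_def
proof
  fix z
  show "cinner ((x \<boxtimes> x) *\<^sub>V z) z \<in> \<real>\<^sub>\<ge>\<^sub>0"
    unfolding rank_one.rep_eq cinner_scaleC_left
    by (subst cinner_commute[of x z])
      (simp add: complex_norm_square[symmetric] nonneg_Reals_of_real_iff del: of_real_power)
qed

theorem theorem3p1:
  fixes M :: "'h::chilbert_space bop set" and x\<^sub>0 :: 'h and \<phi> :: "'h bop \<Rightarrow> 'h bop"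
  assumes "separable_space (euclidean :: 'h topology)"
    and "factor M"
    and "norm x\<^sub>0 = 1" and "cyclic_vector M x\<^sub>0" and "separating_vector M x\<^sub>0"
    and "\<phi> \<in> CB_sigma M"
  shows "(completely_positive_on M \<phi> \<longleftrightarrow> completely_positive_on UNIV (tilde M \<phi>))
    \<and> (completely_positive_on UNIV (tilde M \<phi>) \<longleftrightarrow> positive_map_on UNIV (tilde M \<phi>))
    \<and> (positive_map_on UNIV (tilde M \<phi>) \<longleftrightarrow> positive_op (C_op M x\<^sub>0 \<phi>))
    \<and> (positive_op (C_op M x\<^sub>0 \<phi>) \<longleftrightarrow> D_op M x\<^sub>0 \<phi> \<in> trace_class \<and> positive_op (D_op M x\<^sub>0 \<phi>))
    \<and> (D_op M x\<^sub>0 \<phi> \<in> trace_class \<and> positive_op (D_op M x\<^sub>0 \<phi>) \<longleftrightarrow>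
        (\<exists>V. (\<forall>i::nat. V i \<in> M)
          \<and> (\<forall>A\<in>M. wot_sums (\<lambda>i. Ad (V i) A) (\<phi> A))
          \<and> (\<exists>S. wot_sums (\<lambda>i. adj (V i) * V i) S
                \<and> positive_op (complex_of_real (cb_norm_on M \<phi>) *\<^sub>C 1 - S))))"
    (is "(?i \<longleftrightarrow> ?ii) \<and> (_ \<longleftrightarrow> ?iii) \<and> (_ \<longleftrightarrow> ?iv) \<and> (_ \<longleftrightarrow> ?v) \<and> (_ \<longleftrightarrow> ?vi)")
proof -
  note sep = assms(1) and M = assms(2) and x0 = assms(3) and sv = assms(5)
  define \<Phi> where "\<Phi> = tilde M \<phi>"
  have \<Phi>: "normal_extension M \<phi> \<Phi>"
    unfolding \<Phi>_def by (rule normal_extension_tilde[OF M sep assms(6)])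
  have \<phi>M: "\<phi> ` M \<subseteq> M" using assms(6) by (simp add: CB_sigma_def)
  have lin\<phi>: "linear_map_on M \<phi>" using assms(6) by (simp add: CB_sigma_def)
  have lin\<Phi>: "linear_map_on UNIV \<Phi>" using \<Phi> by (simp add: normal_extension_def)
  note Ceq = C_op_def[of M x\<^sub>0 \<phi>, folded \<Phi>_def] and Deq = D_op_def[of M x\<^sub>0 \<phi>, folded \<Phi>_def]
  have oneM: "1 \<in> M" by (rule factor_one[OF M])
  \<comment> \<open>The hub of the equivalences: (iv) implies it, and it implies both (ii) and
    (vi).\<close>
  let ?kraus = "\<exists>V. (\<forall>k::nat. V k \<in> M) \<and>
    (\<forall>A u w. (\<lambda>k. cinner (A *\<^sub>V (V k *\<^sub>V u)) (V k *\<^sub>V w)) sums cinner (\<Phi> A *\<^sub>V u) w)"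
  have iv_kraus: ?kraus if ?iv
    using that unfolding Ceq by (rule kraus_exists[OF M sep sv \<Phi> \<phi>M])
  have kraus_ii: ?ii if ?kraus
  proof -
    obtain V where V: "\<forall>A u w. (\<lambda>k::nat. cinner (A *\<^sub>V (V k *\<^sub>V u)) (V k *\<^sub>V w)) sums cinner (\<Phi> A *\<^sub>V u) w"
      using \<open>?kraus\<close> by blast
    show ?thesis
      unfolding \<Phi>_def[symmetric]
      by (rule completely_positive_if_kraus[OF lin\<Phi>, of V]) (rule V[rule_format])
  qed
  have ii_iii: ?iii if ?ii
    using that by (rule positive_map_if_completely_positive)
  have iii_rank_one: "positive_op (\<Phi> (x \<boxtimes> x))" if ?iii for x
    using that positive_op_rank_one[of x] unfolding \<Phi>_def positive_map_on_def by blast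
  have iii_iv: ?iv if ?iii
    unfolding Ceq by (rule iii_rank_one[OF that])
  have D_tc: "D_op M x\<^sub>0 \<phi> \<in> trace_class"
    unfolding Deq by (rule predual_map_rank_one(1)[OF M sep sv \<Phi> \<phi>M])
  have iii_v: ?v if ?iii
    using D_tc iii_rank_one[OF that] unfolding Deq positive_op_def
      predual_map_rank_one(2)[OF M sep sv \<Phi> \<phi>M] by blast
  have v_iv: ?iv if ?v
    using that unfolding Ceq Deq by (intro extension_positive_if_predual_positive[OF M sep sv \<Phi> \<phi>M]) blast
  have kraus_vi: ?vi if ?kraus
  proof -
    obtain V where V: "\<And>k::nat. V k \<in> M"
      "\<And>A u w. (\<lambda>k. cinner (A *\<^sub>V (V k *\<^sub>V u)) (V k *\<^sub>V w)) sums cinner (\<Phi> A *\<^sub>V u) w"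
      using \<open>?kraus\<close> by blast
    have V\<phi>: "(\<lambda>k. cinner (A *\<^sub>V (V k *\<^sub>V u)) (V k *\<^sub>V w)) sums cinner (\<phi> A *\<^sub>V u) w" if "A \<in> M" for A u w
      using V(2)[of A u w] unfolding normal_extension_eq[OF M sep \<Phi> that] .
    have "wot_sums (\<lambda>i. Ad (V i) A) (\<phi> A)" if "A \<in> M" for A
      using V\<phi>[OF that] by (simp add: wot_sums_def Ad_def bop_simps cinner_adj_left)
    \<comment> \<open>The witness for \<open>S\<close> is \<open>\<phi> 1\<close>, the Kraus sum
      evaluated at the unit.\<close>
    moreover have "wot_sums (\<lambda>i. adj (V i) * V i) (\<phi> 1)"
      using V\<phi>[OF oneM] by (simp add: wot_sums_def bop_simps cinner_adj_left)
    moreover have "positive_op (complex_of_real (cb_norm_on M \<phi>) *\<^sub>C 1 - \<phi> 1)"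
      unfolding positive_op_def
    proof
      fix u
      have "cinner (\<phi> 1 *\<^sub>V u) u \<in> \<real>\<^sub>\<ge>\<^sub>0"
        by (rule sums_nonneg_Reals[OF V\<phi>[OF oneM]])
          (simp add: bop_simps cinner_self nonneg_Reals_of_real_iff del: of_real_power)
      moreover have "Re (cinner (\<phi> 1 *\<^sub>V u) u) \<le> cb_norm_on M \<phi> * (norm u)\<^sup>2"
        by (rule kraus_le_cb_norm[OF V\<phi> oneM])
      ultimately show "cinner ((complex_of_real (cb_norm_on M \<phi>) *\<^sub>C 1 - \<phi> 1) *\<^sub>V u) u \<in> \<real>\<^sub>\<ge>\<^sub>0"
        by (simp add: nonneg_Reals_iff_Re bop_simps cinner.diff_left cinner_scaleC_left cinner_self
            del: of_real_power)
    qed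
    ultimately show ?thesis using V(1) by blast
  qed
  have vi_i: ?i if ?vi
  proof -
    obtain V where V: "\<forall>A\<in>M. wot_sums (\<lambda>i::nat. Ad (V i) A) (\<phi> A)" using \<open>?vi\<close> by blast
    show ?thesis
    proof (rule completely_positive_if_kraus[OF lin\<phi>])
      fix A u w assume "A \<in> M"
      with V show "(\<lambda>k. cinner (A *\<^sub>V (V k *\<^sub>V u)) (V k *\<^sub>V w)) sums cinner (\<phi> A *\<^sub>V u) w"
        by (simp add: wot_sums_def Ad_def bop_simps cinner_adj_left)
    qed
  qed
  have i_iv: ?iv if ?i
  proof -
    \<comment> \<open>Because \<open>x\<^sub>0\<close> is a unit vector,
      \<open>x\<^sub>0 \<boxtimes> x\<^sub>0\<close> is a projection and is therefore of the form
      \<open>Z\<^sup>*Z\<close>.\<close>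
    have "adj (x\<^sub>0 \<boxtimes> x\<^sub>0) = x\<^sub>0 \<boxtimes> x\<^sub>0" by (rule positive_op_adj[OF positive_op_rank_one])
    moreover have "(x\<^sub>0 \<boxtimes> x\<^sub>0) * (x\<^sub>0 \<boxtimes> x\<^sub>0) = x\<^sub>0 \<boxtimes> x\<^sub>0"
      unfolding mult_rank_one by (simp add: rank_one.rep_eq cinner_self x0)
    ultimately show ?thesis
      using normal_extension_positive_if_cp[OF M sep \<Phi> that, of "x\<^sub>0 \<boxtimes> x\<^sub>0"] \<phi>M unfolding Ceq by auto
  qed
  have "?i \<longleftrightarrow> ?iv" "?ii \<longleftrightarrow> ?iv" "?iii \<longleftrightarrow> ?iv" "?v \<longleftrightarrow> ?iv" "?vi \<longleftrightarrow> ?iv"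
    using iv_kraus kraus_ii ii_iii iii_iv iii_v v_iv kraus_vi vi_i i_iv by argo+
  then show ?thesis by argo
qed

end
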